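(* The height $\mathrm{H}(\mathsf{T}_n^\Omega)$ of the tree $\mathsf{T}_n^\Omega$ satisfies \[ \mathrm{H}(\mathsf{T}_n^\Omega) = \frac{\log n}{\log(1/\mathbb{E}[\xi])} + O_p(1), \] that is, the sequence of random variables $\mathrm{H}(\mathsf{T}_n^\Omega)-\log(n)/\log(1/\mathbb{E}[\xi])$ is stochastically bounded (tight) as $n\to\infty$.
   Context: Setting. $\xi$ is a random variable with values in $\mathbb{N}_0=\{0,1,2,\dots\}$ such that $\mathbb{P}(\xi=0)>0$, $\mathbb{P}(\xi\le 1)<1$, $\mathbb{E}[\xi]<1$, and there are a slowly varying function $f$ and a constant $\alpha>1$ with $\mathbb{P}(\xi=n)=f(n)n^{-1-\alpha}$ for all large enough integers $n$. $\Omega\subset\mathbb{N}_0$ is a fixed non-empty set with $\mathbb{P}(\xi\in\Omega)>0$ such that $\Omega$ or its complement $\mathbb{N}_0\setminus\Omega$ is finite. $\mathsf{T}$ is a Galton--Watson tree with offspring distribution $\xi$. The outdegree of a vertex is its number of children. For $n$ large enough, $\mathsf{T}_n^\Omega$ denotes $\mathsf{T}$ conditioned on having exactly $n$ vertices with outdegree in $\Omega$. The height of a finite rooted tree is the maximal graph distance of a vertex from the root. *)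

theory Defs
  imports "HOL-Probability.Probability"
begin

text \<open>
  Karamata's notion: the function only has to be positive and measurable on a neighbourhood
  of infinity.
\<close>

definition slowly_varying :: "(real \<Rightarrow> real) \<Rightarrow> bool" where
  "slowly_varying f \<longleftrightarrow>
     (\<exists>a. set_borel_measurable borel {a..} f \<and> (\<forall>x\<ge>a. f x > 0)) \<and>
     (\<forall>t>0. ((\<lambda>x. f (t * x) / f x) \<longlongrightarrow> 1) at_top)"

text \<open>
  Rooted plane trees in Ulam--Harris encoding: a tree is a set of words over the naturals,
  the root is the empty word and the children of \<open>v\<close> are words \<open>v @ [i]\<close>.  The graph
  distance of \<open>v\<close> from the root is thus \<open>length v\<close>.
\<close>

type_synonym plane_tree = "nat list set"

definition outdegree :: "plane_tree \<Rightarrow> nat list \<Rightarrow> nat" where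
  "outdegree T v = card {i. v @ [i] \<in> T}"

text \<open>Only meaningful for finite trees, like \<^const>\<open>Max\<close>.\<close>

definition tree_height :: "plane_tree \<Rightarrow> nat" where
  "tree_height T = Max (length ` T)"

definition vertices_outdegree_in :: "nat set \<Rightarrow> plane_tree \<Rightarrow> nat list set" where
  "vertices_outdegree_in \<Omega> T = {v \<in> T. outdegree T v \<in> \<Omega>}"

text \<open>The tree in which every vertex \<open>v\<close> has \<open>c v\<close> children.\<close>

inductive_set tree_of :: "(nat list \<Rightarrow> nat) \<Rightarrow> plane_tree" for c where
  root: "[] \<in> tree_of c"
| child: "v \<in> tree_of c \<Longrightarrow> i < c v \<Longrightarrow> v @ [i] \<in> tree_of c"

text \<open>
  An independent copy of the offspring variable for every potential vertex; under this
  measure, \<^const>\<open>tree_of\<close> is a Galton--Watson tree with offspring law \<open>\<xi>\<close>.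
\<close>

definition gw_space :: "nat pmf \<Rightarrow> (nat list \<Rightarrow> nat) measure" where
  "gw_space \<xi> = (\<Pi>\<^sub>M v\<in>UNIV. measure_pmf \<xi>)"

text \<open>
  The law \<^const>\<open>gw_space\<close> conditioned on the tree having exactly \<open>n\<close> vertices with outdegree
  in \<open>\<Omega>\<close>.  (Finiteness is required explicitly because \<^const>\<open>card\<close> is 0 on infinite sets.)
  If the event has probability 0, this is the null measure and not a probability measure.
\<close>

definition cond_gw_space :: "nat pmf \<Rightarrow> nat set \<Rightarrow> nat \<Rightarrow> (nat list \<Rightarrow> nat) measure" where
  "cond_gw_space \<xi> \<Omega> n =
     uniform_measure (gw_space \<xi>)
       {c \<in> space (gw_space \<xi>).
          finite (vertices_outdegree_in \<Omega> (tree_of c)) \<and>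
          card (vertices_outdegree_in \<Omega> (tree_of c)) = n}"

end

theory Submission
  imports Defs
begin

text \<open>
  Write \<open>m < 1\<close> for the mean of \<open>\<xi>\<close>, \<open>p\<^sub>k\<close> for its point probabilities, \<open>N\<close> for the number of vertices
  with outdegree in \<open>\<Omega>\<close> and \<open>H\<close> for the height.  The reason for the theorem is the one-big-jump
  principle: given \<open>N = n\<close>, the tree has a vertex of outdegree of order \<open>n\<close> at bounded height, and
  this vertex carries order \<open>n\<close> almost independent subcritical Galton--Watson trees.  As
  \<open>P(H \<ge> h)\<close> is of exact order \<open>m\<^sup>h\<close>, the highest of them has height \<open>log n / log (1/m) + O(1)\<close>.

  All estimates come from one identity.  Given that the root has \<open>k\<close> children, its \<open>k\<close> branches
  are independent copies of the tree and \<open>N\<close> is the sum of the values of \<open>N\<close> in the branches, plus 1 if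
  \<open>k \<in> \<Omega>\<close>.  So if the series \<open>F A\<close> has the coefficients \<open>P(N = l, A)\<close>, restricting the branches
  to events \<open>A\<^sub>i\<close> gives \<open>p\<^sub>k\<close> times the product of the \<open>F A\<^sub>i\<close> (\<open>prob_root_count\<close>).  Two facts on
  nonnegative power series control the result: the total mass is submultiplicative, and the sums
  \<open>\<Sum>k<K. F\<^sup>k\<close> of a (sub)probability series \<open>F\<close> have uniformly bounded coefficients, since these
  count expected visits of a renewal process.

  \<^item> A vertex is called big if its outdegree is at least \<open>\<delta> n\<close>.  An exponential moment bound for
    \<open>N\<close> on trees without big vertices shows that \<open>N = n\<close> without a big vertex has a probability that
    is polynomially small of any prescribed order, if \<open>\<delta>\<close> is small (\<open>no_big_polynomial_bound\<close>).

  \<^item> For \<open>k \<ge> \<delta> n\<close> regular variation gives \<open>p\<^sub>k \<le> C p\<^sub>n\<close>, so a big root together with \<open>N = l\<close> has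
    probability at most a constant times \<open>p\<^sub>n\<close>, uniformly in \<open>l\<close>.  Passing from the root to a child
    costs a factor \<open>m\<close>, so a big vertex at height \<open>j\<close> costs \<open>m\<^sup>j p\<^sub>n\<close> (\<open>big_at_bound\<close>).

  \<^item> Conversely \<open>P(N = n) \<ge> c p\<^sub>n\<close> (\<open>F_UNIV_ge_pmf\<close>), by making the root big and bounding the renewal
    function of \<open>N\<close> from below (\<open>renewal_lower_bound\<close>).

  \<^item> With a big vertex at height \<open>j\<close> the tree is higher than \<open>h\<close> only if one of about \<open>n\<close> branches of
    the big vertex reaches height \<open>h - j - 1\<close>, at an expected cost \<open>n m\<^sup>h\<^sup>-\<^sup>j\<^sup>-\<^sup>1\<close>, or if some other branch on
    the way does (\<open>big_at_high_bound\<close>).  It is lower than \<open>h\<close> only if all branches of the big vertex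
    are, which has probability at most \<open>(1 - c m\<^sup>h)\<close> to the power \<open>\<delta> n\<close> (\<open>big_at_low_bound\<close>).

  Summing over \<open>j\<close> and dividing by \<open>P(N = n)\<close> gives the two tails of \<open>H - log n / log (1/m)\<close>
  (\<open>conditioned_height_low\<close>, \<open>conditioned_height_high\<close>).
\<close>

section \<open>Power series with nonnegative coefficients\<close>

text \<open>
  Bounds on all partial sums rather than on a limit make convergence questions disappear.
  For \<open>z = 1\<close> and \<open>s \<le> 1\<close> the series is a subprobability distribution on the naturals; \<open>z > 1\<close> is used
  for exponential moments and \<open>z < 1\<close> for Laplace transforms.
\<close>

definition weight_le :: "real \<Rightarrow> real fps \<Rightarrow> real \<Rightarrow> bool" where
  "weight_le z F s \<longleftrightarrow> (\<forall>l. 0 \<le> fps_nth F l) \<and> (\<forall>L. (\<Sum>l\<le>L. fps_nth F l * z ^ l) \<le> s)"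

definition coeff_le :: "real fps \<Rightarrow> real \<Rightarrow> bool" where
  "coeff_le F b \<longleftrightarrow> (\<forall>l. 0 \<le> fps_nth F l \<and> fps_nth F l \<le> b)"

lemma weight_leD:
  assumes "weight_le z F s"
  shows "0 \<le> fps_nth F l" "(\<Sum>l\<le>L. fps_nth F l * z ^ l) \<le> s"
  using assms by (auto simp: weight_le_def)

lemma weight_le_nonneg: "weight_le z F s \<Longrightarrow> z \<ge> 0 \<Longrightarrow> s \<ge> 0"
  using weight_leD(1)[of z F s 0] weight_leD(2)[of z F s 0] by simp

lemma weight_le_mono: "weight_le z F s \<Longrightarrow> s \<le> t \<Longrightarrow> weight_le z F t"
  unfolding weight_le_def by (meson order_trans)

lemma weight_le_coeff:
  assumes "weight_le z F s" "z \<ge> 0"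
  shows "fps_nth F l * z ^ l \<le> s"
proof -
  have "fps_nth F l * z ^ l \<le> (\<Sum>l\<le>l. fps_nth F l * z ^ l)"
    using assms weight_leD(1)[OF assms(1)] by (intro member_le_sum) auto
  also have "\<dots> \<le> s" using weight_leD(2)[OF assms(1)] .
  finally show ?thesis .
qed

lemma weight_le_1: "weight_le z 1 1"
proof -
  have "(\<Sum>l\<le>L. fps_nth (1::real fps) l * z ^ l) = (\<Sum>l\<le>L. if l = 0 then 1 else 0)" for L
    by (intro sum.cong) (auto simp: fps_one_nth)
  thus ?thesis by (auto simp: weight_le_def fps_one_nth)
qed

lemma weight_le_X: "z \<ge> 0 \<Longrightarrow> weight_le z fps_X z"
proof -
  assume z: "z \<ge> 0"
  have "(\<Sum>l\<le>L. fps_nth (fps_X::real fps) l * z ^ l) = (\<Sum>l\<le>L. if l = 1 then z else 0)" for L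
    by (intro sum.cong) (auto simp: fps_X_def)
  thus ?thesis using z by (auto simp: weight_le_def fps_X_def)
qed

lemma weight_le_mult:
  assumes F: "weight_le z F s" and G: "weight_le z G t" and z: "z \<ge> 0"
  shows "weight_le z (F * G) (s * t)"
  unfolding weight_le_def
proof (intro conjI allI)
  fix l show "0 \<le> fps_nth (F * G) l"
    unfolding fps_mult_nth using F G by (intro sum_nonneg mult_nonneg_nonneg) (auto dest: weight_leD)
next
  fix L
  let ?f = "\<lambda>i. fps_nth F i * z ^ i" and ?g = "\<lambda>i. fps_nth G i * z ^ i"
  have nn: "?f i \<ge> 0" "?g i \<ge> 0" for i
    using weight_leD(1)[OF F, of i] weight_leD(1)[OF G, of i] z by simp_all
  have "(\<Sum>l\<le>L. fps_nth (F * G) l * z ^ l) = (\<Sum>l\<le>L. \<Sum>i\<le>l. ?f i * ?g (l - i))"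
    unfolding fps_mult_nth sum_distrib_right atLeast0AtMost
    by (intro sum.cong refl) (auto simp: power_add[symmetric] algebra_simps)
  also have "\<dots> = (\<Sum>(l,i)\<in>Sigma {..L} (\<lambda>l. {..l}). ?f i * ?g (l - i))"
    by (simp add: sum.Sigma)
  also have "\<dots> = (\<Sum>(i,j)\<in>(\<lambda>(l,i). (i, l - i)) ` Sigma {..L} (\<lambda>l. {..l}). ?f i * ?g j)"
    by (subst sum.reindex) (auto simp: inj_on_def case_prod_unfold)
  also have "\<dots> \<le> (\<Sum>(i,j)\<in>{..L} \<times> {..L}. ?f i * ?g j)"
    using nn by (intro sum_mono2) auto
  also have "\<dots> = (\<Sum>i\<le>L. ?f i) * (\<Sum>j\<le>L. ?g j)"
    by (simp add: sum_product sum.cartesian_product)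
  also have "\<dots> \<le> s * t"
    using weight_leD[OF F] weight_leD[OF G] z weight_le_nonneg[OF F z]
    by (intro mult_mono sum_nonneg) auto
  finally show "(\<Sum>l\<le>L. fps_nth (F * G) l * z ^ l) \<le> s * t" .
qed

lemma weight_le_prod:
  assumes "finite I" "\<And>i. i \<in> I \<Longrightarrow> weight_le z (F i) (s i)" "z \<ge> 0"
  shows "weight_le z (\<Prod>i\<in>I. F i) (\<Prod>i\<in>I. s i)"
  using assms by (induction I rule: finite_induct) (auto intro: weight_le_mult weight_le_1)

lemma weight_le_power: "weight_le z F s \<Longrightarrow> z \<ge> 0 \<Longrightarrow> weight_le z (F ^ k) (s ^ k)"
  by (induction k) (auto intro: weight_le_mult weight_le_1)

lemma weight_le_power1: "weight_le z F 1 \<Longrightarrow> z \<ge> 0 \<Longrightarrow> weight_le z (F ^ k) 1"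
  using weight_le_power[of z F 1 k] by simp

lemma coeff_leD:
  assumes "coeff_le F b" shows "0 \<le> fps_nth F l" "fps_nth F l \<le> b"
  using assms by (auto simp: coeff_le_def)

lemma coeff_le_nonneg: "coeff_le F b \<Longrightarrow> 0 \<le> b"
  unfolding coeff_le_def by (meson order_trans)

text \<open>
  Convolving a bounded sequence with a measure of mass \<open>t\<close> multiplies the bound by at most \<open>t\<close>; the
  factor \<open>F\<close> holds the event of interest and \<open>G\<close> everything independent of it.
\<close>

lemma coeff_le_mult:
  assumes F: "coeff_le F b" and G: "weight_le 1 G t"
  shows "coeff_le (F * G) (b * t)"
  unfolding coeff_le_def
proof (intro allI conjI)
  fix l
  show "0 \<le> fps_nth (F * G) l"
    unfolding fps_mult_nth using F G
    by (intro sum_nonneg mult_nonneg_nonneg) (auto dest: weight_leD coeff_leD)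
  have "fps_nth (F * G) l \<le> (\<Sum>i=0..l. b * fps_nth G (l - i))"
    unfolding fps_mult_nth using F G
    by (intro sum_mono mult_right_mono) (auto dest: weight_leD coeff_leD)
  also have "\<dots> = b * (\<Sum>i\<le>l. fps_nth G (l - i))"
    by (simp add: sum_distrib_left atLeast0AtMost)
  also have "(\<Sum>i\<le>l. fps_nth G (l - i)) = (\<Sum>i\<le>l. fps_nth G i)"
    by (rule sum.nat_diff_reindex[of _ "Suc l", unfolded lessThan_Suc_atMost diff_Suc_Suc diff_Suc_1, simplified]) 
  also have "b * \<dots> \<le> b * t"
    using weight_leD(2)[OF G, of l] coeff_le_nonneg[OF F] by (intro mult_left_mono) auto
  finally show "fps_nth (F * G) l \<le> b * t" .
qed

text \<open>
  Coefficient \<open>l\<close> of the sum is the expected number of visits to \<open>l\<close> by a renewal process with step law \<open>F\<close>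
  before time \<open>K\<close>.  A visited state is held for a geometric time because only steps of size 0 stay
  there, whence the bound.  Formally, the sums \<open>U\<close> satisfy the recursion \<open>1 + F * U\<close>, and the bound \<open>B\<close>
  reproduces itself because \<open>1 + q * B = B\<close>.
\<close>

lemma coeff_le_geometric_sum:
  assumes F: "weight_le 1 F 1" and q: "fps_nth F 0 \<le> q" "q < 1"
  shows "coeff_le (\<Sum>k<K. F ^ k) (1 / (1 - q))"
proof (induction K)
  case 0
  show ?case using q by (auto simp: coeff_le_def)
next
  case (Suc K)
  define B where "B = 1 / (1 - q)"
  define U where "U = (\<Sum>k<K. F ^ k)"
  have U: "coeff_le U B" using Suc by (simp add: U_def B_def)
  have B: "B \<ge> 1" "1 + q * B = B" using q weight_leD(1)[OF F, of 0] by (auto simp: B_def field_simps)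
  have rec: "(\<Sum>k<Suc K. F ^ k) = 1 + F * U"
    by (simp add: sum.lessThan_Suc_shift U_def sum_distrib_left del: sum.lessThan_Suc)
  have FU: "coeff_le (F * U) B"
    using coeff_le_mult[OF U F] by (simp add: mult.commute)
  have "fps_nth (1 + F * U) l \<le> B" for l
  proof (cases "l = 0")
    case True
    have "fps_nth F 0 * fps_nth U 0 \<le> q * B"
      using q coeff_leD[OF U, of 0] weight_leD(1)[OF F, of 0] by (intro mult_mono) auto
    thus ?thesis using True B by simp
  next
    case False
    thus ?thesis using coeff_leD[OF FU, of l] by simp
  qed
  moreover have "fps_nth (1 + F * U) l \<ge> 0" for l
    using coeff_leD[OF FU, of l] by (simp add: fps_one_nth)
  ultimately show ?case unfolding rec B_def[symmetric] by (auto simp: coeff_le_def)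
qed

text \<open>
  For a proper step law \<open>Q\<close> of finite mean, the renewal process has a probability bounded below of hitting a far
  window of fixed length \<open>W\<close>, since jumping over it means a step longer than \<open>W\<close>.  From any point of the
  window it hits \<open>n\<close> in one more step with a probability bounded below, because the window is placed
  at a distance from \<open>n\<close> where all step probabilities are positive.  A linear number of steps suffices,
  because after \<open>b * n\<close> steps the process has left \<open>{..n}\<close> up to an exponentially small probability.
\<close>

lemma renewal_lower_bound:
  fixes Q :: "real fps"
  assumes nn: "\<And>l. 0 \<le> fps_nth Q l"
    and sums1: "fps_nth Q sums 1"
    and q0: "fps_nth Q 0 < 1"
    and tail: "summable (\<lambda>j. 1 - (\<Sum>i\<le>j. fps_nth Q i))"
    and pos: "\<forall>\<^sub>F j in sequentially. fps_nth Q j > 0"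
  shows "\<exists>b c. b > 0 \<and> c > 0 \<and>
    (\<forall>\<^sub>F n in sequentially. \<forall>K\<ge>b * n. (\<Sum>k<K. fps_nth (Q ^ k) n) \<ge> c)"
proof -
  define Qb where "Qb = (\<lambda>j. 1 - (\<Sum>i\<le>j. fps_nth Q i))"
  have part: "(\<Sum>i\<le>j. fps_nth Q i) \<le> 1" for j
    using sum_le_suminf[of "fps_nth Q" "{..j}"] nn sums1 by (simp add: sums_iff)
  have Qb: "Qb j \<ge> 0" "Qb j \<le> 1" for j
    using part[of j] sum_nonneg[of "{..j}" "fps_nth Q"] nn by (auto simp: Qb_def)
  have Q1: "weight_le 1 Q 1" using nn part by (auto simp: weight_le_def)
  define q where "q = fps_nth Q 0"
  define B where "B = 1 / (1 - q)"
  have B: "B > 0" using q0 by (simp add: B_def q_def)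
  define \<rho> where "\<rho> = q + exp (-1) * (1 - q)"
  have \<rho>: "0 < \<rho>" "\<rho> < 1"
  proof -
    have "(1 - q) * exp (-1) > 0" using q0 by (simp add: q_def)
    moreover have "(1 - q) * exp (-1) < 1 - q"
      using q0 mult_strict_left_mono[of "exp (-1)" 1 "1 - q"] by (simp add: q_def)
    moreover have "q \<ge> 0" using nn[of 0] by (simp add: q_def)
    ultimately show "0 < \<rho>" "\<rho> < 1" unfolding \<rho>_def mult.commute[of "exp (-1)"] by linarith+
  qed
  \<comment> \<open>Laplace transform of a step at 1, bounded by moving all positive steps to 1\<close>
  have Qe: "weight_le (exp (-1)) Q \<rho>"
    unfolding weight_le_def
  proof (intro conjI allI nn)
    fix L
    have "(\<Sum>l\<le>L. fps_nth Q l * exp (-1) ^ l) \<le> (\<Sum>l\<le>L. fps_nth Q l * (exp (-1) + (if l = 0 then 1 - exp (-1) else 0)))"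
    proof (intro sum_mono mult_left_mono nn)
      fix l :: nat
      show "exp (-1) ^ l \<le> exp (-1) + (if l = 0 then 1 - exp (-1) else (0::real))"
        using power_decreasing[of 1 l "exp (-1::real)"] by (cases "l = 0") auto
    qed
    also have "\<dots> = (\<Sum>l\<le>L. exp (-1) * fps_nth Q l + (if l = 0 then q * (1 - exp (-1)) else 0))"
      by (intro sum.cong) (auto simp: q_def algebra_simps)
    also have "\<dots> = exp (-1) * (\<Sum>l\<le>L. fps_nth Q l) + q * (1 - exp (-1))"
      by (simp add: sum.distrib sum_distrib_left)
    also have "\<dots> \<le> exp (-1) * 1 + q * (1 - exp (-1))"
      using part[of L] by (intro add_right_mono mult_left_mono) auto
    also have "\<dots> = \<rho>" by (simp add: \<rho>_def algebra_simps)
    finally show "(\<Sum>l\<le>L. fps_nth Q l * exp (-1) ^ l) \<le> \<rho>" .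
  qed
  have Qk: "fps_nth (Q ^ k) l \<le> exp (real l) * \<rho> ^ k" for k l
  proof -
    have "fps_nth (Q ^ k) l * exp (-1) ^ l \<le> \<rho> ^ k"
      by (intro weight_le_coeff weight_le_power Qe) auto
    thus ?thesis by (simp add: exp_of_nat_mult[symmetric] exp_minus field_simps)
  qed
  have Qknn: "fps_nth (Q ^ k) l \<ge> 0" for k l
    using weight_le_power1[OF Q1, of k] by (auto dest: weight_leD)
  obtain b :: nat where b: "\<rho> ^ b < exp (-2)"
    using real_arch_pow_inv[of "exp (-2)" \<rho>] \<rho> by auto
  have b0: "b > 0"
  proof (rule ccontr)
    assume "\<not> b > 0" hence "b = 0" by simp
    with b have "1 < exp (-2::real)" by simp
    thus False by simp
  qed
  have QK: "fps_nth (Q ^ K) l \<le> exp (- real n)" if "K \<ge> b * n" "l \<le> n" for K l n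
  proof -
    have "fps_nth (Q ^ K) l \<le> exp (real l) * \<rho> ^ K" by (rule Qk)
    also have "\<dots> \<le> exp (real n) * \<rho> ^ (b * n)"
      using that \<rho> by (intro mult_mono power_decreasing) auto
    also have "\<rho> ^ (b * n) = (\<rho> ^ b) ^ n" by (simp add: power_mult)
    also have "\<dots> \<le> exp (-2) ^ n" using b \<rho> by (intro power_mono) auto
    also have "exp (real n) * exp (-2) ^ n = exp (- real n)"
      by (simp add: exp_of_nat_mult[symmetric] exp_add[symmetric] mult.commute)
    finally show ?thesis by simp
  qed
  \<comment> \<open>The expected number of jumps over the last \<open>j\<close> positions from the one before them is at most \<open>B * Qb j\<close>;
      summed over \<open>j \<ge> W\<close> this is at most \<open>1/4\<close>.\<close>
  obtain W where W: "\<And>l. (\<Sum>j\<in>{W..l}. Qb j) \<le> 1 / (4 * B)"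
  proof -
    have "summable Qb" using tail by (simp add: Qb_def)
    then obtain W where W: "\<And>m n. W \<le> m \<Longrightarrow> norm (\<Sum>j\<in>{m..<n}. Qb j) < 1 / (4 * B)"
      using B unfolding summable_Cauchy by (meson divide_pos_pos mult_pos_pos zero_less_numeral zero_less_one)
    show ?thesis
    proof (rule that[of W])
      fix l
      have "norm (\<Sum>j\<in>{W..<Suc l}. Qb j) < 1 / (4 * B)" by (rule W) simp
      thus "(\<Sum>j\<in>{W..l}. Qb j) \<le> 1 / (4 * B)" by (simp add: atLeastLessThanSuc_atLeastAtMost)
    qed
  qed
  obtain j0 where j0: "\<And>j. j \<ge> j0 \<Longrightarrow> fps_nth Q j > 0"
    using pos by (auto simp: eventually_sequentially)
  define d where "d = Min (fps_nth Q ` {j0..j0+W})"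
  have d: "d > 0" unfolding d_def using j0 by (subst Min_gr_iff) auto
  have dQ: "d \<le> fps_nth Q j" if "j \<in> {j0..j0+W}" for j unfolding d_def using that by (intro Min_le) auto
  have lim0: "((\<lambda>n. (real n + 1) * exp (- real n)) \<longlonglongrightarrow> 0)"
  proof -
    have "((\<lambda>x::real. x ^ 1 / exp x) \<longlongrightarrow> 0) at_top" by (rule tendsto_power_div_exp_0)
    moreover have "((\<lambda>x::real. x ^ 0 / exp x) \<longlongrightarrow> 0) at_top" by (rule tendsto_power_div_exp_0)
    ultimately have "((\<lambda>x::real. x ^ 1 / exp x + x ^ 0 / exp x) \<longlongrightarrow> 0 + 0) at_top" by (rule tendsto_add)
    moreover have "(\<lambda>x::real. x ^ 1 / exp x + x ^ 0 / exp x) = (\<lambda>x. (x + 1) * exp (- x))"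
      by (simp add: fun_eq_iff exp_minus divide_inverse distrib_right)
    ultimately have "((\<lambda>x::real. (x + 1) * exp (- x)) \<longlongrightarrow> 0) at_top" by simp
    from filterlim_compose[OF this filterlim_real_sequentially] show ?thesis .
  qed
  have ev: "\<forall>\<^sub>F n in sequentially. (real n + 1) * exp (- real n) < min (1/2) (d / 8)"
    using lim0 d by (intro order_tendstoD) auto
  have main: "(\<Sum>k<K. fps_nth (Q ^ k) n) \<ge> d / 8"
    if n: "(real n + 1) * exp (- real n) < min (1/2) (d / 8)" "n \<ge> j0 + W" "n \<ge> 1" and K: "K \<ge> b * n" for n K
  proof -
    define U where "U = (\<Sum>k<K. Q ^ k)"
    have U: "coeff_le U B" unfolding U_def B_def by (rule coeff_le_geometric_sum[OF Q1]) (use q0 in \<open>auto simp: q_def\<close>)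
    have rec: "U + Q ^ K = 1 + Q * U"
    proof -
      have "U + Q ^ K = (\<Sum>k<Suc K. Q ^ k)" by (simp add: U_def)
      also have "\<dots> = 1 + Q * U" by (simp add: sum.lessThan_Suc_shift U_def sum_distrib_left del: sum.lessThan_Suc)
      finally show ?thesis .
    qed
    define l where "l = n - j0"
    have l: "l \<le> n" "W \<le> l" "n - l = j0" using n by (auto simp: l_def)
    \<comment> \<open>Decomposition according to the last position \<open>r \<le> l\<close> of the process: the total is the
        probability of having passed \<open>l\<close> within \<open>K\<close> steps.\<close>
    have "(\<Sum>r\<le>l. fps_nth U r * Qb (l - r)) = (\<Sum>r\<le>l. fps_nth U r) - (\<Sum>r\<le>l. \<Sum>i\<le>l-r. fps_nth U r * fps_nth Q i)"
      by (simp add: Qb_def algebra_simps sum_subtractf sum_distrib_left)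
    also have "(\<Sum>r\<le>l. \<Sum>i\<le>l-r. fps_nth U r * fps_nth Q i) = (\<Sum>s\<le>l. fps_nth (U * Q) s)"
    proof -
      have "(\<Sum>r\<le>l. \<Sum>i\<le>l-r. fps_nth U r * fps_nth Q i) = (\<Sum>(r,i)\<in>{(i,j). i + j \<le> l}. fps_nth U r * fps_nth Q i)"
        by (subst sum.Sigma) (auto intro!: sum.cong)
      also have "\<dots> = (\<Sum>s\<le>l. \<Sum>i\<le>s. fps_nth U i * fps_nth Q (s - i))"
        by (rule sum.triangle_reindex_eq)
      finally show ?thesis by (simp add: fps_mult_nth atLeast0AtMost)
    qed
    also have "(\<Sum>r\<le>l. fps_nth U r) - \<dots> = (\<Sum>s\<le>l. fps_nth (U - Q * U) s)"
      by (simp add: sum_subtractf mult.commute)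
    also have "U - Q * U = 1 - Q ^ K" using rec by (simp add: algebra_simps)
    also have "(\<Sum>s\<le>l. fps_nth (1 - Q ^ K) s) = 1 - (\<Sum>s\<le>l. fps_nth (Q ^ K) s)"
      by (simp add: sum_subtractf fps_one_nth)
    also have "\<dots> \<ge> 1 - (\<Sum>s\<le>l. exp (- real n))"
      using QK[OF K] l by (intro diff_left_mono sum_mono) auto
    finally have "1 - (real l + 1) * exp (- real n) \<le> (\<Sum>r\<le>l. fps_nth U r * Qb (l - r))" by (simp add: add.commute)
    moreover have "(real l + 1) * exp (- real n) \<le> (real n + 1) * exp (- real n)"
      using l by (intro mult_right_mono) auto
    ultimately have "1/2 \<le> (\<Sum>r\<le>l. fps_nth U r * Qb (l - r))" using n by linarith
    also have "{..l} = {..<l-W} \<union> {l-W..l}" by auto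
    also have "(\<Sum>r\<in>{..<l-W} \<union> {l-W..l}. fps_nth U r * Qb (l - r)) =
        (\<Sum>r\<in>{..<l-W}. fps_nth U r * Qb (l - r)) + (\<Sum>r\<in>{l-W..l}. fps_nth U r * Qb (l - r))"
      by (rule sum.union_disjoint) auto
    also have "\<dots> \<le> (\<Sum>r\<in>{..<l-W}. B * Qb (l - r)) + (\<Sum>r\<in>{l-W..l}. fps_nth U r * 1)"
      using coeff_leD[OF U] Qb by (intro add_mono sum_mono mult_right_mono mult_left_mono) auto
    also have "(\<Sum>r\<in>{..<l-W}. B * Qb (l - r)) = B * (\<Sum>r\<in>{..<l-W}. Qb (l - r))"
      by (simp add: sum_distrib_left)
    also have "(\<Sum>r\<in>{..<l-W}. Qb (l - r)) = (\<Sum>j\<in>{W+1..l}. Qb j)"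
      by (rule sum.reindex_bij_witness[of _ "\<lambda>j. l - j" "\<lambda>j. l - j"]) (auto simp: less_diff_conv2 l)
    also have "\<dots> \<le> (\<Sum>j\<in>{W..l}. Qb j)" using Qb by (intro sum_mono2) auto
    also have "\<dots> \<le> 1 / (4 * B)" by (rule W)
    also have "B * \<dots> = 1/4" using B by simp
    finally have win: "1/4 \<le> (\<Sum>r\<in>{l-W..l}. fps_nth U r)" using B by simp
    have "d * (1/4) \<le> d * (\<Sum>r\<in>{l-W..l}. fps_nth U r)" using win d by (intro mult_left_mono) auto
    also have "\<dots> = (\<Sum>r\<in>{l-W..l}. d * fps_nth U r)" by (simp add: sum_distrib_left)
    also have "\<dots> \<le> (\<Sum>r\<in>{l-W..l}. fps_nth Q (n - r) * fps_nth U r)"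
      using coeff_leD[OF U] l n by (intro sum_mono mult_right_mono dQ) (auto simp: l_def)
    also have "\<dots> \<le> (\<Sum>r\<in>{0..n}. fps_nth Q (n - r) * fps_nth U r)"
      using coeff_leD[OF U] nn l by (intro sum_mono2) auto
    also have "\<dots> = fps_nth (U * Q) n"
      unfolding fps_mult_nth by (intro sum.cong) auto
    also have "\<dots> = fps_nth (U + Q ^ K) n" using rec n(3) by (simp add: mult.commute)
    also have "\<dots> = fps_nth U n + fps_nth (Q ^ K) n" by simp
    also have "fps_nth (Q ^ K) n \<le> exp (- real n)" by (rule QK[OF K]) simp
    also have "exp (- real n) \<le> (real n + 1) * exp (- real n)" by simp
    finally have "fps_nth U n \<ge> d / 8" using n by linarith
    thus ?thesis by (simp add: U_def fps_sum_nth)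
  qed
  have "\<forall>\<^sub>F n in sequentially. \<forall>K\<ge>b * n. (\<Sum>k<K. fps_nth (Q ^ k) n) \<ge> d / 8"
    using ev eventually_ge_at_top[of "j0 + W"] eventually_ge_at_top[of 1]
    by eventually_elim (use main in auto)
  thus ?thesis using b0 d by (intro exI[of _ b] exI[of _ "d/8"]) auto
qed

section \<open>Slowly varying functions\<close>

text \<open>
  The uniform convergence theorem for slowly varying functions, in additive notation.
  If uniformity fails along points \<open>x\<^sub>k\<close> and shifts \<open>s\<^sub>k\<close>, pointwise convergence at \<open>x\<^sub>k\<close> and at \<open>x\<^sub>k + s\<^sub>k\<close>
  holds uniformly on subsets of \<open>[0,2]\<close> of measure above \<open>7/4\<close>.  These two sets, the second shifted by \<open>s\<^sub>k\<close>,
  lie in \<open>[0,3]\<close> and so must meet; a common point bounds the difference between \<open>x\<^sub>k\<close> and \<open>x\<^sub>k + s\<^sub>k\<close>.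
\<close>

lemma additive_slow_variation_uniform:
  fixes h :: "real \<Rightarrow> real"
  assumes meas [measurable]: "h \<in> borel_measurable borel"
    and lim: "\<And>s. ((\<lambda>x. h (x + s) - h x) \<longlongrightarrow> 0) at_top"
    and \<eta>: "\<eta> > 0"
  shows "\<exists>X. \<forall>x\<ge>X. \<forall>s\<in>{0..1}. \<bar>h (x + s) - h x\<bar> \<le> \<eta>"
proof (rule ccontr)
  assume "\<not> ?thesis"
  hence "\<forall>n::nat. \<exists>x s. x \<ge> real n \<and> s \<in> {0..1} \<and> \<bar>h (x + s) - h x\<bar> > \<eta>"
    by (meson not_le)
  then obtain x s where xs: "\<And>n::nat. x n \<ge> real n" "\<And>n. s n \<in> {0..1}"
     "\<And>n. \<bar>h (x n + s n) - h (x n)\<bar> > \<eta>"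
    by metis
  have big: "\<exists>N. \<forall>n\<ge>N. measure lebesgue {u \<in> {0..2}. \<forall>k\<ge>n. \<bar>h (y k + u) - h (y k)\<bar> \<le> \<eta> / 2} > 7/4"
    if y: "filterlim y at_top sequentially" for y :: "nat \<Rightarrow> real"
  proof -
    define V where "V = (\<lambda>n. {u \<in> {0..2}. \<forall>k\<ge>n. \<bar>h (y k + u) - h (y k)\<bar> \<le> \<eta> / 2})"
    have V [measurable]: "V n \<in> sets borel" for n
    proof -
      have "{u \<in> space borel. u \<in> {0..2} \<and> (\<forall>k\<ge>n. \<bar>h (y k + u) - h (y k)\<bar> \<le> \<eta> / 2)} \<in> sets borel"
        by measurable
      thus ?thesis by (simp add: V_def)
    qed
    have un: "(\<Union>n. V n) = {0..2}"
    proof (rule equalityI; rule subsetI)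
      fix u :: real assume u: "u \<in> {0..2}"
      have "((\<lambda>k. h (y k + u) - h (y k)) \<longlongrightarrow> 0) sequentially"
        by (rule filterlim_compose[OF lim y])
      hence "\<forall>\<^sub>F k in sequentially. \<bar>h (y k + u) - h (y k)\<bar> < \<eta> / 2"
        using \<eta> by (auto dest!: tendstoD[where e = "\<eta>/2"] simp: dist_real_def)
      then obtain n where "\<And>k. k \<ge> n \<Longrightarrow> \<bar>h (y k + u) - h (y k)\<bar> < \<eta> / 2"
        by (auto simp: eventually_sequentially)
      hence "u \<in> V n" using u by (auto simp: V_def less_imp_le)
      thus "u \<in> (\<Union>n. V n)" by blast
    qed (auto simp: V_def)
    have "(\<lambda>n. measure lebesgue (V n)) \<longlonglongrightarrow> measure lebesgue (\<Union>n. V n)"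
    proof (rule Lim_measure_incseq)
      show "incseq V" by (auto simp: incseq_def V_def)
      show "range V \<subseteq> sets lebesgue" using V by (auto intro: sets_completionI_sets)
      show "emeasure lebesgue (\<Union>n. V n) \<noteq> \<infinity>" unfolding un by simp
    qed
    hence "(\<lambda>n. measure lebesgue (V n)) \<longlonglongrightarrow> 2" by (simp add: un)
    hence "\<forall>\<^sub>F n in sequentially. measure lebesgue (V n) > 7/4"
      by (rule order_tendstoD) simp
    thus ?thesis by (simp add: V_def eventually_sequentially)
  qed
  have lx: "filterlim x at_top sequentially"
    by (rule filterlim_at_top_mono[OF filterlim_real_sequentially]) (use xs in auto)
  have ly: "filterlim (\<lambda>n. x n + s n) at_top sequentially"
    by (rule filterlim_at_top_mono[OF lx]) (use xs in auto)
  obtain n where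
    n: "measure lebesgue {u \<in> {0..2}. \<forall>k\<ge>n. \<bar>h (x k + u) - h (x k)\<bar> \<le> \<eta> / 2} > 7/4"
       "measure lebesgue {u \<in> {0..2}. \<forall>k\<ge>n. \<bar>h (x k + s k + u) - h (x k + s k)\<bar> \<le> \<eta> / 2} > 7/4"
    using big[OF lx] big[OF ly] by (meson max.cobounded1 max.cobounded2)
  define V where "V = {u \<in> {0..2}. \<forall>k\<ge>n. \<bar>h (x k + u) - h (x k)\<bar> \<le> \<eta> / 2}"
  define W where "W = {u \<in> {0..2}. \<forall>k\<ge>n. \<bar>h (x k + s k + u) - h (x k + s k)\<bar> \<le> \<eta> / 2}"
  have Vm: "V \<in> lmeasurable"
  proof -
    have "{u \<in> space borel. u \<in> {0..2} \<and> (\<forall>k\<ge>n. \<bar>h (x k + u) - h (x k)\<bar> \<le> \<eta> / 2)} \<in> sets borel"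
      by measurable
    thus ?thesis unfolding V_def
      by (intro bounded_set_imp_lmeasurable sets_completionI_sets) (auto intro: bounded_subset[OF bounded_closed_interval[of 0 2]])
  qed
  have Wm: "W \<in> lmeasurable"
  proof -
    have "{u \<in> space borel. u \<in> {0..2} \<and> (\<forall>k\<ge>n. \<bar>h (x k + s k + u) - h (x k + s k)\<bar> \<le> \<eta> / 2)} \<in> sets borel"
      by measurable
    thus ?thesis unfolding W_def
      by (intro bounded_set_imp_lmeasurable sets_completionI_sets) (auto intro: bounded_subset[OF bounded_closed_interval[of 0 2]])
  qed
  define W' where "W' = (+) (s n) ` W"
  have W'm: "W' \<in> lmeasurable" "measure lebesgue W' = measure lebesgue W"
    using Wm by (auto simp: W'_def measurable_translation measure_translation)
  have "V \<inter> W' \<noteq> {}"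
  proof
    assume "V \<inter> W' = {}"
    hence "measure lebesgue (V \<union> W') = measure lebesgue V + measure lebesgue W'"
      using Vm W'm by (intro measure_Un2[THEN trans]) (auto simp: Diff_triv Int_commute)
    moreover have "measure lebesgue (V \<union> W') \<le> measure lebesgue {0..3::real}"
    proof (rule measure_mono_fmeasurable)
      have "V \<subseteq> {0..2}" "W \<subseteq> {0..2}" unfolding V_def W_def by blast+
      thus "V \<union> W' \<subseteq> {0..3}" using xs(2)[of n] unfolding W'_def by fastforce
    qed (use Vm W'm in auto)
    moreover have "measure lebesgue V > 7/4" "measure lebesgue W > 7/4"
      using n unfolding V_def W_def by blast+
    moreover have "measure lebesgue {0..3::real} = 3" by simp
    ultimately show False using W'm(2) by linarith
  qed
  then obtain w where "s n + w \<in> V" "w \<in> W" by (auto simp: W'_def)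
  hence "\<bar>h (x n + (s n + w)) - h (x n)\<bar> \<le> \<eta> / 2" "\<bar>h (x n + s n + w) - h (x n + s n)\<bar> \<le> \<eta> / 2"
    unfolding V_def W_def by blast+
  moreover have "x n + (s n + w) = x n + s n + w" by simp
  ultimately show False using xs(3)[of n] by argo
qed

text \<open>
  A form of Potter's bound: \<open>f y / f x\<close> lies between powers of \<open>y / x\<close> with small exponents, up to a constant.
  Uniform convergence handles \<open>y / x \<le> e\<close>, and longer distances are split into such pieces.
\<close>

lemma slowly_varying_log_bound:
  assumes f: "slowly_varying f" and \<eta>: "\<eta> > 0"
  shows "\<exists>X\<ge>1. (\<forall>x\<ge>X. f x > 0) \<and>
           (\<forall>x y. X \<le> x \<longrightarrow> x \<le> y \<longrightarrow> \<bar>ln (f y) - ln (f x)\<bar> \<le> \<eta> * (ln y - ln x + 1))"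
proof -
  obtain a where a: "set_borel_measurable borel {a..} f" "\<And>x. x \<ge> a \<Longrightarrow> f x > 0"
    and lim: "\<And>t. t > 0 \<Longrightarrow> ((\<lambda>x. f (t * x) / f x) \<longlongrightarrow> 1) at_top"
    using f by (auto simp: slowly_varying_def)
  define h where "h = (\<lambda>u. ln (indicator {a..} (exp u) *\<^sub>R f (exp u)))"
  have h_eq: "h u = ln (f (exp u))" if "exp u \<ge> a" for u using that by (simp add: h_def)
  have m1: "(\<lambda>x. indicator {a..} x *\<^sub>R f x) \<in> borel_measurable borel"
    using a(1) unfolding set_borel_measurable_def .
  have hm: "h \<in> borel_measurable borel"
  proof -
    have "(\<lambda>u::real. (\<lambda>x. indicator {a..} x *\<^sub>R f x) (exp u)) \<in> borel_measurable borel"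
      by (rule measurable_compose[OF _ m1]) measurable
    thus ?thesis unfolding h_def by measurable
  qed
  have hl: "((\<lambda>x. h (x + s) - h x) \<longlongrightarrow> 0) at_top" for s
  proof -
    have "((\<lambda>x. ln (f (exp s * x) / f x)) \<longlongrightarrow> ln 1) at_top"
      by (intro tendsto_ln lim) auto
    hence "((\<lambda>x. ln (f (exp s * exp x) / f (exp x))) \<longlongrightarrow> 0) at_top"
      by (auto intro: filterlim_compose[OF _ exp_at_top])
    moreover have "\<forall>\<^sub>F x in at_top. ln (f (exp s * exp x) / f (exp x)) = h (x + s) - h x"
    proof -
      have "\<forall>\<^sub>F x in at_top. exp x \<ge> a" using exp_at_top by (simp add: filterlim_at_top)
      moreover have "\<forall>\<^sub>F x in at_top. exp x \<ge> a / exp s" using exp_at_top by (simp add: filterlim_at_top)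
      ultimately show ?thesis
      proof eventually_elim
        case (elim x)
        hence "exp (x + s) \<ge> a" by (simp add: exp_add field_simps)
        thus ?case using elim a(2)[of "exp x"] a(2)[of "exp (x + s)"]
          by (simp add: h_eq ln_div exp_add mult.commute)
      qed
    qed
    ultimately show ?thesis by (blast intro: Lim_transform_eventually)
  qed
  obtain X0 where X0: "\<And>x s. x \<ge> X0 \<Longrightarrow> s \<in> {0..1} \<Longrightarrow> \<bar>h (x + s) - h x\<bar> \<le> \<eta>"
    using additive_slow_variation_uniform[OF hm hl \<eta>] by blast
  have it: "\<forall>x\<ge>X0. \<forall>t. 0 \<le> t \<longrightarrow> t \<le> real n \<longrightarrow> \<bar>h (x + t) - h x\<bar> \<le> \<eta> * real n" for n
  proof (induction n)
    case (Suc n)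
    show ?case
    proof (intro allI impI)
      fix x t :: real assume x: "x \<ge> X0" and t: "0 \<le> t" "t \<le> real (Suc n)"
      show "\<bar>h (x + t) - h x\<bar> \<le> \<eta> * real (Suc n)"
      proof (cases "t \<le> 1")
        case True
        have "\<bar>h (x + t) - h x\<bar> \<le> \<eta> * 1" using X0[OF x, of t] t True by simp
        also have "\<dots> \<le> \<eta> * real (Suc n)" using \<eta> by (intro mult_left_mono) auto
        finally show ?thesis .
      next
        case False
        have "\<bar>h ((x + 1) + (t - 1)) - h (x + 1)\<bar> \<le> \<eta> * real n"
          using Suc x t False by (intro Suc[rule_format]) auto
        moreover have "\<bar>h (x + 1) - h x\<bar> \<le> \<eta>" using X0[OF x, of 1] by simp
        moreover have e: "(x + 1) + (t - 1) = x + t" by simp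
        ultimately have "\<bar>h (x + t) - h x\<bar> \<le> \<eta> * real n + \<eta>" unfolding e by linarith
        thus ?thesis by (simp add: algebra_simps)
      qed
    qed
  qed auto
  have it': "\<bar>h (x + t) - h x\<bar> \<le> \<eta> * (t + 1)" if "x \<ge> X0" "t \<ge> 0" for x t
  proof -
    have c: "t \<le> real (nat \<lceil>t\<rceil>)" "real (nat \<lceil>t\<rceil>) \<le> t + 1" using that by linarith+
    have "\<bar>h (x + t) - h x\<bar> \<le> \<eta> * real (nat \<lceil>t\<rceil>)" using it that c by blast
    also have "\<dots> \<le> \<eta> * (t + 1)" using c \<eta> by (intro mult_left_mono) auto
    finally show ?thesis .
  qed
  define X where "X = max 1 (max a (exp X0))"
  show ?thesis
  proof (intro exI[of _ X] conjI allI impI)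
    fix x y assume xy: "X \<le> x" "x \<le> y"
    have pos: "x > 0" "y > 0" using xy by (auto simp: X_def)
    have "exp X0 \<le> x" using xy by (simp add: X_def)
    hence x0: "X0 \<le> ln x" using pos by (simp add: ln_ge_iff)
    have t0: "ln y - ln x \<ge> 0" using xy pos by simp
    have "\<bar>h (ln x + (ln y - ln x)) - h (ln x)\<bar> \<le> \<eta> * (ln y - ln x + 1)" by (rule it'[OF x0 t0])
    moreover have "h (ln x) = ln (f x)" "h (ln y) = ln (f y)"
      using pos xy by (auto simp: h_eq X_def)
    ultimately show "\<bar>ln (f y) - ln (f x)\<bar> \<le> \<eta> * (ln y - ln x + 1)" by simp
  qed (auto simp: X_def intro!: a)
qed

text \<open>
  The point probabilities at \<open>k \<ge> \<delta> n\<close> are dominated by those at \<open>n\<close>, even after weighting by \<open>k\<close>.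
  The weight can be afforded because \<open>k * p k\<close> still decays like \<open>k powr (- \<alpha>)\<close> with \<open>\<alpha> > 1\<close>, which beats the
  factor \<open>k / n\<close> in Potter's bound with exponent 1.
\<close>

lemma regular_tail_compare:
  fixes p :: "nat \<Rightarrow> real"
  assumes f: "slowly_varying f" and \<alpha>: "\<alpha> > 1"
    and p: "\<forall>\<^sub>F n in sequentially. p n = f (real n) * real n powr (- 1 - \<alpha>)"
  shows "\<exists>k0. \<forall>\<delta>>0. \<exists>C>0. \<forall>n\<ge>k0. \<forall>k\<ge>k0. \<delta> * real n \<le> real k \<longrightarrow>
           real k * p k \<le> C * (real n * p n)"
proof -
  obtain X where X: "X \<ge> 1" "\<And>x. x \<ge> X \<Longrightarrow> f x > 0"
    "\<And>x y. X \<le> x \<Longrightarrow> x \<le> y \<Longrightarrow> \<bar>ln (f y) - ln (f x)\<bar> \<le> 1 * (ln y - ln x + 1)"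
    using slowly_varying_log_bound[OF f, of 1] by auto
  obtain N where N: "\<And>n. n \<ge> N \<Longrightarrow> p n = f (real n) * real n powr (- 1 - \<alpha>)"
    using p by (auto simp: eventually_sequentially)
  define k0 where "k0 = max N (nat \<lceil>X\<rceil>)"
  have k0: "n \<ge> N \<and> real n \<ge> X \<and> real n > 0" if "n \<ge> k0" for n
  proof -
    have "n \<ge> N" "nat \<lceil>X\<rceil> \<le> n" using that by (auto simp: k0_def)
    thus ?thesis using X(1) by linarith
  qed
  have np: "real n * p n = f (real n) * real n powr (- \<alpha>)" if "n \<ge> k0" for n
  proof -
    have "real n * real n powr (- 1 - \<alpha>) = real n powr (1 + (- 1 - \<alpha>))"
      using k0[OF that] by (subst powr_add) auto
    thus ?thesis using N[of n] k0[OF that] by (simp add: algebra_simps)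
  qed
  show ?thesis
  proof (rule exI[of _ k0], intro allI impI)
    fix \<delta> :: real assume \<delta>: "\<delta> > 0"
    show "\<exists>C>0. \<forall>n\<ge>k0. \<forall>k\<ge>k0. \<delta> * real n \<le> real k \<longrightarrow> real k * p k \<le> C * (real n * p n)"
    proof (intro exI[of _ "exp 1 + exp 1 / \<delta> * \<delta> powr (- \<alpha>)"] conjI allI impI)
      show "0 < exp 1 + exp 1 / \<delta> * \<delta> powr (- \<alpha>)" using \<delta> by (intro add_pos_pos) auto
      fix n k assume nk: "n \<ge> k0" "k \<ge> k0" "\<delta> * real n \<le> real k"
      note n = k0[OF nk(1)] and k = k0[OF nk(2)]
      have fpos: "f (real n) > 0" "f (real k) > 0" using n k X by auto
      have nn: "real n * p n \<ge> 0" using np[OF nk(1)] fpos by simp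
      show "real k * p k \<le> (exp 1 + exp 1 / \<delta> * \<delta> powr (- \<alpha>)) * (real n * p n)"
      proof (cases "n \<le> k")
        case True
        have "ln (f k) \<le> ln (f n) + (ln k - ln n) + 1" using X(3)[of "real n" "real k"] n k True by auto
        hence "f k \<le> exp (ln (f n) + (ln k - ln n) + 1)" using fpos by (metis exp_le_cancel_iff exp_ln)
        also have "\<dots> = exp 1 * f n * (k / n)" using fpos n k by (simp add: exp_add exp_diff)
        finally have fk: "f k \<le> exp 1 * f n * (k / n)" .
        have "real k * real k powr (- \<alpha>) = real k powr (1 + - \<alpha>)"
          using k by (subst powr_add) auto
        hence kk: "(k / n) * real k powr (- \<alpha>) = real k powr (1 - \<alpha>) / n" by simp
        have "f k * k powr (- \<alpha>) \<le> exp 1 * f n * (k / n) * k powr (- \<alpha>)"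
          using fk by (intro mult_right_mono) auto
        also have "\<dots> = exp 1 * f n * (k powr (1 - \<alpha>) / n)"
          unfolding kk[symmetric] by (simp add: mult.assoc)
        also have "\<dots> \<le> exp 1 * f n * (n powr (1 - \<alpha>) / n)"
          using fpos n k True \<alpha> by (intro mult_left_mono divide_right_mono powr_mono2') auto
        also have "real n powr (1 - \<alpha>) / n = n powr (- \<alpha>)" using n by (simp add: powr_diff powr_minus field_simps)
        finally have "real k * p k \<le> exp 1 * (real n * p n)" using np nk by (simp add: mult.assoc)
        also have "\<dots> \<le> (exp 1 + exp 1 / \<delta> * \<delta> powr (- \<alpha>)) * (real n * p n)"
          using nn \<delta> by (intro mult_right_mono) auto
        finally show ?thesis .
      next
        case False
        have "ln (f k) \<le> ln (f n) + (ln n - ln k) + 1" using X(3)[of "real k" "real n"] n k False by auto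
        hence "f k \<le> exp (ln (f n) + (ln n - ln k) + 1)" using fpos by (metis exp_le_cancel_iff exp_ln)
        also have "\<dots> = exp 1 * f n * (n / k)" using fpos n k by (simp add: exp_add exp_diff)
        also have "\<dots> \<le> exp 1 * f n * (1 / \<delta>)"
          using nk \<delta> k fpos by (intro mult_left_mono) (auto simp: field_simps)
        finally have fk: "f k \<le> exp 1 / \<delta> * f n" by (simp add: field_simps)
        have "real k powr (- \<alpha>) \<le> (\<delta> * real n) powr (- \<alpha>)"
          using nk \<delta> n \<alpha> by (intro powr_mono2') auto
        also have "\<dots> = \<delta> powr (- \<alpha>) * real n powr (- \<alpha>)" using \<delta> by (simp add: powr_mult)
        finally have "f k * k powr (- \<alpha>) \<le> (exp 1 / \<delta> * f n) * (\<delta> powr (- \<alpha>) * real n powr (- \<alpha>))"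
          using fk fpos \<delta> by (intro mult_mono) auto
        hence "real k * p k \<le> exp 1 / \<delta> * \<delta> powr (- \<alpha>) * (real n * p n)" using np nk by (simp add: mult_ac)
        also have "\<dots> \<le> (exp 1 + exp 1 / \<delta> * \<delta> powr (- \<alpha>)) * (real n * p n)"
          using nn \<delta> by (intro mult_right_mono) auto
        finally show ?thesis .
      qed
    qed
  qed
qed

lemma regular_tail_lower:
  fixes p :: "nat \<Rightarrow> real"
  assumes f: "slowly_varying f"
    and p: "\<forall>\<^sub>F n in sequentially. p n = f (real n) * real n powr (- 1 - \<alpha>)"
  shows "\<forall>\<^sub>F n in sequentially. p n \<ge> real n powr (- 2 - \<alpha>)"
proof -
  obtain X where X: "X \<ge> 1" "\<And>x. x \<ge> X \<Longrightarrow> f x > 0"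
    "\<And>x y. X \<le> x \<Longrightarrow> x \<le> y \<Longrightarrow> \<bar>ln (f y) - ln (f x)\<bar> \<le> (1/2) * (ln y - ln x + 1)"
    using slowly_varying_log_bound[OF f, of "1/2"] by auto
  have l: "filterlim (\<lambda>n. ln (real n)) at_top sequentially"
    using filterlim_compose[OF ln_at_top filterlim_real_sequentially] .
  have "\<forall>\<^sub>F n in sequentially. ln (real n) \<ge> 1 - 2 * ln (f X)"
    using l by (simp add: filterlim_at_top)
  moreover have "\<forall>\<^sub>F n in sequentially. real n \<ge> X"
    using filterlim_real_sequentially by (simp add: filterlim_at_top)
  ultimately show ?thesis using p
  proof eventually_elim
    case (elim n)
    have n: "real n > 0" using elim X by simp
    have "\<bar>ln (f n) - ln (f X)\<bar> \<le> (1/2) * (ln n - ln X + 1)"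
      by (rule X(3)) (use elim in auto)
    moreover have "ln X \<ge> 0" using X by simp
    moreover note elim(1) abs_ge_minus_self[of "ln (f n) - ln (f X)"]
    ultimately have "2 * ln (f n) \<ge> 2 * (- ln n)" by argo
    hence "ln (f n) \<ge> - ln n" by simp
    moreover have "f n > 0" using X elim by simp
    ultimately have "f n \<ge> exp (- ln n)" by (metis exp_le_cancel_iff exp_ln)
    hence "f n \<ge> real n powr (-1)" using n by (simp add: powr_def)
    hence "real n powr (-1) * real n powr (- 1 - \<alpha>) \<le> p n"
      unfolding elim(3) by (intro mult_right_mono) auto
    moreover have "real n powr (-1) * real n powr (- 1 - \<alpha>) = real n powr (- 2 - \<alpha>)"
      unfolding powr_add[symmetric] by simp
    ultimately show ?case by simp
  qed
qed

lemma regular_tail_moment: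
  fixes p :: "nat \<Rightarrow> real"
  assumes f: "slowly_varying f" and \<alpha>: "\<alpha> > 1"
    and p: "\<forall>\<^sub>F n in sequentially. p n = f (real n) * real n powr (- 1 - \<alpha>)"
  shows "\<exists>\<kappa>>0. \<kappa> \<le> 1 \<and> summable (\<lambda>k. p k * real k powr (1 + \<kappa>))"
proof -
  define \<kappa> where "\<kappa> = min 1 ((\<alpha> - 1) / 4)"
  have \<kappa>: "\<kappa> > 0" "\<kappa> \<le> 1" "\<kappa> + \<kappa> - \<alpha> < -1" using \<alpha> by (auto simp: \<kappa>_def min_def field_simps)
  obtain X where X: "X \<ge> 1" "\<And>x. x \<ge> X \<Longrightarrow> f x > 0"
    "\<And>x y. X \<le> x \<Longrightarrow> x \<le> y \<Longrightarrow> \<bar>ln (f y) - ln (f x)\<bar> \<le> \<kappa> * (ln y - ln x + 1)"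
    using slowly_varying_log_bound[OF f \<kappa>(1)] by auto
  define C where "C = exp (ln (f X) - \<kappa> * ln X + \<kappa>)"
  have "\<forall>\<^sub>F n in sequentially. norm (p n * real n powr (1 + \<kappa>)) \<le> C * real n powr (\<kappa> + \<kappa> - \<alpha>)"
  proof -
    have "\<forall>\<^sub>F n in sequentially. real n \<ge> X"
      using filterlim_real_sequentially by (simp add: filterlim_at_top)
    thus ?thesis using p
    proof eventually_elim
      case (elim n)
      have n: "real n > 0" using elim X by simp
      have fp: "f n > 0" using X elim by simp
      have "ln (f n) \<le> (ln (f X) - \<kappa> * ln X + \<kappa>) + \<kappa> * ln n" using X(3)[of X "real n"] elim by (auto simp: algebra_simps)
      hence "f n \<le> exp ((ln (f X) - \<kappa> * ln X + \<kappa>) + \<kappa> * ln n)" using fp by (metis exp_le_cancel_iff exp_ln)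
      also have "\<dots> = C * n powr \<kappa>" using n unfolding exp_add C_def by (simp add: powr_def)
      finally have "f n * (real n powr (- 1 - \<alpha>) * real n powr (1 + \<kappa>)) \<le> C * n powr \<kappa> * (real n powr (- 1 - \<alpha>) * real n powr (1 + \<kappa>))"
        by (intro mult_right_mono) auto
      also have "\<dots> = C * (n powr \<kappa> * (real n powr (- 1 - \<alpha>) * real n powr (1 + \<kappa>)))" by simp
      also have "n powr \<kappa> * (real n powr (- 1 - \<alpha>) * real n powr (1 + \<kappa>)) = n powr (\<kappa> + \<kappa> - \<alpha>)"
        by (simp add: powr_add[symmetric])
      finally show ?case using elim(2) fp by (simp add: mult.assoc)
    qed
  qed
  moreover have "summable (\<lambda>n. C * real n powr (\<kappa> + \<kappa> - \<alpha>))"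
    using \<kappa> by (intro summable_mult) (simp add: summable_real_powr_iff)
  ultimately have "summable (\<lambda>n. p n * real n powr (1 + \<kappa>))" by (rule summable_comparison_test_ev)
  with \<kappa> show ?thesis by blast
qed

section \<open>The recursive structure of a tree\<close>

definition branch :: "(nat list \<Rightarrow> nat) \<Rightarrow> nat \<Rightarrow> nat list \<Rightarrow> nat" where
  "branch c i = (\<lambda>w. c (i # w))"

lemma branch_apply: "branch c i w = c (i # w)"
  by (simp add: branch_def)

lemma Nil_in_tree_of [simp]: "[] \<in> tree_of c"
  by (rule tree_of.root)

lemma Cons_in_tree_of_iff: "i # w \<in> tree_of c \<longleftrightarrow> i < c [] \<and> w \<in> tree_of (branch c i)"
proof
  have "v \<in> tree_of c \<Longrightarrow> (\<forall>i w. v = i # w \<longrightarrow> i < c [] \<and> w \<in> tree_of (branch c i))" for v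
  proof (induction rule: tree_of.induct)
    case (child v j)
    show ?case
    proof (intro allI impI)
      fix i w assume eq: "v @ [j] = i # w"
      show "i < c [] \<and> w \<in> tree_of (branch c i)"
      proof (cases v)
        case Nil
        with eq child show ?thesis by auto
      next
        case (Cons a u)
        hence "a < c []" "u \<in> tree_of (branch c a)" "i = a" "w = u @ [j]"
          using eq child by auto
        moreover have "j < branch c a u" using Cons child by (simp add: branch_def)
        ultimately show ?thesis using tree_of.child[of u "branch c a" j] by simp
      qed
    qed
  qed auto
  thus "i # w \<in> tree_of c \<Longrightarrow> i < c [] \<and> w \<in> tree_of (branch c i)" by blast
next
  have "w \<in> tree_of (branch c i) \<Longrightarrow> i < c [] \<Longrightarrow> i # w \<in> tree_of c" for w
  proof (induction rule: tree_of.induct)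
    case root
    thus ?case using tree_of.child[of "[]" c i] by simp
  next
    case (child v j)
    thus ?case using tree_of.child[of "i # v" c j] by (simp add: branch_apply)
  qed
  thus "i < c [] \<and> w \<in> tree_of (branch c i) \<Longrightarrow> i # w \<in> tree_of c" by blast
qed

lemma snoc_in_tree_of_iff: "v @ [i] \<in> tree_of c \<longleftrightarrow> v \<in> tree_of c \<and> i < c v"
  by (auto intro: tree_of.intros elim: tree_of.cases)

lemma outdegree_tree_of: "v \<in> tree_of c \<Longrightarrow> outdegree (tree_of c) v = c v"
  by (simp add: outdegree_def snoc_in_tree_of_iff)

lemma take_in_tree_of: "v \<in> tree_of c \<Longrightarrow> take h v \<in> tree_of c"
proof (induction v rule: rev_induct)
  case (snoc i v)
  thus ?case by (cases "h \<le> length v") (auto simp: snoc_in_tree_of_iff)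
qed auto

definition count_event :: "nat set \<Rightarrow> nat \<Rightarrow> (nat list \<Rightarrow> nat) set" where
  "count_event \<Omega> l = {c. finite (vertices_outdegree_in \<Omega> (tree_of c)) \<and>
                          card (vertices_outdegree_in \<Omega> (tree_of c)) = l}"

text \<open>
  Replaces \<^const>\<open>tree_height\<close>, as it is meaningful on infinite trees and recursive in the branches.
\<close>

definition reach :: "nat \<Rightarrow> (nat list \<Rightarrow> nat) set" where
  "reach h = {c. \<exists>v\<in>tree_of c. length v = h}"

definition big_at :: "nat \<Rightarrow> nat \<Rightarrow> (nat list \<Rightarrow> nat) set" where
  "big_at M j = {c. \<exists>v\<in>tree_of c. length v = j \<and> c v \<ge> M}"

lemma reach_0 [simp]: "reach 0 = UNIV"
  by (auto simp: reach_def)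

lemma reach_Suc: "c \<in> reach (Suc h) \<longleftrightarrow> (\<exists>i<c []. branch c i \<in> reach h)"
  unfolding reach_def by (auto simp: length_Suc_conv Cons_in_tree_of_iff intro!: bexI[of _ "_ # _"]) blast

lemma reach_antimono: "h \<le> h' \<Longrightarrow> reach h' \<subseteq> reach h"
  unfolding reach_def using take_in_tree_of by (auto intro!: bexI[of _ "take h _"])

lemma big_at_0: "c \<in> big_at M 0 \<longleftrightarrow> M \<le> c []"
  by (auto simp: big_at_def)

lemma big_at_Suc: "c \<in> big_at M (Suc j) \<longleftrightarrow> (\<exists>i<c []. branch c i \<in> big_at M j)"
proof
  assume "c \<in> big_at M (Suc j)"
  then obtain i w where "i # w \<in> tree_of c" "length w = j" "c (i # w) \<ge> M"
    by (auto simp: big_at_def length_Suc_conv)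
  thus "\<exists>i<c []. branch c i \<in> big_at M j" by (auto simp: big_at_def Cons_in_tree_of_iff branch_apply)
next
  assume "\<exists>i<c []. branch c i \<in> big_at M j"
  then obtain i w where "i < c []" "w \<in> tree_of (branch c i)" "length w = j" "c (i # w) \<ge> M"
    by (auto simp: big_at_def branch_apply)
  thus "c \<in> big_at M (Suc j)" unfolding big_at_def by (auto simp: Cons_in_tree_of_iff intro!: bexI[of _ "i # w"])
qed

lemma vertices_outdegree_in_tree_of:
  "vertices_outdegree_in \<Omega> (tree_of c) = {v \<in> tree_of c. c v \<in> \<Omega>}"
  by (auto simp: vertices_outdegree_in_def outdegree_tree_of)

lemma vertices_outdegree_in_root:
  "vertices_outdegree_in \<Omega> (tree_of c) =
     (if c [] \<in> \<Omega> then {[]} else {}) \<union>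
     (\<Union>i<c []. (#) i ` vertices_outdegree_in \<Omega> (tree_of (branch c i)))"
  (is "?L = ?R")
proof (intro set_eqI)
  fix v show "v \<in> ?L \<longleftrightarrow> v \<in> ?R"
    by (cases v) (auto simp: vertices_outdegree_in_tree_of Cons_in_tree_of_iff branch_apply)
qed

text \<open>
  All outdegrees are finite, so a tree of bounded height is finite.
\<close>

lemma finite_tree_of:
  assumes "c \<notin> reach h"
  shows "finite (tree_of c)"
  using assms
proof (induction h arbitrary: c)
  case (Suc h)
  have "tree_of c \<subseteq> insert [] (\<Union>i<c []. (#) i ` tree_of (branch c i))"
  proof
    fix v assume "v \<in> tree_of c"
    thus "v \<in> insert [] (\<Union>i<c []. (#) i ` tree_of (branch c i))"
      by (cases v rule: list.exhaust) (auto simp: Cons_in_tree_of_iff)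
  qed
  moreover have "finite (insert [] (\<Union>i<c []. (#) i ` tree_of (branch c i)))"
    using Suc by (auto simp: reach_Suc)
  ultimately show ?case by (rule finite_subset)
qed auto

lemma tree_height_less_iff:
  assumes "finite (tree_of c)"
  shows "tree_height (tree_of c) < h \<longleftrightarrow> c \<notin> reach h"
proof -
  have "tree_height (tree_of c) < h \<longleftrightarrow> (\<forall>v\<in>tree_of c. length v < h)"
    unfolding tree_height_def using assms
    by (subst Max_less_iff) (auto intro: Nil_in_tree_of simp del: Nil_in_tree_of)
  also have "\<dots> \<longleftrightarrow> c \<notin> reach h"
  proof
    assume *: "c \<notin> reach h"
    show "\<forall>v\<in>tree_of c. length v < h"
    proof (rule ballI, rule ccontr)
      fix v assume v: "v \<in> tree_of c" "\<not> length v < h"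
      hence "take h v \<in> tree_of c" "length (take h v) = h" using take_in_tree_of by auto
      thus False using * by (auto simp: reach_def)
    qed
  qed (auto simp: reach_def)
  finally show ?thesis .
qed

lemma count_event_root:
  "c \<in> count_event \<Omega> l \<longleftrightarrow>
     (\<exists>r. (\<forall>i<c []. branch c i \<in> count_event \<Omega> (r i)) \<and> 
          l = of_bool (c [] \<in> \<Omega>) + (\<Sum>i<c []. r i))"
proof -
  define V where "V = (\<lambda>c. vertices_outdegree_in \<Omega> (tree_of c))"
  define R where "R = (if c [] \<in> \<Omega> then {[]} else {} :: nat list set)"
  have V: "V c = R \<union> (\<Union>i<c []. (#) i ` V (branch c i))"
    unfolding V_def R_def by (rule vertices_outdegree_in_root)
  have fin: "finite (V c) \<longleftrightarrow> (\<forall>i<c []. finite (V (branch c i)))"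
    unfolding V by (auto simp: R_def finite_image_iff)
  have cd: "card (V c) = of_bool (c [] \<in> \<Omega>) + (\<Sum>i<c []. card (V (branch c i)))"
    if "\<forall>i<c []. finite (V (branch c i))"
  proof -
    have "card (V c) = card R + card (\<Union>i<c []. (#) i ` V (branch c i))"
      unfolding V using that by (intro card_Un_disjoint) (auto simp: R_def)
    also have "card (\<Union>i<c []. (#) i ` V (branch c i)) = (\<Sum>i<c []. card ((#) i ` V (branch c i)))"
      using that by (intro card_UN_disjoint) auto
    also have "\<dots> = (\<Sum>i<c []. card (V (branch c i)))"
      by (intro sum.cong card_image) auto
    finally show ?thesis by (simp add: R_def)
  qed
  have ce: "c' \<in> count_event \<Omega> l \<longleftrightarrow> finite (V c') \<and> card (V c') = l" for c' l
    by (simp add: count_event_def V_def)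
  show ?thesis
  proof
    assume "c \<in> count_event \<Omega> l"
    thus "\<exists>r. (\<forall>i<c []. branch c i \<in> count_event \<Omega> (r i)) \<and> l = of_bool (c [] \<in> \<Omega>) + (\<Sum>i<c []. r i)"
      using cd fin by (intro exI[of _ "\<lambda>i. card (V (branch c i))"]) (auto simp: ce)
  next
    assume "\<exists>r. (\<forall>i<c []. branch c i \<in> count_event \<Omega> (r i)) \<and> l = of_bool (c [] \<in> \<Omega>) + (\<Sum>i<c []. r i)"
    then obtain r where r: "\<forall>i<c []. branch c i \<in> count_event \<Omega> (r i)" "l = of_bool (c [] \<in> \<Omega>) + (\<Sum>i<c []. r i)"
      by blast
    hence "(\<Sum>i<c []. card (V (branch c i))) = (\<Sum>i<c []. r i)"
      by (intro sum.cong) (auto simp: ce)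
    thus "c \<in> count_event \<Omega> l" using r cd fin by (auto simp: ce)
  qed
qed

lemma count_event_disjoint: "l \<noteq> l' \<Longrightarrow> count_event \<Omega> l \<inter> count_event \<Omega> l' = {}"
  by (auto simp: count_event_def)

section \<open>Measurability\<close>

lemma space_gw_space [simp]: "space (gw_space \<xi>) = UNIV"
  by (simp add: gw_space_def space_PiM)

lemma prob_space_gw_space: "prob_space (gw_space \<xi>)"
  unfolding gw_space_def by (intro prob_space_PiM) (rule measure_pmf.prob_space_axioms)

lemma measurable_coordinate [measurable]: "(\<lambda>c. c v) \<in> measurable (gw_space \<xi>) (count_space UNIV)"
proof -
  have "(\<lambda>c. c v) \<in> measurable (\<Pi>\<^sub>M v\<in>UNIV. measure_pmf \<xi>) (measure_pmf \<xi>)"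
    by (rule measurable_component_singleton) simp
  thus ?thesis unfolding gw_space_def measurable_pmf_measure2 .
qed

lemma sets_gw_space_coordinate: "{c. P (c v)} \<in> sets (gw_space \<xi>)"
proof -
  have "{c \<in> space (gw_space \<xi>). P (c v)} \<in> sets (gw_space \<xi>)" by measurable
  thus ?thesis by simp
qed

lemma measurable_branch [measurable]: "(\<lambda>c. branch c i) \<in> measurable (gw_space \<xi>) (gw_space \<xi>)"
  unfolding gw_space_def branch_def
proof (rule measurable_PiM_single')
  show "(\<lambda>c. c (i # w)) \<in> measurable (\<Pi>\<^sub>M v\<in>UNIV. measure_pmf \<xi>) (measure_pmf \<xi>)" for w
    by (rule measurable_component_singleton) simp
qed auto

lemma sets_in_tree_of [measurable]: "Measurable.pred (gw_space \<xi>) (\<lambda>c. v \<in> tree_of c)"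
proof (induction v rule: rev_induct)
  case (snoc i v)
  note [measurable] = snoc
  show ?case unfolding snoc_in_tree_of_iff by measurable
qed simp

lemma sets_reach: "reach h \<in> sets (gw_space \<xi>)"
proof -
  have "{c \<in> space (gw_space \<xi>). \<exists>v\<in>{v. length v = h}. v \<in> tree_of c} \<in> sets (gw_space \<xi>)"
    by measurable
  also have "{c \<in> space (gw_space \<xi>). \<exists>v\<in>{v. length v = h}. v \<in> tree_of c} = reach h"
    by (auto simp: reach_def)
  finally show ?thesis .
qed

lemma sets_big_at: "big_at M j \<in> sets (gw_space \<xi>)"
proof -
  have "{c \<in> space (gw_space \<xi>). \<exists>v\<in>{v. length v = j}. v \<in> tree_of c \<and> M \<le> c v} \<in> sets (gw_space \<xi>)"
    by measurable
  also have "{c \<in> space (gw_space \<xi>). \<exists>v\<in>{v. length v = j}. v \<in> tree_of c \<and> M \<le> c v} = big_at M j"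
    by (auto simp: big_at_def)
  finally show ?thesis .
qed

text \<open>
  There are only countably many finite sets of vertices, and each of them can be prescribed.
\<close>

lemma sets_count_event: "count_event \<Omega> l \<in> sets (gw_space \<xi>)"
proof -
  define V where "V = (\<lambda>c. vertices_outdegree_in \<Omega> (tree_of c))"
  have eq: "count_event \<Omega> l = (\<Union>S\<in>{S. finite S \<and> card S = l}. {c \<in> space (gw_space \<xi>). \<forall>v. v \<in> S \<longleftrightarrow> v \<in> V c})"
    by (auto simp: count_event_def V_def set_eq_iff[symmetric])
  have "countable {S :: nat list set. finite S \<and> card S = l}"
    by (rule countable_subset[OF _ countable_Collect_finite]) auto
  moreover have "{c \<in> space (gw_space \<xi>). \<forall>v. v \<in> S \<longleftrightarrow> v \<in> V c} \<in> sets (gw_space \<xi>)" for S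
    unfolding V_def vertices_outdegree_in_tree_of mem_Collect_eq by measurable
  ultimately show ?thesis unfolding eq by (intro sets.countable_UN'') auto
qed

section \<open>Independence of the branches\<close>

text \<open>
  The coordinates \<open>[]\<close> and \<open>i # w\<close>, for different \<open>i\<close>, form disjoint blocks of independent variables, and each
  block \<open>{i # w}\<close> is a reindexed copy of the whole family.
\<close>

lemma root_branches_independent:
  assumes A: "\<And>i. i < k \<Longrightarrow> A i \<in> sets (gw_space \<xi>)"
  shows "measure (gw_space \<xi>) {c. c [] = k \<and> (\<forall>i<k. branch c i \<in> A i)} =
           pmf \<xi> k * (\<Prod>i<k. measure (gw_space \<xi>) (A i))"
proof -
  define G where "G = gw_space \<xi>"
  interpret G: prob_space G unfolding G_def by (rule prob_space_gw_space)
  let ?M = "\<lambda>_::nat list. measure_pmf \<xi>"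
  have G: "G = PiM UNIV ?M" by (simp add: G_def gw_space_def)
  interpret PP: product_prob_space ?M UNIV
    by unfold_locales
  have ind: "G.indep_vars ?M (\<lambda>v c. c v) UNIV"
  proof (subst G.indep_vars_iff_distr_eq_PiM)
    show "G.random_variable (measure_pmf \<xi>) (\<lambda>c. c i)" for i
      unfolding G by (rule measurable_component_singleton) simp
    have "distr G (measure_pmf \<xi>) (\<lambda>\<omega>. \<omega> i) = measure_pmf \<xi>" for i
      unfolding G by (rule distr_PiM_component) (auto intro: measure_pmf.prob_space_axioms)
    moreover have "distr G (Pi\<^sub>M UNIV (\<lambda>_. measure_pmf \<xi>)) (\<lambda>x. \<lambda>i\<in>UNIV. x i) = G"
      using distr_id2[of G G] by (simp add: G restrict_UNIV)
    ultimately show "distr G (Pi\<^sub>M UNIV (\<lambda>_. measure_pmf \<xi>)) (\<lambda>x. \<lambda>i\<in>UNIV. x i) =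
       Pi\<^sub>M UNIV (\<lambda>i. distr G (measure_pmf \<xi>) (\<lambda>\<omega>. \<omega> i))" by (simp add: G)
  qed auto
  define K where "K = (\<lambda>j. case j of None \<Rightarrow> {[]} | Some i \<Rightarrow> range ((#) (i::nat)))"
  define L where "L = insert None (Some ` {..<k})"
  have indr: "G.indep_vars (\<lambda>j. PiM (K j) ?M) (\<lambda>j \<omega>. restrict (\<lambda>v. \<omega> v) (K j)) L"
    by (rule G.indep_vars_restrict[OF ind]) (auto simp: K_def disjoint_family_on_def split: option.splits)
  have dist: "distr G G (\<lambda>c. branch c i) = G" for i
    using distr_PiM_reindex[of UNIV ?M "(#) i" UNIV]
    by (simp add: G branch_def restrict_UNIV measure_pmf.prob_space_axioms)
  have mb: "measure G {c. branch c i \<in> B} = measure G B" if "B \<in> sets G" for i B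
  proof -
    have "measure G B = measure (distr G G (\<lambda>c. branch c i)) B" by (simp add: dist)
    also have "\<dots> = measure G ((\<lambda>c. branch c i) -` B \<inter> space G)"
      using that by (intro measure_distr) (auto simp: G_def)
    finally show ?thesis by (simp add: G_def vimage_def)
  qed
  define B where "B = (\<lambda>j. case j of None \<Rightarrow> {g \<in> space (PiM {[]} ?M). g [] = k}
     | Some i \<Rightarrow> {g \<in> space (PiM (range ((#) i)) ?M). (\<lambda>w. g (i # w)) \<in> A i})"
  have Bs: "B j \<in> sets (PiM (K j) ?M)" if "j \<in> L" for j
  proof (cases j)
    case None
    have m: "(\<lambda>g. g []) \<in> measurable (PiM {[]} ?M) (count_space UNIV)"
      using measurable_component_singleton[of "[]" "{[]}" ?M] by (simp cong: measurable_cong_sets)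
    have "{g \<in> space (PiM {[]} ?M). g [] = k} \<in> sets (PiM {[]} ?M)" using m by measurable
    thus ?thesis by (simp add: B_def K_def None)
  next
    case (Some i)
    hence [measurable]: "A i \<in> sets G" using that A by (auto simp: L_def G_def)
    have m [measurable]: "(\<lambda>g w. g (i # w)) \<in> measurable (PiM (range ((#) i)) ?M) G"
      unfolding G
    proof (rule measurable_PiM_single')
      show "(\<lambda>g. g (i # w)) \<in> measurable (PiM (range ((#) i)) ?M) (measure_pmf \<xi>)" for w
        by (rule measurable_component_singleton) simp
    qed (auto simp: space_PiM)
    have "{g \<in> space (PiM (range ((#) i)) ?M). (\<lambda>w. g (i # w)) \<in> A i} \<in> sets (PiM (range ((#) i)) ?M)"
      by measurable
    thus ?thesis by (simp add: B_def K_def Some)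
  qed
  have "G.prob (\<Inter>j\<in>L. (\<lambda>\<omega>. restrict (\<lambda>v. \<omega> v) (K j)) -` B j \<inter> space G) = 
        (\<Prod>j\<in>L. G.prob ((\<lambda>\<omega>. restrict (\<lambda>v. \<omega> v) (K j)) -` B j \<inter> space G))"
    using Bs by (intro G.indep_varsD[OF indr]) (auto simp: L_def)
  also have "(\<Inter>j\<in>L. (\<lambda>\<omega>. restrict (\<lambda>v. \<omega> v) (K j)) -` B j \<inter> space G) = {c. c [] = k \<and> (\<forall>i<k. branch c i \<in> A i)}"
    by (auto simp: L_def B_def K_def G_def branch_def space_PiM)
  also have "(\<Prod>j\<in>L. G.prob ((\<lambda>\<omega>. restrict (\<lambda>v. \<omega> v) (K j)) -` B j \<inter> space G)) = 
     measure G {c. c [] = k} * (\<Prod>i<k. measure G {c. branch c i \<in> A i})"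
  proof -
    have 1: "((\<lambda>\<omega>. restrict (\<lambda>v. \<omega> v) (K None)) -` B None \<inter> space G) = {c. c [] = k}"
      by (auto simp: B_def K_def G_def space_PiM)
    have 2: "((\<lambda>\<omega>. restrict (\<lambda>v. \<omega> v) (K (Some i))) -` B (Some i) \<inter> space G) = {c. branch c i \<in> A i}" for i
      by (auto simp: B_def K_def G_def space_PiM branch_def)
    show ?thesis unfolding L_def by (subst prod.insert) (auto simp: 1 2 prod.reindex)
  qed
  also have "measure G {c. c [] = k} = pmf \<xi> k"
  proof -
    have "pmf \<xi> k = measure (distr G (measure_pmf \<xi>) (\<lambda>\<omega>. \<omega> [])) {k}"
      unfolding G by (subst distr_PiM_component) (auto intro: measure_pmf.prob_space_axioms simp: measure_pmf_single)
    also have "\<dots> = measure G ((\<lambda>\<omega>. \<omega> []) -` {k} \<inter> space G)"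
      by (rule measure_distr) (unfold G, rule measurable_component_singleton, auto)
    finally show ?thesis by (simp add: G_def vimage_def)
  qed
  also have "(\<Prod>i<k. measure G {c. branch c i \<in> A i}) = (\<Prod>i<k. measure G (A i))"
    using A mb unfolding G_def by (intro prod.cong) auto
  finally show ?thesis unfolding G_def .
qed

lemma sets_branch: "A \<in> sets (gw_space \<xi>) \<Longrightarrow> {c. branch c i \<in> A} \<in> sets (gw_space \<xi>)"
  using measurable_sets[OF measurable_branch, of A \<xi> i] by (simp add: vimage_def)

lemma sets_root_branches:
  assumes "\<And>i. i < k \<Longrightarrow> A i \<in> sets (gw_space \<xi>)"
  shows "{c. c [] = k \<and> (\<forall>i<k. branch c i \<in> A i)} \<in> sets (gw_space \<xi>)"
proof -
  define A' where "A' = (\<lambda>i. if i < k then A i else space (gw_space \<xi>))"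
  have [measurable]: "A' i \<in> sets (gw_space \<xi>)" for i
    using assms[of i] sets.top[of "gw_space \<xi>"] by (simp add: A'_def)
  have "{c \<in> space (gw_space \<xi>). c [] = k \<and> (\<forall>i\<in>{..<k}. branch c i \<in> A' i)} \<in> sets (gw_space \<xi>)"
    by measurable
  also have "{c \<in> space (gw_space \<xi>). c [] = k \<and> (\<forall>i\<in>{..<k}. branch c i \<in> A' i)} =
      {c. c [] = k \<and> (\<forall>i<k. branch c i \<in> A i)}" by (auto simp: A'_def)
  finally show ?thesis .
qed

lemma root_decomposition_sums:
  assumes "E \<in> sets (gw_space \<xi>)"
  shows "(\<lambda>k. measure (gw_space \<xi>) {c \<in> E. c [] = k}) sums measure (gw_space \<xi>) E"
proof -
  interpret prob_space "gw_space \<xi>" by (rule prob_space_gw_space)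
  have "(\<lambda>k. measure (gw_space \<xi>) (E \<inter> {c. c [] = k})) sums measure (gw_space \<xi>) (\<Union>k. E \<inter> {c. c [] = k})"
    using assms sets_gw_space_coordinate
    by (intro finite_measure_UNION) (auto simp: disjoint_family_on_def)
  moreover have "(\<Union>k. E \<inter> {c. c [] = k}) = E" by auto
  ultimately show ?thesis by (simp add: Collect_conj_eq)
qed

section \<open>Counting vertices by power series\<close>

text \<open>
  The first \<open>M\<close> steps already cost the factor \<open>s ^ M\<close>; the rest is a renewal function.
\<close>

lemma coeff_le_geometric_tail:
  assumes F: "weight_le 1 F s" "s \<le> 1" and q: "fps_nth F 0 \<le> q" "q < 1"
  shows "coeff_le (\<Sum>k\<in>{M..<K}. F ^ k) (s ^ M / (1 - q))"
proof -
  have F1: "weight_le 1 F 1" using F weight_le_mono by blast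
  have "(\<Sum>k\<in>{M..<K}. F ^ k) = (\<Sum>k<K-M. F ^ k) * F ^ M"
  proof -
    have "(\<Sum>k\<in>{M..<K}. F ^ k) = (\<Sum>k\<in>{..<K-M}. F ^ (k + M))"
      by (rule sum.reindex_bij_witness[of _ "\<lambda>k. k + M" "\<lambda>k. k - M"]) auto
    thus ?thesis by (simp add: power_add sum_distrib_right)
  qed
  moreover have "coeff_le ((\<Sum>k<K-M. F ^ k) * F ^ M) (1 / (1 - q) * s ^ M)"
    by (intro coeff_le_mult coeff_le_geometric_sum F1 q weight_le_power F) auto
  ultimately show ?thesis by simp
qed

locale gw_tree =
  fixes \<xi> :: "nat pmf" and \<Omega> :: "nat set"
begin

sublocale prob_space "gw_space \<xi>"
  by (rule prob_space_gw_space)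

abbreviation count :: "nat \<Rightarrow> (nat list \<Rightarrow> nat) set" where
  "count \<equiv> count_event \<Omega>"

text \<open>
  Generating function of the number of \<open>\<Omega>\<close>-vertices on the event \<open>A\<close>.  For \<open>A = UNIV\<close> it is the step law of
  the renewal process behind the count.
\<close>

definition F :: "(nat list \<Rightarrow> nat) set \<Rightarrow> real fps" where
  "F A = Abs_fps (\<lambda>l. prob (count l \<inter> A))"

text \<open>
  The root's own contribution to the count.
\<close>

definition root_fps :: "nat \<Rightarrow> real fps" where
  "root_fps k = fps_X ^ (of_bool (k \<in> \<Omega>))"

lemma F_nth: "fps_nth (F A) l = prob (count l \<inter> A)"
  by (simp add: F_def)

lemma F_nonneg: "fps_nth (F A) l \<ge> 0"
  by (simp add: F_nth)

lemma UNIV_in_events [simp]: "UNIV \<in> events"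
  using sets.top[of "gw_space \<xi>"] by simp

lemma F_mono: "A \<subseteq> B \<Longrightarrow> B \<in> events \<Longrightarrow> fps_nth (F A) l \<le> fps_nth (F B) l"
  unfolding F_nth by (intro finite_measure_mono) (auto intro!: sets.Int sets_count_event)

lemma F_sum: 
  assumes "A \<in> events"
  shows "(\<Sum>l\<le>L. fps_nth (F A) l) = prob (A \<inter> (\<Union>l\<le>L. count l))"
proof -
  have "(\<Sum>l\<le>L. fps_nth (F A) l) = prob (\<Union>l\<le>L. count l \<inter> A)"
    unfolding F_nth using assms count_event_disjoint
    by (intro finite_measure_finite_Union[symmetric])
       (auto simp: disjoint_family_on_def intro!: sets.Int sets_count_event)
  also have "(\<Union>l\<le>L. count l \<inter> A) = A \<inter> (\<Union>l\<le>L. count l)" by auto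
  finally show ?thesis .
qed

lemma weight_le_F:
  assumes "A \<in> events"
  shows "weight_le 1 (F A) (prob A)"
  unfolding weight_le_def
proof (intro conjI allI F_nonneg)
  fix L
  have "(\<Sum>l\<le>L. fps_nth (F A) l) \<le> prob A"
    unfolding F_sum[OF assms] by (intro finite_measure_mono assms) auto
  thus "(\<Sum>l\<le>L. fps_nth (F A) l * 1 ^ l) \<le> prob A" by simp
qed

lemma weight_le_F1: "A \<in> events \<Longrightarrow> weight_le 1 (F A) 1"
  using weight_le_F weight_le_mono prob_le_1 by blast

lemma weight_le_root_fps: "z \<ge> 0 \<Longrightarrow> weight_le z (root_fps k) (z ^ of_bool (k \<in> \<Omega>))"
  unfolding root_fps_def by (intro weight_le_power weight_le_X)

lemma weight_le_root_fps1: "weight_le 1 (root_fps k) 1"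
  using weight_le_root_fps[of 1 k] by simp

text \<open>
  Allowing both possible contributions of the root removes the dependence on \<open>k\<close>, so that sums over \<open>k\<close> can be
  taken; this costs a factor 2 in the bounds below.
\<close>

lemma root_fps_mult_le:
  assumes "\<And>l. fps_nth G l \<ge> 0"
  shows "fps_nth (root_fps k * G) l \<le> fps_nth G l + fps_nth (fps_X * G) l"
  using assms by (cases "k \<in> \<Omega>") (auto simp: root_fps_def)

text \<open>
  The counts in the \<open>k\<close> branches are independent, so their sum has the product of the generating
  functions.  The proof adds the branches to the sum one at a time: \<open>S A j l\<close> requires the first \<open>j\<close> branches to have
  total count \<open>l\<close>, and prescribing the count of branch \<open>j\<close> amounts to shrinking \<open>A j\<close>.
\<close>

lemma prob_root_count:
  assumes A: "\<And>i. i < k \<Longrightarrow> A i \<in> events"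
  shows "prob {c. c [] = k \<and> (\<forall>i<k. branch c i \<in> A i) \<and> c \<in> count l} =
           pmf \<xi> k * fps_nth (root_fps k * (\<Prod>i<k. F (A i))) l"
proof -
  define S where "S = (\<lambda>A j l. {c. c [] = k \<and> (\<forall>i<k. branch c i \<in> A i) \<and> 
     (\<exists>r. (\<forall>i<j. branch c i \<in> count (r i)) \<and> l = (\<Sum>i<j. r i))})"
  have S0: "S A 0 l = (if l = 0 then {c. c [] = k \<and> (\<forall>i<k. branch c i \<in> A i)} else {})" for A l
    by (auto simp: S_def)
  have SSuc: "S A (Suc j) l = (\<Union>s\<le>l. S (A(j := A j \<inter> count s)) j (l - s))" if "j < k" for A j l
  proof (intro equalityI subsetI)
    fix c assume "c \<in> S A (Suc j) l"
    then obtain r where r: "c [] = k" "\<forall>i<k. branch c i \<in> A i" "\<forall>i<Suc j. branch c i \<in> count (r i)" "l = (\<Sum>i<Suc j. r i)"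
      by (auto simp: S_def)
    have "c \<in> S (A(j := A j \<inter> count (r j))) j (l - r j)"
      using r unfolding S_def by (auto intro!: exI[of _ r])
    moreover have "r j \<le> l" using r by simp
    ultimately show "c \<in> (\<Union>s\<le>l. S (A(j := A j \<inter> count s)) j (l - s))" by blast
  next
    fix c assume "c \<in> (\<Union>s\<le>l. S (A(j := A j \<inter> count s)) j (l - s))"
    then obtain s where s: "s \<le> l" "c \<in> S (A(j := A j \<inter> count s)) j (l - s)" by blast
    then obtain r where r: "c [] = k" "\<forall>i<k. branch c i \<in> (A(j := A j \<inter> count s)) i" 
      "\<forall>i<j. branch c i \<in> count (r i)" "l - s = (\<Sum>i<j. r i)"
      by (auto simp: S_def)
    have 1: "branch c j \<in> count s" using r(2) that by auto
    have 2: "\<forall>i<k. branch c i \<in> A i" using r(2) by (auto split: if_splits)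
    have "(\<Sum>i<j. (r(j := s)) i) = (\<Sum>i<j. r i)" by (intro sum.cong) auto
    hence "(\<Sum>i<Suc j. (r(j := s)) i) = l" using s(1) r(4) by simp
    moreover have "\<forall>i<Suc j. branch c i \<in> count ((r(j := s)) i)" using 1 r(3) by (auto simp: less_Suc_eq)
    ultimately show "c \<in> S A (Suc j) l" unfolding S_def using r(1) 2 by blast
  qed
  have Sm: "(\<forall>i<k. A i \<in> events) \<longrightarrow> j \<le> k \<longrightarrow> S A j l \<in> events \<and> 
      prob (S A j l) = pmf \<xi> k * (fps_nth (\<Prod>i<j. F (A i)) l * (\<Prod>i\<in>{j..<k}. prob (A i)))" for j A l
  proof (induction j arbitrary: A l)
    case 0
    show ?case
    proof (intro impI conjI)
      assume A: "\<forall>i<k. A i \<in> events"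
      show "S A 0 l \<in> events" using A sets_root_branches[of k A] by (auto simp: S0)
      show "prob (S A 0 l) = pmf \<xi> k * (fps_nth (\<Prod>i<0. F (A i)) l * (\<Prod>i\<in>{0..<k}. prob (A i)))"
        using A root_branches_independent[of k A \<xi>] by (auto simp: S0 fps_one_nth atLeast0LessThan)
    qed
  next
    case (Suc j)
    show ?case
    proof (intro impI)
      assume A: "\<forall>i<k. A i \<in> events" and j: "Suc j \<le> k"
      have jk: "j < k" using j by simp
      have A': "\<forall>i<k. (A(j := A j \<inter> count s)) i \<in> events" for s
        using A jk by (auto intro!: sets.Int sets_count_event)
      have ev: "S (A(j := A j \<inter> count s)) j (l - s) \<in> events" for s
        using Suc[of "A(j := A j \<inter> count s)" "l - s", THEN mp, THEN mp, OF A' less_imp_le[OF jk]] by blast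
      have pr: "prob (S (A(j := A j \<inter> count s)) j (l - s)) = 
         pmf \<xi> k * (fps_nth (\<Prod>i<j. F (A i)) (l - s) * (fps_nth (F (A j)) s * (\<Prod>i\<in>{Suc j..<k}. prob (A i))))" for s
      proof -
        have "prob (S (A(j := A j \<inter> count s)) j (l - s)) = pmf \<xi> k * (fps_nth (\<Prod>i<j. F ((A(j := A j \<inter> count s)) i)) (l - s)
              * (\<Prod>i\<in>{j..<k}. prob ((A(j := A j \<inter> count s)) i)))"
          using Suc[of "A(j := A j \<inter> count s)" "l - s", THEN mp, THEN mp, OF A' less_imp_le[OF jk]] by blast
        also have "(\<Prod>i<j. F ((A(j := A j \<inter> count s)) i)) = (\<Prod>i<j. F (A i))"
          by (intro prod.cong) auto
        also have "(\<Prod>i\<in>{j..<k}. prob ((A(j := A j \<inter> count s)) i)) = 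
           prob (A j \<inter> count s) * (\<Prod>i\<in>{Suc j..<k}. prob ((A(j := A j \<inter> count s)) i))"
          using jk by (subst prod.atLeast_Suc_lessThan) auto
        also have "(\<Prod>i\<in>{Suc j..<k}. prob ((A(j := A j \<inter> count s)) i)) = (\<Prod>i\<in>{Suc j..<k}. prob (A i))"
          by (intro prod.cong) auto
        also have "prob (A j \<inter> count s) = fps_nth (F (A j)) s" by (simp add: F_nth Int_commute)
        finally show ?thesis .
      qed
      have disj: "disjoint_family_on (\<lambda>s. S (A(j := A j \<inter> count s)) j (l - s)) {..l}"
        unfolding disjoint_family_on_def
      proof (intro ballI impI)
        fix s s' :: nat assume "s \<noteq> s'"
        have "branch c j \<in> count s" if "c \<in> S (A(j := A j \<inter> count s)) j (l - s)" for c s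
          using that jk by (auto simp: S_def)
        thus "S (A(j := A j \<inter> count s)) j (l - s) \<inter> S (A(j := A j \<inter> count s')) j (l - s') = {}"
          using count_event_disjoint[OF \<open>s \<noteq> s'\<close>, of \<Omega>] by blast
      qed
      have "prob (S A (Suc j) l) = (\<Sum>s\<le>l. prob (S (A(j := A j \<inter> count s)) j (l - s)))"
        unfolding SSuc[OF jk] using ev disj by (intro finite_measure_finite_Union) auto
      also have "\<dots> = pmf \<xi> k * ((\<Sum>s\<le>l. fps_nth (F (A j)) s * fps_nth (\<Prod>i<j. F (A i)) (l - s)) * (\<Prod>i\<in>{Suc j..<k}. prob (A i)))"
        unfolding pr sum_distrib_left sum_distrib_right by (intro sum.cong refl) (simp add: mult_ac)
      also have "(\<Sum>s\<le>l. fps_nth (F (A j)) s * fps_nth (\<Prod>i<j. F (A i)) (l - s)) = fps_nth (\<Prod>i<Suc j. F (A i)) l"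
        by (simp add: fps_mult_nth atLeast0AtMost mult.commute[of "prod _ _"])
      finally show "S A (Suc j) l \<in> events \<and> 
        prob (S A (Suc j) l) = pmf \<xi> k * (fps_nth (\<Prod>i<Suc j. F (A i)) l * (\<Prod>i\<in>{Suc j..<k}. prob (A i)))"
        unfolding SSuc[OF jk] using ev by auto
    qed
  qed
  have PS: "prob (S A k l) = pmf \<xi> k * fps_nth (\<Prod>i<k. F (A i)) l" for l
    using Sm[of A k l] A by simp
  define e where "e = (of_bool (k \<in> \<Omega>) :: nat)"
  have eq: "{c. c [] = k \<and> (\<forall>i<k. branch c i \<in> A i) \<and> c \<in> count l} = (if l < e then {} else S A k (l - e))"
  proof (intro set_eqI iffI)
    fix c assume "c \<in> {c. c [] = k \<and> (\<forall>i<k. branch c i \<in> A i) \<and> c \<in> count l}"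
    thus "c \<in> (if l < e then {} else S A k (l - e))"
      by (auto simp: S_def count_event_root[of c] e_def)
  next
    fix c assume "c \<in> (if l < e then {} else S A k (l - e))"
    hence "l \<ge> e" "c \<in> S A k (l - e)" by (auto split: if_splits)
    then obtain r where "c [] = k" "\<forall>i<k. branch c i \<in> A i" "\<forall>i<k. branch c i \<in> count (r i)" "l = e + (\<Sum>i<k. r i)"
      by (auto simp: S_def)
    thus "c \<in> {c. c [] = k \<and> (\<forall>i<k. branch c i \<in> A i) \<and> c \<in> count l}"
      by (auto simp: count_event_root[of c] e_def intro!: exI[of _ r])
  qed
  show ?thesis unfolding eq using PS
    by (auto simp: root_fps_def e_def[symmetric] fps_X_power_mult_nth)
qed

lemma sets_exists_branch:
  assumes [measurable]: "A \<in> events"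
  shows "{c. \<exists>i<c []. branch c i \<in> A} \<in> events"
proof -
  have "{c \<in> space (gw_space \<xi>). \<exists>i. i < c [] \<and> branch c i \<in> A} \<in> events" by measurable
  thus ?thesis by simp
qed

lemma sets_all_branches:
  assumes [measurable]: "A \<in> events"
  shows "{c. Q (c []) \<and> (\<forall>i<c []. branch c i \<in> A)} \<in> events"
proof -
  have "{c \<in> space (gw_space \<xi>). Q (c []) \<and> (\<forall>i. i < c [] \<longrightarrow> branch c i \<in> A)} \<in> events" by measurable
  thus ?thesis by simp
qed

lemma sets_exists_two_branches:
  assumes [measurable]: "A \<in> events" "B \<in> events"
  shows "{c. \<exists>i<c []. \<exists>j<c []. i \<noteq> j \<and> branch c i \<in> A \<and> branch c j \<in> B} \<in> events" (is "?E \<in> _")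
proof -
  have "{c \<in> space (gw_space \<xi>). \<exists>i j. i < c [] \<and> j < c [] \<and> i \<noteq> j \<and> branch c i \<in> A \<and> branch c j \<in> B} \<in> events"
    by measurable
  also have "{c \<in> space (gw_space \<xi>). \<exists>i j. i < c [] \<and> j < c [] \<and> i \<noteq> j \<and> branch c i \<in> A \<and> branch c j \<in> B} = ?E"
    by auto
  finally show ?thesis .
qed

lemma sets_root_count_one:
  assumes "A \<in> events"
  shows "{c. c [] = k \<and> branch c i \<in> A \<and> c \<in> count l} \<in> events"
proof -
  have "{c. c [] = k \<and> branch c i \<in> A \<and> c \<in> count l} = {c. c [] = k} \<inter> {c. branch c i \<in> A} \<inter> count l" by auto
  thus ?thesis by (auto intro!: sets.Int sets_gw_space_coordinate sets_branch assms sets_count_event)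
qed

lemma prob_root_count_one:
  assumes A: "A \<in> events" and i: "i < k"
  shows "prob {c. c [] = k \<and> branch c i \<in> A \<and> c \<in> count l} = pmf \<xi> k * fps_nth (root_fps k * (F A * F UNIV ^ (k - 1))) l"
proof -
  define A' where "A' = (\<lambda>j. if j = i then A else UNIV)"
  have "prob {c. c [] = k \<and> (\<forall>j<k. branch c j \<in> A' j) \<and> c \<in> count l} = pmf \<xi> k * fps_nth (root_fps k * (\<Prod>j<k. F (A' j))) l"
    by (rule prob_root_count) (use A in \<open>auto simp: A'_def\<close>)
  also have "{c. c [] = k \<and> (\<forall>j<k. branch c j \<in> A' j) \<and> c \<in> count l} = {c. c [] = k \<and> branch c i \<in> A \<and> c \<in> count l}"
    using i by (auto simp: A'_def)
  also have "(\<Prod>j<k. F (A' j)) = F (A' i) * (\<Prod>j\<in>{..<k} - {i}. F (A' j))"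
    using i by (intro prod.remove) auto
  also have "(\<Prod>j\<in>{..<k} - {i}. F (A' j)) = (\<Prod>j\<in>{..<k} - {i}. F UNIV)"
    by (intro prod.cong) (auto simp: A'_def)
  also have "\<dots> = F UNIV ^ (k - 1)" using i by simp
  finally show ?thesis by (simp add: A'_def)
qed

lemma prob_root_count_two_le:
  assumes A: "A \<in> events" "B \<in> events" and ij: "i < k" "j < k" "i \<noteq> j" and b: "coeff_le (F A) b"
  shows "prob {c. c [] = k \<and> branch c i \<in> A \<and> branch c j \<in> B \<and> c \<in> count l} \<le> pmf \<xi> k * (b * prob B)"
proof -
  define A' where "A' = (\<lambda>i'. if i' = i then A else if i' = j then B else UNIV)"
  have "prob {c. c [] = k \<and> (\<forall>j<k. branch c j \<in> A' j) \<and> c \<in> count l} = pmf \<xi> k * fps_nth (root_fps k * (\<Prod>j<k. F (A' j))) l"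
    by (rule prob_root_count) (use A in \<open>auto simp: A'_def\<close>)
  also have "{c. c [] = k \<and> (\<forall>j<k. branch c j \<in> A' j) \<and> c \<in> count l} = {c. c [] = k \<and> branch c i \<in> A \<and> branch c j \<in> B \<and> c \<in> count l}"
    using ij by (auto simp: A'_def)
  also have "(\<Prod>j<k. F (A' j)) = F (A' i) * (F (A' j) * (\<Prod>j\<in>{..<k} - {i} - {j}. F (A' j)))"
    using ij by (subst prod.remove[of _ i], simp, simp, subst prod.remove[of _ j]) auto
  also have "(\<Prod>j\<in>{..<k} - {i} - {j}. F (A' j)) = (\<Prod>j\<in>{..<k} - {i} - {j}. F UNIV)"
    by (intro prod.cong) (auto simp: A'_def)
  also have "F (A' i) = F A" by (simp add: A'_def)
  also have "F (A' j) = F B" using ij by (simp add: A'_def)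
  also have "root_fps k * (F A * (F B * (\<Prod>j\<in>{..<k} - {i} - {j}. F UNIV))) = 
      F A * (F B * (root_fps k * (\<Prod>j\<in>{..<k} - {i} - {j}. F UNIV)))" by (simp add: mult_ac)
  also have "fps_nth \<dots> l \<le> b * (prob B * (1 * (\<Prod>j\<in>{..<k} - {i} - {j}. 1)))"
    by (intro coeff_leD(2)[OF coeff_le_mult] b weight_le_mult weight_le_F A weight_le_prod weight_le_root_fps1 weight_le_F1) auto
  finally show ?thesis by (simp add: mult_left_mono)
qed

lemma prob_root_count_one_le:
  assumes A: "A \<in> events" and i: "i < k" and b: "coeff_le (F A) b"
  shows "prob {c. c [] = k \<and> branch c i \<in> A \<and> c \<in> count l} \<le> pmf \<xi> k * b"
proof -
  have "root_fps k * (F A * F UNIV ^ (k - 1)) = F A * (root_fps k * F UNIV ^ (k - 1))" by (simp add: mult_ac)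
  also have "fps_nth \<dots> l \<le> b * (1 * 1)"
    by (intro coeff_leD(2)[OF coeff_le_mult] b weight_le_mult weight_le_root_fps1 weight_le_power1 weight_le_F1) auto
  finally show ?thesis unfolding prob_root_count_one[OF A i] by (simp add: mult_left_mono)
qed

lemma prob_le_by_root:
  assumes E: "E \<in> events"
    and g: "\<And>k. prob {c \<in> E. c [] = k} \<le> g k" "g sums s"
  shows "prob E \<le> s"
  using sums_le[OF _ root_decomposition_sums[OF E] g(2)] g(1) by auto

lemma F_nth_root_all:
  assumes A: "A \<in> events" 
  shows "(\<lambda>k. if R k then pmf \<xi> k * fps_nth (root_fps k * F A ^ k) l else 0) sums 
     fps_nth (F {c. R (c []) \<and> (\<forall>i<c []. branch c i \<in> A)}) l"
proof -
  let ?E = "count l \<inter> {c. R (c []) \<and> (\<forall>i<c []. branch c i \<in> A)}"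
  have "?E \<in> events" by (intro sets.Int sets_count_event sets_all_branches A)
  from root_decomposition_sums[OF this] 
  have "(\<lambda>k. prob {c \<in> ?E. c [] = k}) sums fps_nth (F {c. R (c []) \<and> (\<forall>i<c []. branch c i \<in> A)}) l"
    by (simp add: F_nth)
  also have "(\<lambda>k. prob {c \<in> ?E. c [] = k}) = (\<lambda>k. if R k then pmf \<xi> k * fps_nth (root_fps k * F A ^ k) l else 0)"
  proof
    fix k
    have "{c \<in> ?E. c [] = k} = (if R k then {c. c [] = k \<and> (\<forall>i<k. branch c i \<in> A) \<and> c \<in> count l} else {})"
      by auto
    thus "prob {c \<in> ?E. c [] = k} = (if R k then pmf \<xi> k * fps_nth (root_fps k * F A ^ k) l else 0)"
      using prob_root_count[of k "\<lambda>_. A" l] A by simp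
  qed
  finally show ?thesis .
qed

lemma F_UNIV_sums: "(\<lambda>k. pmf \<xi> k * fps_nth (root_fps k * F UNIV ^ k) l) sums fps_nth (F UNIV) l"
  using F_nth_root_all[of UNIV "\<lambda>_. True" l] by simp

lemma prob_root_all_sums:
  assumes A: "A \<in> events" 
  shows "(\<lambda>k. pmf \<xi> k * prob A ^ k) sums prob {c. \<forall>i<c []. branch c i \<in> A}"
proof -
  let ?E = "{c. \<forall>i<c []. branch c i \<in> A}"
  have "?E \<in> events" using sets_all_branches[OF A, of "\<lambda>_. True"] by simp
  from root_decomposition_sums[OF this] have "(\<lambda>k. prob {c \<in> ?E. c [] = k}) sums prob ?E" .
  also have "(\<lambda>k. prob {c \<in> ?E. c [] = k}) = (\<lambda>k. pmf \<xi> k * prob A ^ k)"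
  proof
    fix k
    have "{c \<in> ?E. c [] = k} = {c. c [] = k \<and> (\<forall>i<k. branch c i \<in> A)}" by auto
    thus "prob {c \<in> ?E. c [] = k} = pmf \<xi> k * prob A ^ k"
      using root_branches_independent[of k "\<lambda>_. A" \<xi>] A by simp
  qed
  finally show ?thesis .
qed

end

text \<open>
  Interpolation between the trivial bound and the union bound: \<open>t\<close> is replaced by \<open>t powr \<kappa>\<close> where only
  moments of order \<open>1 + \<kappa>\<close> are at hand.
\<close>

lemma min_1_le_powr:
  assumes "(t::real) \<ge> 0" "0 < \<kappa>" "\<kappa> \<le> 1"
  shows "min 1 t \<le> t powr \<kappa>"
proof (cases "t \<le> 1")
  case True
  have "t \<le> t powr \<kappa>" using powr_mono'[of \<kappa> 1 t] assms True by (cases "t = 0") auto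
  thus ?thesis using True by simp
next
  case False
  hence "1 \<le> t powr \<kappa>" using assms by (intro ge_one_powr_ge_zero) auto
  thus ?thesis by simp
qed

lemma exp_minus_le_powr:
  assumes "(t::real) \<ge> 0" "0 < \<kappa>" "\<kappa> \<le> 1"
  shows "exp (- t) \<le> 1 - t + t powr (1 + \<kappa>)"
proof (cases "t \<le> 1")
  case True
  have "t ^ 2 \<le> t powr (1 + \<kappa>)"
  proof (cases "t = 0")
    case False
    hence "t powr 2 \<le> t powr (1 + \<kappa>)" using assms True by (intro powr_mono') auto
    thus ?thesis using False assms by simp
  qed auto
  moreover have "exp (- t) \<le> 1 - t + t ^ 2"
  proof -
    have "1 + t \<le> exp t" by (rule exp_ge_add_one_self)
    hence "exp (- t) \<le> 1 / (1 + t)" using assms by (simp add: exp_minus field_simps)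
    also have "\<dots> \<le> 1 - t + t ^ 2"
      using assms by (simp add: field_simps power2_eq_square)
    finally show ?thesis .
  qed
  ultimately show ?thesis by linarith
next
  case False
  have "t \<le> t powr (1 + \<kappa>)" using powr_mono[of 1 "1 + \<kappa>" t] False assms by simp
  moreover have "exp (- t) \<le> 1" using assms by simp
  ultimately show ?thesis by linarith
qed

text \<open>
  The parameters are kept abstract: \<open>m\<close> is the mean, and some moment of order above 1 is finite.
  Second moments may be infinite, as \<open>\<alpha>\<close> can be close to 1.
\<close>

locale subcritical_gw = gw_tree +
  fixes m \<kappa> :: real
  assumes p0: "pmf \<xi> 0 > 0"
    and mean: "(\<lambda>k. pmf \<xi> k * real k) sums m"
    and m_pos: "0 < m" and m_less_1: "m < 1"
    and Om: "\<exists>a\<in>\<Omega>. pmf \<xi> a > 0"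
    and \<kappa>: "0 < \<kappa>" "\<kappa> \<le> 1"
    and moment: "summable (\<lambda>k. pmf \<xi> k * real k powr (1 + \<kappa>))"
begin

definition "moment_const = (\<Sum>k. pmf \<xi> k * real k powr (1 + \<kappa>))"

text \<open>
  The bound of \<open>coeff_le_geometric_sum\<close> for the step law \<open>F UNIV\<close>; it also serves for every \<open>F A\<close>.
\<close>

definition "renewal_const = 1 / (1 - fps_nth (F UNIV) 0)"

lemma moment_sums: "(\<lambda>k. pmf \<xi> k * real k powr (1 + \<kappa>)) sums moment_const"
  using moment by (simp add: moment_const_def summable_sums)

lemma moment_const_nonneg: "moment_const \<ge> 0"
  unfolding moment_const_def by (intro suminf_nonneg moment) auto

lemma pmf_root_le: "pmf \<xi> k * fps_nth (root_fps k * F UNIV ^ k) l \<le> fps_nth (F UNIV) l"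
proof -
  have nn: "0 \<le> pmf \<xi> k * fps_nth (root_fps k * F UNIV ^ k) l" for k
    by (intro mult_nonneg_nonneg weight_leD(1)[where z=1 and s="1*1"] weight_le_mult weight_le_root_fps1
         weight_le_power1 weight_le_F1) auto
  have "(\<Sum>j\<in>{k}. pmf \<xi> j * fps_nth (root_fps j * F UNIV ^ j) l) \<le> fps_nth (F UNIV) l"
    using F_UNIV_sums[of l] nn by (subst sums_unique[OF F_UNIV_sums[of l]], intro sum_le_suminf) (auto simp: sums_iff)
  thus ?thesis by simp
qed

text \<open>
  The tree consisting of a root only if \<open>0 \<in> \<Omega>\<close>, and otherwise a root with outdegree \<open>a \<in> \<Omega>\<close> whose children
  are leaves, has exactly one \<open>\<Omega>\<close>-vertex.
\<close>

lemma F_UNIV_1_pos: "fps_nth (F UNIV) 1 > 0"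
proof (cases "0 \<in> \<Omega>")
  case True
  thus ?thesis using pmf_root_le[of 0 1] p0 by (simp add: root_fps_def)
next
  case False
  obtain a where a: "a \<in> \<Omega>" "pmf \<xi> a > 0" using Om by blast
  have "fps_nth (F UNIV) 0 \<ge> pmf \<xi> 0" using pmf_root_le[of 0 0] False by (simp add: root_fps_def)
  hence "pmf \<xi> a * fps_nth (F UNIV) 0 ^ a > 0" using a p0 by simp
  thus ?thesis using pmf_root_le[of a 1] a by (simp add: root_fps_def fps_nth_power_0)
qed

lemma F_UNIV_0_less_1: "fps_nth (F UNIV) 0 < 1"
proof -
  have "(\<Sum>l\<le>1. fps_nth (F UNIV) l) \<le> 1"
    using weight_leD(2)[OF weight_le_F1[OF UNIV_in_events], of 1] by simp
  thus ?thesis using F_UNIV_1_pos by simp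
qed

lemma renewal_const_pos: "renewal_const > 0"
  using F_UNIV_0_less_1 by (simp add: renewal_const_def)

section \<open>One-step bounds at the root\<close>

lemma coeff_leI:
  assumes "E \<in> events" "\<And>l k. prob {c. c [] = k \<and> c \<in> E \<and> c \<in> count l} \<le> g k" "g sums s"
  shows "coeff_le (F E) s"
  unfolding coeff_le_def
proof (intro allI conjI F_nonneg)
  fix l
  have "{c \<in> count l \<inter> E. c [] = k} = {c. c [] = k \<and> c \<in> E \<and> c \<in> count l}" for k by auto
  note eq = this
  show "fps_nth (F E) l \<le> s" unfolding F_nth
  proof (rule prob_le_by_root[where g = g, OF _ _ assms(3)])
    show "count l \<inter> E \<in> events" by (intro sets.Int sets_count_event assms(1))
    show "prob {c \<in> count l \<inter> E. c [] = k} \<le> g k" for k unfolding eq by (rule assms(2))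
  qed
qed

text \<open>
  A union bound over the children: on average there are \<open>m\<close> of them, and the branches other than the chosen
  one only smear out the count.
\<close>

lemma first_moment_step:
  assumes A: "A \<in> events" and b: "coeff_le (F A) b"
  shows "coeff_le (F {c. \<exists>i<c []. branch c i \<in> A}) (m * b)"
proof (rule coeff_leI)
  show "{c. \<exists>i<c []. branch c i \<in> A} \<in> events" by (rule sets_exists_branch[OF A])
  show "(\<lambda>k. pmf \<xi> k * real k * b) sums (m * b)" using mean by (rule sums_mult2)
  fix l k
  have "{c. c [] = k \<and> c \<in> {c. \<exists>i<c []. branch c i \<in> A} \<and> c \<in> count l} = 
     (\<Union>i\<in>{..<k}. {c. c [] = k \<and> branch c i \<in> A \<and> c \<in> count l})" by auto
  also have "prob \<dots> \<le> (\<Sum>i\<in>{..<k}. prob {c. c [] = k \<and> branch c i \<in> A \<and> c \<in> count l})"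
    by (intro finite_measure_subadditive_finite) (auto intro!: sets_root_count_one A)
  also have "\<dots> \<le> (\<Sum>i\<in>{..<k}. pmf \<xi> k * b)"
    by (intro sum_mono prob_root_count_one_le A b) auto
  finally show "prob {c. c [] = k \<and> c \<in> {c. \<exists>i<c []. branch c i \<in> A} \<and> c \<in> count l} \<le> pmf \<xi> k * real k * b"
    by (simp add: mult_ac)
qed

text \<open>
  The union bound over pairs of children gives \<open>k * k * prob B\<close>, but the second moment of \<open>\<xi>\<close>
  may be infinite.  Taking the minimum with the bound \<open>k\<close> for the event concerning \<open>A\<close> alone and interpolating
  leaves a moment of order \<open>1 + \<kappa>\<close>.
\<close>

lemma pair_step:
  assumes A: "A \<in> events" "B \<in> events" and b: "coeff_le (F A) b"
  shows "coeff_le (F {c. \<exists>i<c []. \<exists>j<c []. i \<noteq> j \<and> branch c i \<in> A \<and> branch c j \<in> B})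
           (moment_const * (b * prob B powr \<kappa>))"
proof (rule coeff_leI)
  let ?E = "{c. \<exists>i<c []. \<exists>j<c []. i \<noteq> j \<and> branch c i \<in> A \<and> branch c j \<in> B}"
  show "?E \<in> events" by (rule sets_exists_two_branches[OF A])
  show "(\<lambda>k. pmf \<xi> k * real k powr (1 + \<kappa>) * (b * prob B powr \<kappa>)) sums (moment_const * (b * prob B powr \<kappa>))"
    using moment_sums by (rule sums_mult2)
  fix l k
  have b0: "b \<ge> 0" using b by (rule coeff_le_nonneg)
  have ev2: "{c. c [] = k \<and> branch c i \<in> A \<and> branch c j \<in> B \<and> c \<in> count l} \<in> events" for i j
  proof -
    have "{c. c [] = k \<and> branch c i \<in> A \<and> branch c j \<in> B \<and> c \<in> count l} = {c. c [] = k} \<inter> {c. branch c i \<in> A} \<inter> {c. branch c j \<in> B} \<inter> count l" by auto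
    thus ?thesis by (auto intro!: sets.Int sets_gw_space_coordinate sets_branch A sets_count_event)
  qed
  let ?S = "{c. c [] = k \<and> c \<in> ?E \<and> c \<in> count l}"
  have "prob ?S \<le> prob (\<Union>i\<in>{..<k}. {c. c [] = k \<and> branch c i \<in> A \<and> c \<in> count l})"
    by (intro finite_measure_mono) (auto intro!: sets_root_count_one A)
  also have "\<dots> \<le> (\<Sum>i\<in>{..<k}. prob {c. c [] = k \<and> branch c i \<in> A \<and> c \<in> count l})"
    by (intro finite_measure_subadditive_finite) (auto intro!: sets_root_count_one A)
  also have "\<dots> \<le> (\<Sum>i\<in>{..<k}. pmf \<xi> k * b)"
    by (intro sum_mono prob_root_count_one_le A b) auto
  finally have 1: "prob ?S \<le> pmf \<xi> k * real k * b * 1" by (simp add: mult_ac)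
  define I where "I = {(i,j). i < k \<and> j < k \<and> i \<noteq> j}"
  have Iin: "p \<in> I \<Longrightarrow> fst p < k \<and> snd p < k \<and> fst p \<noteq> snd p" for p by (auto simp: I_def)
  have I: "I \<subseteq> {..<k} \<times> {..<k}" by (auto simp: I_def)
  have fI: "finite I" by (rule finite_subset[OF I]) auto
  have cI: "card I \<le> k * k" using card_mono[OF _ I] by (simp add: card_cartesian_product)
  have "?S = (\<Union>(i,j)\<in>I. {c. c [] = k \<and> branch c i \<in> A \<and> branch c j \<in> B \<and> c \<in> count l})"
    unfolding I_def by auto
  also have "prob \<dots> \<le> (\<Sum>(i,j)\<in>I. prob {c. c [] = k \<and> branch c i \<in> A \<and> branch c j \<in> B \<and> c \<in> count l})"
    unfolding case_prod_unfold by (rule finite_measure_subadditive_finite[OF fI]) (auto intro!: ev2)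
  also have "\<dots> \<le> (\<Sum>(i,j)\<in>I. pmf \<xi> k * (b * prob B))"
    unfolding case_prod_unfold by (intro sum_mono prob_root_count_two_le A b) (auto dest: Iin)
  also have "\<dots> = real (card I) * (pmf \<xi> k * (b * prob B))" by (simp add: case_prod_unfold)
  also have "\<dots> \<le> real (k * k) * (pmf \<xi> k * (b * prob B))"
    using cI b0 by (intro mult_right_mono of_nat_mono) auto
  finally have 2: "prob ?S \<le> pmf \<xi> k * real k * b * (real k * prob B)" by (simp add: mult_ac)
  have "prob ?S \<le> pmf \<xi> k * real k * b * min 1 (real k * prob B)"
    using 1 2 by (cases "1 \<le> real k * prob B") (auto simp: min_def)
  also have "\<dots> \<le> pmf \<xi> k * real k * b * (real k * prob B) powr \<kappa>"
    using b0 by (intro mult_left_mono min_1_le_powr \<kappa>) auto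
  also have "\<dots> = pmf \<xi> k * (real k * real k powr \<kappa>) * (b * prob B powr \<kappa>)"
    by (simp add: powr_mult mult_ac)
  also have "real k * real k powr \<kappa> = real k powr (1 + \<kappa>)"
    by (cases "k = 0") (auto simp: powr_add)
  finally show "prob ?S \<le> pmf \<xi> k * real k powr (1 + \<kappa>) * (b * prob B powr \<kappa>)" .
qed

lemma coeff_leI_partial:
  assumes E: "E \<in> events" "\<And>l K. (\<Sum>k<K. prob {c. c [] = k \<and> c \<in> E \<and> c \<in> count l}) \<le> s"
  shows "coeff_le (F E) s"
  unfolding coeff_le_def
proof (intro allI conjI F_nonneg)
  fix l
  have eq: "{c \<in> count l \<inter> E. c [] = k} = {c. c [] = k \<and> c \<in> E \<and> c \<in> count l}" for k by auto
  have "(\<lambda>k. prob {c \<in> count l \<inter> E. c [] = k}) sums fps_nth (F E) l"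
    unfolding F_nth by (intro root_decomposition_sums sets.Int sets_count_event E)
  hence s: "(\<lambda>k. prob {c. c [] = k \<and> c \<in> E \<and> c \<in> count l}) sums fps_nth (F E) l" unfolding eq .
  show "fps_nth (F E) l \<le> s"
    unfolding sums_unique[OF s] using E(2) s by (intro suminf_le_const) (auto simp: sums_iff)
qed

text \<open>
  The point of this bound is that it does not grow with the range of outdegrees: the sum over \<open>k\<close> is a
  renewal function, so only the supremum \<open>D\<close> of the weights enters.  Here \<open>G k\<close> is the joint law of the counts
  in the branches.
\<close>

lemma big_root_bound:
  assumes E: "E \<in> events" "E \<subseteq> {c. M \<le> c []}"
    and G: "\<And>k. weight_le 1 (G k) t" "\<And>K. coeff_le (\<Sum>k\<in>{M..<K}. G k) s" and D: "D \<ge> 0"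
    and le: "\<And>k l. k \<ge> M \<Longrightarrow> prob {c. c [] = k \<and> c \<in> E \<and> c \<in> count l} \<le> D * fps_nth (root_fps k * G k) l"
  shows "coeff_le (F E) (2 * D * s)"
proof (rule coeff_leI_partial[OF E(1)])
  fix l K
  define S where "S = (\<Sum>k\<in>{M..<K}. G k)"
  have S: "coeff_le S s" unfolding S_def by (rule G)
  have "coeff_le (S * fps_X) (s * 1)" by (intro coeff_le_mult S weight_le_X) auto
  hence XS: "coeff_le (fps_X * S) s" by (simp add: mult.commute)
  have "prob {c. c [] = k \<and> c \<in> E \<and> c \<in> count l} \<le>
     (if k \<in> {M..<K} then D * (fps_nth (G k) l + fps_nth (fps_X * G k) l) else 0)" if "k < K" for k
  proof (cases "k \<ge> M")
    case True
    have "prob {c. c [] = k \<and> c \<in> E \<and> c \<in> count l} \<le> D * fps_nth (root_fps k * G k) l" by (rule le[OF True])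
    also have "\<dots> \<le> D * (fps_nth (G k) l + fps_nth (fps_X * G k) l)"
      by (intro mult_left_mono D root_fps_mult_le weight_leD(1)[OF G(1)])
    finally show ?thesis using True that by simp
  next
    case False
    hence e: "{c. c [] = k \<and> c \<in> E \<and> c \<in> count l} = {}" using E(2) by auto
    show ?thesis unfolding e using False by simp
  qed
  hence "(\<Sum>k<K. prob {c. c [] = k \<and> c \<in> E \<and> c \<in> count l}) \<le>
     (\<Sum>k<K. if k \<in> {M..<K} then D * (fps_nth (G k) l + fps_nth (fps_X * G k) l) else 0)"
    by (intro sum_mono) auto
  also have "\<dots> = (\<Sum>k\<in>{M..<K}. D * (fps_nth (G k) l + fps_nth (fps_X * G k) l))"
    by (subst sum.inter_restrict[symmetric]) (auto intro!: sum.cong)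
  also have "\<dots> = D * (fps_nth S l + fps_nth (fps_X * S) l)"
    unfolding S_def sum_distrib_left[symmetric] sum.distrib fps_sum_nth[symmetric] by simp
  also have "\<dots> \<le> D * (s + s)" by (intro mult_left_mono add_mono coeff_leD S XS D)
  finally show "(\<Sum>k<K. prob {c. c [] = k \<and> c \<in> E \<and> c \<in> count l}) \<le> 2 * D * s" by (simp add: mult_ac)
qed

text \<open>
  Each of the at least \<open>M\<close> branches contributes a factor \<open>prob A\<close>.
\<close>

lemma big_root_all:
  assumes A: "A \<in> events" and D: "\<And>k. k \<ge> M \<Longrightarrow> pmf \<xi> k \<le> D"
  shows "coeff_le (F {c. M \<le> c [] \<and> (\<forall>i<c []. branch c i \<in> A)}) (2 * D * (renewal_const * prob A ^ M))"
proof (rule big_root_bound[where G = "\<lambda>k. F A ^ k"])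
  let ?E = "{c. M \<le> c [] \<and> (\<forall>i<c []. branch c i \<in> A)}"
  show "?E \<in> events" by (rule sets_all_branches[OF A])
  show "weight_le 1 (F A ^ k) 1" for k by (intro weight_le_power1 weight_le_F1 A) auto
  show "coeff_le (\<Sum>k\<in>{M..<K}. F A ^ k) (renewal_const * prob A ^ M)" for K
    using coeff_le_geometric_tail[OF weight_le_F[OF A] prob_le_1 F_mono F_UNIV_0_less_1]
    by (simp add: renewal_const_def)
  show "D \<ge> 0" using D[of M] pmf_nonneg[of \<xi> M] by linarith
  fix k l assume k: "k \<ge> M"
  hence "{c. c [] = k \<and> c \<in> ?E \<and> c \<in> count l} = {c. c [] = k \<and> (\<forall>i<k. branch c i \<in> A) \<and> c \<in> count l}" by auto
  hence "prob {c. c [] = k \<and> c \<in> ?E \<and> c \<in> count l} = pmf \<xi> k * fps_nth (root_fps k * F A ^ k) l"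
    using prob_root_count[of k "\<lambda>_. A" l] A by simp
  also have "\<dots> \<le> D * fps_nth (root_fps k * F A ^ k) l"
    by (intro mult_right_mono D k weight_leD(1)[where z=1 and s="1*1"] weight_le_mult weight_le_root_fps1
         weight_le_power1 weight_le_F1 A) auto
  finally show "prob {c. c [] = k \<and> c \<in> ?E \<and> c \<in> count l} \<le> D * fps_nth (root_fps k * F A ^ k) l" .
qed auto

text \<open>
  The number \<open>k\<close> of choices of the branch is absorbed into the weight \<open>k * pmf \<xi> k\<close>.
\<close>

lemma big_root_exists:
  assumes A: "A \<in> events" and M: "M \<ge> 1" and D: "\<And>k. k \<ge> M \<Longrightarrow> real k * pmf \<xi> k \<le> D"
  shows "coeff_le (F {c. M \<le> c [] \<and> (\<exists>i<c []. branch c i \<in> A)}) (2 * D * (renewal_const * prob A))"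
proof (rule big_root_bound[where G = "\<lambda>k. F A * F UNIV ^ (k - 1)"])
  let ?E = "{c. M \<le> c [] \<and> (\<exists>i<c []. branch c i \<in> A)}" and ?G = "\<lambda>k. F A * F UNIV ^ (k - 1)"
  have "{c. M \<le> c []} \<inter> {c. \<exists>i<c []. branch c i \<in> A} \<in> events"
    by (intro sets.Int sets_gw_space_coordinate sets_exists_branch A)
  thus "?E \<in> events" by (simp add: Collect_conj_eq)
  show wG: "weight_le 1 (?G k) (1 * 1)" for k
    by (intro weight_le_mult weight_le_power1 weight_le_F1 A) auto
  show "D \<ge> 0" using D[of M] mult_nonneg_nonneg[OF _ pmf_nonneg[of \<xi> M], of "real M"] by linarith
  show "coeff_le (\<Sum>k\<in>{M..<K}. ?G k) (renewal_const * prob A)" for K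
  proof -
    have eq: "(\<Sum>k\<in>{M..<K}. ?G k) = (\<Sum>k\<in>{M-1..<K-1}. F UNIV ^ k) * F A"
      unfolding sum_distrib_right
      by (rule sum.reindex_bij_witness[of _ Suc "\<lambda>k. k - 1"]) (use M in \<open>auto simp: mult.commute\<close>)
    have "coeff_le (\<Sum>k\<in>{M-1..<K-1}. F UNIV ^ k) (1 ^ (M-1) / (1 - fps_nth (F UNIV) 0))"
      by (rule coeff_le_geometric_tail[OF weight_le_F1 _ order_refl F_UNIV_0_less_1]) auto
    hence "coeff_le (\<Sum>k\<in>{M-1..<K-1}. F UNIV ^ k) renewal_const" by (simp add: renewal_const_def)
    from coeff_le_mult[OF this weight_le_F[OF A]] show ?thesis unfolding eq .
  qed
  fix k l assume k: "k \<ge> M"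
  have "{c. c [] = k \<and> c \<in> ?E \<and> c \<in> count l} = (\<Union>i\<in>{..<k}. {c. c [] = k \<and> branch c i \<in> A \<and> c \<in> count l})"
    using k by auto
  also have "prob \<dots> \<le> (\<Sum>i\<in>{..<k}. prob {c. c [] = k \<and> branch c i \<in> A \<and> c \<in> count l})"
    by (intro finite_measure_subadditive_finite) (auto intro!: sets_root_count_one A)
  also have "\<dots> = (\<Sum>i\<in>{..<k}. pmf \<xi> k * fps_nth (root_fps k * ?G k) l)"
    by (intro sum.cong refl prob_root_count_one A) auto
  also have "\<dots> = (real k * pmf \<xi> k) * fps_nth (root_fps k * ?G k) l" by simp
  also have "\<dots> \<le> D * fps_nth (root_fps k * ?G k) l"
    by (intro mult_right_mono D k weight_leD(1)[OF weight_le_mult[OF weight_le_root_fps1 wG]]) auto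
  finally show "prob {c. c [] = k \<and> c \<in> ?E \<and> c \<in> count l} \<le> D * fps_nth (root_fps k * ?G k) l" .
qed auto

section \<open>The tail of the height\<close>

lemma compl_events: "A \<in> events \<Longrightarrow> - A \<in> events"
  using sets.compl_sets[of A "gw_space \<xi>"] by (simp add: Compl_eq_Diff_UNIV)

lemma prob_Compl: "A \<in> events \<Longrightarrow> prob (- A) = 1 - prob A"
  using prob_compl[of A] by (simp add: Compl_eq_Diff_UNIV)

lemma prob_reach_Suc:
  "(\<lambda>k. pmf \<xi> k * (1 - prob (reach h)) ^ k) sums (1 - prob (reach (Suc h)))"
proof -
  have "{c. \<forall>i<c []. branch c i \<in> - reach h} = - reach (Suc h)"
    by (auto simp: reach_Suc)
  thus ?thesis
    using prob_root_all_sums[OF compl_events[OF sets_reach], of h] by (simp add: prob_Compl sets_reach)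
qed

lemma pmf_sums_1: "pmf \<xi> sums 1"
  using root_decomposition_sums[OF UNIV_in_events] prob_space root_branches_independent[of _ "\<lambda>_. UNIV" \<xi>]
  by simp

text \<open>
  The first moment bound, in the form of Bernoulli's inequality applied to the recursion.
\<close>

lemma prob_reach_le: "prob (reach h) \<le> m ^ h"
proof (induction h)
  case (Suc h)
  define x where "x = prob (reach h)"
  have x: "0 \<le> x" "x \<le> 1" by (auto simp: x_def)
  have "(\<lambda>k. pmf \<xi> k - pmf \<xi> k * real k * x) sums (1 - m * x)"
    by (intro sums_diff pmf_sums_1 sums_mult2 mean)
  hence "1 - m * x \<le> 1 - prob (reach (Suc h))"
  proof (rule sums_le[rotated])
    show "(\<lambda>k. pmf \<xi> k * (1 - x) ^ k) sums (1 - prob (reach (Suc h)))"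
      unfolding x_def by (rule prob_reach_Suc)
    fix k
    have "1 - real k * x \<le> (1 - x) ^ k" using Bernoulli_inequality[of "- x" k] x by simp
    hence "pmf \<xi> k * (1 - real k * x) \<le> pmf \<xi> k * (1 - x) ^ k" by (intro mult_left_mono) auto
    thus "pmf \<xi> k - pmf \<xi> k * real k * x \<le> pmf \<xi> k * (1 - x) ^ k" by (simp add: algebra_simps)
  qed
  moreover have "m * x \<le> m * m ^ h" using Suc m_pos by (intro mult_left_mono) (auto simp: x_def)
  ultimately show ?case by simp
qed auto

lemma prob_reach_pos: "prob (reach h) > 0"
proof (induction h)
  case 0
  show ?case using prob_space by simp
next
  case (Suc h)
  have "\<exists>k>0. pmf \<xi> k > 0"
  proof (rule ccontr)
    assume "\<not> ?thesis"
    hence "pmf \<xi> k * real k = 0" for k by (metis less_eq_real_def mult_eq_0_iff neq0_conv of_nat_0 pmf_nonneg)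
    hence "(\<lambda>k. pmf \<xi> k * real k) = (\<lambda>_. 0)" by blast
    hence "(\<lambda>k. pmf \<xi> k * real k) sums 0" by simp
    with mean m_pos show False using sums_unique2 by fastforce
  qed
  then obtain k where k: "k > 0" "pmf \<xi> k > 0" by blast
  define A where "A = (\<lambda>i::nat. if i = 0 then reach h else UNIV)"
  have "0 < pmf \<xi> k * prob (reach h)" using k Suc by simp
  also have "prob (reach h) = (\<Prod>i<k. prob (A i))"
  proof -
    have "(\<Prod>i<k. prob (A i)) = prob (A 0) * (\<Prod>i\<in>{..<k}-{0}. prob (A i))" using k by (intro prod.remove) auto
    also have "(\<Prod>i\<in>{..<k}-{0}. prob (A i)) = 1" using prob_space by (intro prod.neutral) (auto simp: A_def)
    finally show ?thesis by (simp add: A_def)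
  qed
  also have "pmf \<xi> k * \<dots> = prob {c. c [] = k \<and> (\<forall>i<k. branch c i \<in> A i)}"
    by (rule root_branches_independent[symmetric]) (auto simp: A_def sets_reach)
  also have "\<dots> \<le> prob (reach (Suc h))"
    using k by (intro finite_measure_mono sets_reach) (auto simp: reach_Suc A_def)
  finally show ?case .
qed

lemma prob_reach_Suc_ge: "prob (reach (Suc h)) \<ge> m * prob (reach h) - moment_const * prob (reach h) powr (1 + \<kappa>)"
proof -
  define x where "x = prob (reach h)"
  have x: "0 \<le> x" "x \<le> 1" by (auto simp: x_def)
  have "1 - prob (reach (Suc h)) \<le> 1 - m * x + moment_const * x powr (1 + \<kappa>)"
  proof (rule sums_le)
    show "(\<lambda>k. pmf \<xi> k * (1 - x) ^ k) sums (1 - prob (reach (Suc h)))"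
      unfolding x_def by (rule prob_reach_Suc)
    show "(\<lambda>k. pmf \<xi> k - pmf \<xi> k * real k * x + pmf \<xi> k * real k powr (1 + \<kappa>) * x powr (1 + \<kappa>)) 
      sums (1 - m * x + moment_const * x powr (1 + \<kappa>))"
      by (intro sums_add sums_diff pmf_sums_1 sums_mult2 mean moment_sums)
    fix k
    have "(1 - x) ^ k \<le> exp (- x) ^ k" using x exp_ge_add_one_self[of "- x"] by (intro power_mono) auto
    also have "\<dots> = exp (- (real k * x))" by (simp add: exp_of_nat_mult[symmetric])
    also have "\<dots> \<le> 1 - real k * x + (real k * x) powr (1 + \<kappa>)"
      using x \<kappa> by (intro exp_minus_le_powr) auto
    also have "(real k * x) powr (1 + \<kappa>) = real k powr (1 + \<kappa>) * x powr (1 + \<kappa>)" using x by (simp add: powr_mult)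
    finally have "pmf \<xi> k * (1 - x) ^ k \<le> pmf \<xi> k * (1 - real k * x + real k powr (1 + \<kappa>) * x powr (1 + \<kappa>))"
      by (intro mult_left_mono) auto
    thus "pmf \<xi> k * (1 - x) ^ k \<le> pmf \<xi> k - pmf \<xi> k * real k * x + pmf \<xi> k * real k powr (1 + \<kappa>) * x powr (1 + \<kappa>)"
      by (simp add: algebra_simps)
  qed
  thus ?thesis by (simp add: x_def)
qed

text \<open>
  One step of the recursion loses a factor \<open>1 - D * r ^ h\<close> against multiplication by \<open>m\<close>, where
  \<open>r < 1\<close>, because the probability \<open>x h\<close> is itself at most \<open>m ^ h\<close>.  The product of these factors converges; from \<open>h0\<close> on it
  stays above \<open>1/2\<close>.
\<close>

lemma prob_reach_ge: "\<exists>c>0. \<forall>h. prob (reach h) \<ge> c * m ^ h"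
proof -
  define x where "x = (\<lambda>h. prob (reach h))"
  define r where "r = m powr \<kappa>"
  have r: "0 < r" "r < 1" using m_pos m_less_1 \<kappa> powr_less_mono2[of \<kappa> m 1] by (auto simp: r_def)
  define D where "D = moment_const / m"
  have D: "D \<ge> 0" using moment_const_nonneg m_pos by (simp add: D_def)
  have step: "x (Suc h) \<ge> m * x h * (1 - D * r ^ h)" for h
  proof -
    have xp: "x h > 0" using prob_reach_pos by (simp add: x_def)
    have "x h powr \<kappa> \<le> (m ^ h) powr \<kappa>" using xp \<kappa> prob_reach_le by (intro powr_mono2) (auto simp: x_def)
    also have "\<dots> = r ^ h" using m_pos by (simp add: r_def powr_power powr_realpow[symmetric] powr_powr mult.commute)
    finally have "moment_const * x h * x h powr \<kappa> \<le> moment_const * x h * r ^ h"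
      using moment_const_nonneg xp by (intro mult_left_mono) auto
    moreover have "x h * x h powr \<kappa> = x h powr (1 + \<kappa>)" using xp by (simp add: powr_add)
    ultimately have "moment_const * x h powr (1 + \<kappa>) \<le> moment_const * x h * r ^ h" by (simp add: mult.assoc)
    hence "x (Suc h) \<ge> m * x h - moment_const * x h * r ^ h"
      using prob_reach_Suc_ge[of h] by (simp add: x_def)
    thus ?thesis using m_pos by (simp add: D_def algebra_simps)
  qed
  have "(\<lambda>h. D * r ^ h / (1 - r)) \<longlonglongrightarrow> D * 0 / (1 - r)"
    using r by (intro tendsto_intros LIMSEQ_realpow_zero) auto
  hence "\<forall>\<^sub>F h in sequentially. D * r ^ h / (1 - r) < 1/2" by (intro order_tendstoD) auto
  then obtain h0 where h0: "D * r ^ h0 / (1 - r) < 1/2" by (auto simp: eventually_sequentially)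
  define s where "s = (\<lambda>j. D * (\<Sum>i<j. r ^ (h0 + i)))"
  have s: "0 \<le> s j" "s j \<le> 1/2" for j
  proof -
    show "0 \<le> s j" using D r by (auto simp: s_def intro!: mult_nonneg_nonneg sum_nonneg)
    have "s j = D * r ^ h0 * (\<Sum>i<j. r ^ i)" by (simp add: s_def power_add sum_distrib_left mult_ac)
    also have "(\<Sum>i<j. r ^ i) \<le> (\<Sum>i. r ^ i)" using r by (intro sum_le_suminf summable_geometric) auto
    also have "(\<Sum>i. r ^ i) = 1 / (1 - r)" using r by (intro suminf_geometric) auto
    finally have "s j \<le> D * r ^ h0 * (1 / (1 - r))" using D r by (simp add: mult_left_mono)
    also have "\<dots> = D * r ^ h0 / (1 - r)" by simp
    finally show "s j \<le> 1/2" using h0 by linarith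
  qed
  have main: "x (h0 + j) \<ge> x h0 * m ^ j * (1 - s j)" for j
  proof (induction j)
    case 0
    show ?case by (simp add: s_def)
  next
    case (Suc j)
    define t where "t = D * r ^ (h0 + j)"
    have sS: "s (Suc j) = s j + t" by (simp add: s_def t_def algebra_simps)
    have t: "0 \<le> t" "t \<le> 1" using s[of "Suc j"] s[of j] D r unfolding sS by (auto simp: t_def)
    have "x h0 * m ^ Suc j * (1 - s (Suc j)) \<le> x h0 * m ^ Suc j * ((1 - s j) * (1 - t))"
      using s[of j] t m_pos unfolding sS
      by (intro mult_left_mono mult_nonneg_nonneg) (auto simp: algebra_simps x_def)
    also have "\<dots> = m * (x h0 * m ^ j * (1 - s j)) * (1 - t)" by simp
    also have "\<dots> \<le> m * x (h0 + j) * (1 - t)"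
      using Suc t m_pos by (intro mult_right_mono mult_left_mono) auto
    also have "\<dots> \<le> x (h0 + Suc j)" using step[of "h0 + j"] by (simp add: t_def)
    finally show ?case .
  qed
  show ?thesis
  proof (intro exI[of _ "x h0 / 2"] conjI allI)
    show "0 < x h0 / 2" using prob_reach_pos by (simp add: x_def)
    fix h
    show "prob (reach h) \<ge> x h0 / 2 * m ^ h"
    proof (cases "h \<ge> h0")
      case True
      then obtain j where j: "h = h0 + j" using le_iff_add by blast
      have "x h0 / 2 * m ^ h \<le> x h0 / 2 * m ^ j" using m_pos m_less_1 prob_reach_pos[of h0] unfolding j
        by (intro mult_left_mono power_decreasing) (auto simp: x_def)
      also have "\<dots> = x h0 * m ^ j * (1 - 1/2)" by simp
      also have "\<dots> \<le> x h0 * m ^ j * (1 - s j)" using s[of j] m_pos by (intro mult_left_mono) (auto simp: x_def)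
      also have "\<dots> \<le> x h" using main[of j] by (simp add: j)
      finally show ?thesis by (simp add: x_def)
    next
      case False
      have "x h0 / 2 * m ^ h \<le> x h0 * 1"
        using m_pos m_less_1 by (intro mult_mono power_le_one) (auto simp: x_def)
      also have "\<dots> \<le> x h" using False reach_antimono[of h h0] unfolding x_def
        by (simp add: finite_measure_mono sets_reach)
      finally show ?thesis by (simp add: x_def)
    qed
  qed
qed

text \<open>
  The tree is almost surely finite, since \<open>m ^ h\<close> tends to 0.
\<close>

lemma F_UNIV_sums_1: "fps_nth (F UNIV) sums 1"
proof -
  have sums: "(\<lambda>l. prob (count l)) sums prob (\<Union>l. count l)"
    using count_event_disjoint
    by (intro finite_measure_UNION) (auto simp: disjoint_family_on_def sets_count_event)
  have ev: "(\<Union>l. count l) \<in> events" by (auto intro!: sets_count_event)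
  have "1 - m ^ h \<le> prob (\<Union>l. count l)" for h
  proof -
    have "1 - m ^ h \<le> prob (- reach h)" using prob_reach_le by (simp add: prob_Compl sets_reach)
    also have "\<dots> \<le> prob (\<Union>l. count l)"
    proof (intro finite_measure_mono ev subsetI)
      fix c assume "c \<in> - reach h"
      hence "finite (tree_of c)" using finite_tree_of by blast
      thus "c \<in> (\<Union>l. count l)"
        by (auto simp: count_event_def vertices_outdegree_in_tree_of)
    qed
    finally show ?thesis .
  qed
  moreover have "(\<lambda>h. 1 - m ^ h) \<longlonglongrightarrow> 1 - 0" using m_pos m_less_1 by (intro tendsto_intros LIMSEQ_realpow_zero) auto
  ultimately have "1 - 0 \<le> prob (\<Union>l. count l)" by (intro LIMSEQ_le_const2) auto
  hence "prob (\<Union>l. count l) = 1" by (intro antisym) auto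
  with sums show ?thesis by (simp add: F_nth[abs_def])
qed

end

text \<open>
  A Taylor bound whose remainder, for \<open>x\<close> proportional to \<open>\<xi>\<close>, is controlled by the moment of order \<open>1 + \<kappa>\<close>
  once the exponential factor is bounded.
\<close>

lemma exp_le_powr_remainder:
  assumes "(x::real) \<ge> 0" "0 < \<kappa>" "\<kappa> \<le> 1"
  shows "exp x \<le> 1 + x + x powr (1 + \<kappa>) * exp x"
proof (cases "x \<le> 1")
  case True
  have "x ^ 2 \<le> x powr (1 + \<kappa>)"
  proof (cases "x = 0")
    case False
    hence "x powr 2 \<le> x powr (1 + \<kappa>)" using assms True by (intro powr_mono') auto
    thus ?thesis using False assms by simp
  qed auto
  also have "\<dots> \<le> x powr (1 + \<kappa>) * exp x" using assms mult_left_mono[of 1 "exp x" "x powr (1 + \<kappa>)"] by simp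
  finally show ?thesis using exp_bound[of x] assms True by simp
next
  case False
  have "x powr (1 + \<kappa>) \<ge> 1" using False assms by (intro ge_one_powr_ge_zero) auto
  hence "1 * exp x \<le> x powr (1 + \<kappa>) * exp x" by (intro mult_right_mono) auto
  thus ?thesis using assms(1) by linarith
qed

lemma partial_sum_le_sums:
  fixes f :: "nat \<Rightarrow> real"
  assumes "f sums s" "\<And>k. f k \<ge> 0"
  shows "(\<Sum>k<n. f k) \<le> s"
  using sum_le_suminf[of f "{..<n}"] assms by (simp add: sums_iff)

text \<open>
  What is needed of regular variation: the point probabilities at \<open>k \<ge> \<delta> n\<close> are dominated by the
  one at \<open>n\<close>, and they decay at most polynomially.  That \<open>\<Omega>\<close> or its complement is finite makes the contribution
  of a big vertex to the count a constant.
\<close>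

locale condensation_gw = subcritical_gw +
  assumes Om_finite: "finite \<Omega> \<or> finite (- \<Omega>)"
    and compare: "\<exists>k0. \<forall>\<delta>>0. \<exists>C>0. \<forall>n\<ge>k0. \<forall>k\<ge>k0. \<delta> * real n \<le> real k \<longrightarrow>
           real k * pmf \<xi> k \<le> C * (real n * pmf \<xi> n)"
    and poly_lower: "\<exists>A>0. \<forall>\<^sub>F n in sequentially. pmf \<xi> n \<ge> real n powr (- A)"
begin

section \<open>Trees without big vertices\<close>

definition no_big :: "nat \<Rightarrow> (nat list \<Rightarrow> nat) set" where
  "no_big M = (\<Inter>j. - big_at M j)"

lemma sets_no_big: "no_big M \<in> events"
  unfolding no_big_def by (auto intro!: compl_events sets_big_at)

lemma no_big_root:
  "no_big M \<inter> - reach (Suc h) = {c. c [] < M \<and> (\<forall>i<c []. branch c i \<in> no_big M \<inter> - reach h)}" (is "?L = ?R")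
proof (intro set_eqI iffI)
  fix c assume c: "c \<in> ?L"
  have "c \<notin> big_at M 0" "c \<notin> big_at M (Suc j)" for j using c by (auto simp: no_big_def)
  moreover have "c \<notin> reach (Suc h)" using c by auto
  ultimately show "c \<in> ?R" by (auto simp: no_big_def big_at_0 big_at_Suc reach_Suc)
next
  fix c assume c: "c \<in> ?R"
  have "c \<notin> big_at M j" for j using c by (cases j) (auto simp: big_at_0 big_at_Suc no_big_def)
  thus "c \<in> ?L" using c by (auto simp: no_big_def reach_Suc)
qed

text \<open>
  A supersolution \<open>s\<close> of the recursion for the exponential moment bounds it at every height, starting from the empty
  event \<open>- reach 0\<close>.  The restriction to bounded height is what allows the induction.
\<close>

lemma weight_le_no_big:
  assumes z: "z \<ge> 1" and s: "s \<ge> 0" "(\<Sum>k<M. pmf \<xi> k * (z * s ^ k)) \<le> s"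
  shows "weight_le z (F (no_big M \<inter> - reach h)) s"
proof (induction h)
  case 0
  have "F (no_big M \<inter> - reach 0) = 0" by (rule fps_ext) (simp add: F_nth)
  thus ?case using s by (simp add: weight_le_def)
next
  case (Suc h)
  define A where "A = no_big M \<inter> - reach h"
  have A: "A \<in> events" unfolding A_def by (intro sets.Int sets_no_big compl_events sets_reach)
  have w: "weight_le z (root_fps k * F A ^ k) (z ^ of_bool (k \<in> \<Omega>) * s ^ k)" for k
    using z Suc unfolding A_def by (intro weight_le_mult weight_le_root_fps weight_le_power) auto
  have nth: "fps_nth (F (no_big M \<inter> - reach (Suc h))) l = (\<Sum>k<M. pmf \<xi> k * fps_nth (root_fps k * F A ^ k) l)" for l
  proof -
    have "(\<lambda>k. if k < M then pmf \<xi> k * fps_nth (root_fps k * F A ^ k) l else 0) sums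
      fps_nth (F (no_big M \<inter> - reach (Suc h))) l"
      unfolding no_big_root A_def[symmetric] by (rule F_nth_root_all[OF A, of "\<lambda>k. k < M"])
    moreover have "(\<lambda>k. if k < M then pmf \<xi> k * fps_nth (root_fps k * F A ^ k) l else 0) sums
       (\<Sum>k\<in>{..<M}. pmf \<xi> k * fps_nth (root_fps k * F A ^ k) l)"
      using sums_If_finite_set[of "{..<M}" "\<lambda>k. pmf \<xi> k * fps_nth (root_fps k * F A ^ k) l"] by simp
    ultimately show ?thesis by (rule sums_unique2)
  qed
  show ?case unfolding weight_le_def
  proof (intro conjI allI F_nonneg)
    fix L
    have "(\<Sum>l\<le>L. fps_nth (F (no_big M \<inter> - reach (Suc h))) l * z ^ l) = 
       (\<Sum>k<M. pmf \<xi> k * (\<Sum>l\<le>L. fps_nth (root_fps k * F A ^ k) l * z ^ l))"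
      unfolding nth sum_distrib_right sum_distrib_left by (subst sum.swap) (simp add: mult_ac)
    also have "\<dots> \<le> (\<Sum>k<M. pmf \<xi> k * (z * s ^ k))"
    proof (intro sum_mono mult_left_mono pmf_nonneg)
      fix k
      have "(\<Sum>l\<le>L. fps_nth (root_fps k * F A ^ k) l * z ^ l) \<le> z ^ of_bool (k \<in> \<Omega>) * s ^ k"
        by (rule weight_leD(2)[OF w])
      also have "\<dots> \<le> z * s ^ k" using z s by (intro mult_right_mono) auto
      finally show "(\<Sum>l\<le>L. fps_nth (root_fps k * F A ^ k) l * z ^ l) \<le> z * s ^ k" .
    qed
    also have "\<dots> \<le> s" by (rule s)
    finally show "(\<Sum>l\<le>L. fps_nth (F (no_big M \<inter> - reach (Suc h))) l * z ^ l) \<le> s" .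
  qed
qed

text \<open>
  Markov's inequality for \<open>z ^ N\<close>, after letting the height bound tend to infinity.
\<close>

lemma prob_no_big_le:
  assumes z: "z \<ge> 1" and s: "s \<ge> 0" "(\<Sum>k<M. pmf \<xi> k * (z * s ^ k)) \<le> s"
  shows "prob (count n \<inter> no_big M) \<le> s / z ^ n"
proof -
  have "prob (count n \<inter> no_big M) \<le> s / z ^ n + m ^ h" for h
  proof -
    have "prob (count n \<inter> no_big M) \<le> prob ((count n \<inter> (no_big M \<inter> - reach h)) \<union> reach h)"
      by (intro finite_measure_mono sets.Un sets.Int sets_no_big compl_events sets_reach sets_count_event) auto
    also have "\<dots> \<le> prob (count n \<inter> (no_big M \<inter> - reach h)) + prob (reach h)"
      by (intro measure_Un_le sets.Int sets_no_big compl_events sets_reach sets_count_event)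
    also have "prob (reach h) \<le> m ^ h" by (rule prob_reach_le)
    also have "prob (count n \<inter> (no_big M \<inter> - reach h)) \<le> s / z ^ n"
      using weight_le_coeff[OF weight_le_no_big[OF assms], of h n] z by (simp add: F_nth field_simps)
    finally show ?thesis by simp
  qed
  moreover have "(\<lambda>h. s / z ^ n + m ^ h) \<longlonglongrightarrow> s / z ^ n + 0"
    using m_pos m_less_1 by (intro tendsto_intros LIMSEQ_realpow_zero) auto
  ultimately show ?thesis by (intro LIMSEQ_le_const[of _ "s / z ^ n"]) auto
qed

text \<open>
  The exponential rate is \<open>\<rho> = A ln n / n\<close>, so that \<open>exp (\<rho> n)\<close> is \<open>n powr A\<close>, and \<open>exp (B \<rho>)\<close> is a
  supersolution for \<open>B = 2 / (1 - m)\<close>: to first order this says \<open>1 + m B \<le> B\<close>, with room to spare.  The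
  remainder is negligible because outdegrees below \<open>\<delta> n\<close> keep the exponential below \<open>n powr (\<kappa> / 2)\<close>, while the
  prefactor is of order \<open>(ln n / n) powr \<kappa>\<close>.
\<close>

lemma no_big_polynomial_bound:
  assumes A: "A > 0"
  shows "\<exists>\<delta>>0. \<forall>\<^sub>F n in sequentially. prob (count n \<inter> no_big (nat \<lceil>\<delta> * real n\<rceil>)) \<le> 2 * real n powr (- A)"
proof -
  define B where "B = 2 / (1 - m)"
  have B: "B > 0" "1 + (1 + m) / 2 * B = B" using m_less_1 by (auto simp: B_def field_simps)
  \<comment> \<open>This choice makes \<open>\<theta> n * (\<delta> * n)\<close> equal to \<open>\<kappa> / 2 * ln n\<close>.\<close>
  define \<delta> where "\<delta> = \<kappa> / (2 * B * A)"
  have \<delta>: "\<delta> > 0" using A B \<kappa> by (simp add: \<delta>_def)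
  define \<theta> where "\<theta> = (\<lambda>n. B * A * (ln (real n) / real n))"
  have lim\<theta>: "\<theta> \<longlonglongrightarrow> B * A * 0" unfolding \<theta>_def by (intro tendsto_intros)
  have ev1: "\<forall>\<^sub>F n in sequentially. \<theta> n < ln 2"
    using lim\<theta> by (intro order_tendstoD) auto
  have nn: "0 \<le> B * A * (ln (real n) / real n powr (1/2))" for n
    using A B by (cases "n = 0") auto
  have "(\<lambda>n. moment_const * (B * A * (ln (real n) / real n powr (1/2))) powr \<kappa>) \<longlonglongrightarrow> moment_const * (B * A * 0) powr \<kappa>"
    using \<kappa> nn by (intro tendsto_mult tendsto_const tendsto_powr' lim_ln_over_power always_eventually disjI2 conjI allI) auto
  hence ev2: "\<forall>\<^sub>F n in sequentially. moment_const * (B * A * (ln (real n) / real n powr (1/2))) powr \<kappa> < (1 - m) / 2"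
    using m_less_1 \<kappa> by (intro order_tendstoD) auto
  have "\<forall>\<^sub>F n in sequentially. prob (count n \<inter> no_big (nat \<lceil>\<delta> * real n\<rceil>)) \<le> 2 * real n powr (- A)"
    using ev1 ev2 eventually_ge_at_top[of 1]
  proof eventually_elim
    case (elim n)
    define M where "M = nat \<lceil>\<delta> * real n\<rceil>"
    have n: "real n > 0" "ln (real n) \<ge> 0" using elim by auto
    have t0: "\<theta> n \<ge> 0" using n B A by (simp add: \<theta>_def)
    define \<rho> where "\<rho> = A * ln (real n) / real n"
    have th: "\<theta> n = B * \<rho>" by (simp add: \<theta>_def \<rho>_def)
    have l0: "\<rho> \<ge> 0" using A n by (simp add: \<rho>_def)
    \<comment> \<open>the second-order remainder fits into half of the gap \<open>1 - m\<close>\<close>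
    have key: "\<theta> n powr \<kappa> * real n powr (\<kappa> / 2) * moment_const \<le> (1 - m) / 2"
    proof -
      have "B * A * (ln (real n) / real n powr (1/2)) = \<theta> n * real n powr (1/2)"
        using n by (simp add: \<theta>_def field_simps powr_half_sqrt)
      hence "(B * A * (ln (real n) / real n powr (1/2))) powr \<kappa> = \<theta> n powr \<kappa> * real n powr (\<kappa> / 2)"
        using t0 by (simp add: powr_mult powr_powr)
      thus ?thesis using elim by (simp add: mult_ac)
    qed
    have ek: "exp (\<theta> n * real k) \<le> 1 + \<theta> n * real k + \<theta> n powr (1 + \<kappa>) * real k powr (1 + \<kappa>) * real n powr (\<kappa> / 2)"
      if "k < M" for k
    proof -
      have "real k < \<delta> * real n" using that unfolding M_def by linarith
      hence "\<theta> n * real k \<le> \<theta> n * (\<delta> * real n)" using t0 by (intro mult_left_mono) auto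
      also have "\<dots> = \<kappa> / 2 * ln (real n)" using A B n by (simp add: \<theta>_def \<delta>_def)
      finally have "exp (\<theta> n * real k) \<le> exp (\<kappa> / 2 * ln (real n))" by simp
      also have "\<dots> = real n powr (\<kappa> / 2)" using n by (simp add: powr_def)
      finally have e: "exp (\<theta> n * real k) \<le> real n powr (\<kappa> / 2)" .
      have "exp (\<theta> n * real k) \<le> 1 + \<theta> n * real k + (\<theta> n * real k) powr (1 + \<kappa>) * exp (\<theta> n * real k)"
        using t0 \<kappa> by (intro exp_le_powr_remainder) auto
      also have "\<dots> \<le> 1 + \<theta> n * real k + (\<theta> n * real k) powr (1 + \<kappa>) * real n powr (\<kappa> / 2)"
        using e by (intro add_left_mono mult_left_mono) auto
      also have "(\<theta> n * real k) powr (1 + \<kappa>) = \<theta> n powr (1 + \<kappa>) * real k powr (1 + \<kappa>)"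
        using t0 by (simp add: powr_mult)
      finally show ?thesis .
    qed
    have "(\<Sum>k<M. pmf \<xi> k * exp (\<theta> n * real k)) \<le> 
       (\<Sum>k<M. pmf \<xi> k * (1 + \<theta> n * real k + \<theta> n powr (1 + \<kappa>) * real k powr (1 + \<kappa>) * real n powr (\<kappa> / 2)))"
      by (intro sum_mono mult_left_mono ek) auto
    also have "\<dots> = (\<Sum>k<M. pmf \<xi> k) + \<theta> n * (\<Sum>k<M. pmf \<xi> k * real k) 
       + \<theta> n powr (1 + \<kappa>) * real n powr (\<kappa> / 2) * (\<Sum>k<M. pmf \<xi> k * real k powr (1 + \<kappa>))"
      by (simp add: algebra_simps sum.distrib sum_distrib_left)
    also have "\<dots> \<le> 1 + \<theta> n * m + \<theta> n powr (1 + \<kappa>) * real n powr (\<kappa> / 2) * moment_const"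
    proof (intro add_mono mult_left_mono t0)
      show "(\<Sum>k<M. pmf \<xi> k) \<le> 1" "(\<Sum>k<M. pmf \<xi> k * real k) \<le> m" "(\<Sum>k<M. pmf \<xi> k * real k powr (1 + \<kappa>)) \<le> moment_const"
        by (intro partial_sum_le_sums pmf_sums_1 mean moment_sums; simp)+
    qed auto
    also have "\<theta> n powr (1 + \<kappa>) = \<theta> n * \<theta> n powr \<kappa>"
      using t0 by (cases "\<theta> n = 0") (auto simp: powr_add)
    also have "1 + \<theta> n * m + \<theta> n * \<theta> n powr \<kappa> * real n powr (\<kappa> / 2) * moment_const
       = 1 + \<theta> n * (m + \<theta> n powr \<kappa> * real n powr (\<kappa> / 2) * moment_const)" by (simp add: algebra_simps)
    also have "\<dots> \<le> 1 + \<theta> n * (m + (1 - m) / 2)"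
      using key t0 by (intro add_left_mono mult_left_mono) auto
    also have "\<dots> = 1 + (1 + m) / 2 * \<theta> n" by (simp add: field_simps)
    also have "\<dots> \<le> exp ((1 + m) / 2 * \<theta> n)" by (rule exp_ge_add_one_self)
    finally have sm: "(\<Sum>k<M. pmf \<xi> k * exp (\<theta> n * real k)) \<le> exp ((1 + m) / 2 * \<theta> n)" .
    have "prob (count n \<inter> no_big M) \<le> exp (\<theta> n) / exp \<rho> ^ n"
    proof (rule prob_no_big_le)
      show "1 \<le> exp \<rho>" using l0 by simp
      have "(\<Sum>k<M. pmf \<xi> k * (exp \<rho> * exp (\<theta> n) ^ k)) = exp \<rho> * (\<Sum>k<M. pmf \<xi> k * exp (\<theta> n * real k))"
        unfolding sum_distrib_left by (intro sum.cong) (auto simp: exp_of_nat_mult[symmetric] mult_ac)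
      also have "\<dots> \<le> exp \<rho> * exp ((1 + m) / 2 * \<theta> n)" using sm by (intro mult_left_mono) auto
      also have "\<dots> = exp (\<rho> + (1 + m) / 2 * \<theta> n)" by (simp add: exp_add)
      also have "\<rho> + (1 + m) / 2 * \<theta> n = \<rho> * (1 + (1 + m) / 2 * B)" by (simp add: th algebra_simps)
      also have "\<dots> = \<theta> n" unfolding B(2) th by simp
      finally show "(\<Sum>k<M. pmf \<xi> k * (exp \<rho> * exp (\<theta> n) ^ k)) \<le> exp (\<theta> n)" .
    qed auto
    also have "exp \<rho> ^ n = real n powr A"
      using n by (simp add: exp_of_nat_mult[symmetric] \<rho>_def powr_def)
    also have "exp (\<theta> n) \<le> 2" using elim by (metis exp_ln exp_le_cancel_iff less_imp_le zero_less_numeral)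
    finally show "prob (count n \<inter> no_big (nat \<lceil>\<delta> * real n\<rceil>)) \<le> 2 * real n powr (- A)"
      using n by (simp add: M_def powr_minus divide_right_mono field_simps)
  qed
  thus ?thesis using \<delta> by blast
qed

section \<open>Big vertices\<close>

text \<open>
  Outdegrees from \<open>\<delta> n\<close> on count as big: there the probabilities are controlled by the one at \<open>n\<close>, and
  trees with count \<open>n\<close> but without such vertices are negligible.
\<close>

definition big_threshold :: "real \<Rightarrow> real \<Rightarrow> nat \<Rightarrow> bool" where
  "big_threshold \<delta> C n \<longleftrightarrow>
     pmf \<xi> n > 0 \<and> nat \<lceil>\<delta> * real n\<rceil> \<ge> 1 \<and>
      (\<forall>k\<ge>nat \<lceil>\<delta> * real n\<rceil>. pmf \<xi> k \<le> C * pmf \<xi> n \<and> real k * pmf \<xi> k \<le> C * (real n * pmf \<xi> n)) \<and>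
      prob (count n \<inter> no_big (nat \<lceil>\<delta> * real n\<rceil>)) \<le> pmf \<xi> n / real n"

lemma big_threshold_exists:
  "\<exists>\<delta> C. \<delta> > 0 \<and> C > 0 \<and> (\<forall>\<^sub>F n in sequentially. big_threshold \<delta> C n)"
proof -
  obtain A0 where A0: "A0 > 0" "\<forall>\<^sub>F n in sequentially. pmf \<xi> n \<ge> real n powr (- A0)"
    using poly_lower by blast
  obtain \<delta> where \<delta>: "\<delta> > 0" "\<forall>\<^sub>F n in sequentially. prob (count n \<inter> no_big (nat \<lceil>\<delta> * real n\<rceil>)) \<le> 2 * real n powr (- (A0 + 2))"
    using no_big_polynomial_bound[of "A0 + 2"] A0 by auto
  obtain k0 where "\<forall>\<delta>>0. \<exists>C>0. \<forall>n\<ge>k0. \<forall>k\<ge>k0. \<delta> * real n \<le> real k \<longrightarrow>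
           real k * pmf \<xi> k \<le> C * (real n * pmf \<xi> n)" using compare by blast
  then obtain C where C: "C > 0" "\<And>n k. n \<ge> k0 \<Longrightarrow> k \<ge> k0 \<Longrightarrow> \<delta> * real n \<le> real k \<Longrightarrow>
           real k * pmf \<xi> k \<le> C * (real n * pmf \<xi> n)" using \<delta> by metis
  have lim: "filterlim (\<lambda>n. \<delta> * real n) at_top sequentially"
    by (rule filterlim_tendsto_pos_mult_at_top[OF tendsto_const \<delta>(1) filterlim_real_sequentially])
  have "\<forall>\<^sub>F n in sequentially. \<delta> * real n \<ge> real (max 1 k0)" using lim by (simp add: filterlim_at_top)
  hence "\<forall>\<^sub>F n in sequentially. big_threshold \<delta> (max C (C / \<delta>)) n"
    using A0(2) \<delta>(2) eventually_ge_at_top[of k0] eventually_ge_at_top[of 2]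
  proof eventually_elim
    case (elim n)
    have n: "real n > 0" using elim by simp
    have pn: "pmf \<xi> n > 0" using elim(2) n by (smt (verit) powr_gt_zero)
    have nat: "nat \<lceil>\<delta> * real n\<rceil> \<ge> max 1 k0" using elim(1) by linarith
    have k: "pmf \<xi> k \<le> max C (C / \<delta>) * pmf \<xi> n \<and> real k * pmf \<xi> k \<le> max C (C / \<delta>) * (real n * pmf \<xi> n)"
      if "k \<ge> nat \<lceil>\<delta> * real n\<rceil>" for k
    proof -
      have dk: "\<delta> * real n \<le> real k" using that by linarith
      have kk: "k \<ge> k0" "k \<ge> 1" using order.trans[OF nat that] by auto
      have 1: "real k * pmf \<xi> k \<le> C * (real n * pmf \<xi> n)" using C(2)[of n k] dk kk elim by auto
      also have "\<dots> \<le> max C (C / \<delta>) * (real n * pmf \<xi> n)" by (intro mult_right_mono) auto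
      finally have 2: "real k * pmf \<xi> k \<le> max C (C / \<delta>) * (real n * pmf \<xi> n)" .
      have "\<delta> * real n * pmf \<xi> k \<le> real k * pmf \<xi> k" using dk by (intro mult_right_mono) auto
      also note 1
      finally have "\<delta> * pmf \<xi> k \<le> C * pmf \<xi> n" using n by (simp add: mult_ac)
      hence "pmf \<xi> k \<le> C / \<delta> * pmf \<xi> n" using \<delta> by (simp add: field_simps)
      also have "\<dots> \<le> max C (C / \<delta>) * pmf \<xi> n" by (intro mult_right_mono) auto
      finally show ?thesis using 2 by simp
    qed
    have "2 * real n powr (- (A0 + 2)) = real n powr (- A0) * (2 / real n / real n)"
      using n by (simp add: powr_diff powr_minus field_simps powr_add power2_eq_square)
    also have "\<dots> \<le> pmf \<xi> n * (1 / real n)"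
      using elim n by (intro mult_mono divide_right_mono) (auto simp: field_simps)
    finally have "prob (count n \<inter> no_big (nat \<lceil>\<delta> * real n\<rceil>)) \<le> pmf \<xi> n / real n" using elim(3) by simp
    thus ?case using pn nat k by (auto simp: big_threshold_def)
  qed
  thus ?thesis using C \<delta> by (intro exI[of _ \<delta>] exI[of _ "max C (C / \<delta>)"]) auto
qed

lemma F_le_Un:
  assumes "E \<subseteq> A \<union> B" "A \<in> events" "B \<in> events"
  shows "fps_nth (F E) l \<le> fps_nth (F A) l + fps_nth (F B) l"
proof -
  have "fps_nth (F E) l \<le> prob ((count l \<inter> A) \<union> (count l \<inter> B))"
    unfolding F_nth using assms by (intro finite_measure_mono sets.Un sets.Int sets_count_event) auto
  also have "\<dots> \<le> prob (count l \<inter> A) + prob (count l \<inter> B)"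
    using assms by (intro measure_Un_le sets.Int sets_count_event)
  finally show ?thesis by (simp add: F_nth)
qed

lemma coeff_le_F_mono:
  assumes "E \<subseteq> A" "A \<in> events" "coeff_le (F A) b"
  shows "coeff_le (F E) b"
  using F_mono[OF assms(1,2)] coeff_leD(2)[OF assms(3)] F_nonneg unfolding coeff_le_def by (meson order_trans)

lemma big_at_Suc_eq: "big_at M (Suc j) = {c. \<exists>i<c []. branch c i \<in> big_at M j}"
  by (auto simp: big_at_Suc)

text \<open>
  Descending from the root to a vertex at height \<open>j\<close> costs a factor \<open>m\<close> per step.
\<close>

lemma big_at_bound:
  assumes D: "\<And>k. k \<ge> M \<Longrightarrow> pmf \<xi> k \<le> D"
  shows "coeff_le (F (big_at M j)) (m ^ j * (2 * D * renewal_const))"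
proof (induction j)
  case 0
  have "big_at M 0 = {c. M \<le> c [] \<and> (\<forall>i<c []. branch c i \<in> UNIV)}" by (auto simp: big_at_0)
  thus ?case using big_root_all[of UNIV M D] D prob_space by simp
next
  case (Suc j)
  show ?case using first_moment_step[OF sets_big_at Suc] unfolding big_at_Suc_eq by (simp add: mult_ac)
qed

text \<open>
  If the tree does not reach height \<open>h\<close>, neither does any branch on the way to the big vertex, nor any of the at
  least \<open>M\<close> branches of the big vertex.
\<close>

lemma big_at_low_bound:
  assumes D: "\<And>k. k \<ge> M \<Longrightarrow> pmf \<xi> k \<le> D"
  shows "coeff_le (F (big_at M j \<inter> - reach h)) (m ^ j * (2 * D * renewal_const * (1 - prob (reach h)) ^ M))"
proof (induction j)
  case 0
  have "reach (Suc h) \<subseteq> reach h" by (rule reach_antimono) simp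
  hence "big_at M 0 \<inter> - reach h \<subseteq> {c. M \<le> c [] \<and> (\<forall>i<c []. branch c i \<in> - reach h)}"
    by (auto simp: big_at_0 reach_Suc subset_iff)
  moreover have "{c. M \<le> c [] \<and> (\<forall>i<c []. branch c i \<in> - reach h)} \<in> events"
    by (intro sets_all_branches compl_events sets_reach)
  moreover have "coeff_le (F {c. M \<le> c [] \<and> (\<forall>i<c []. branch c i \<in> - reach h)}) (2 * D * (renewal_const * prob (- reach h) ^ M))"
    by (intro big_root_all compl_events sets_reach D)
  ultimately show ?case using coeff_le_F_mono by (simp add: prob_Compl sets_reach mult.assoc)
next
  case (Suc j)
  have r: "reach (Suc h) \<subseteq> reach h" by (rule reach_antimono) simp
  have ev: "big_at M j \<inter> - reach h \<in> events" by (intro sets.Int sets_big_at compl_events sets_reach)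
  have "big_at M (Suc j) \<inter> - reach h \<subseteq> {c. \<exists>i<c []. branch c i \<in> big_at M j \<inter> - reach h}"
    using r by (auto simp: big_at_Suc reach_Suc subset_iff)
  from coeff_le_F_mono[OF this sets_exists_branch[OF ev] first_moment_step[OF ev Suc]]
  show ?case by (simp add: mult_ac)
qed

text \<open>
  At each step towards the big vertex, a vertex at the given height is reached either in the branch
  that contains the big vertex or in another one.  The second case contributes the summands with exponent \<open>\<kappa>\<close> through
  \<open>pair_step\<close>; following the first case down to the big vertex leaves \<open>big_root_exists\<close>.
\<close>

lemma big_at_high_bound:
  assumes M: "M \<ge> 1" and D: "\<And>k. k \<ge> M \<Longrightarrow> pmf \<xi> k \<le> D" and D': "\<And>k. k \<ge> M \<Longrightarrow> real k * pmf \<xi> k \<le> D'"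
  shows "coeff_le (F (big_at M j \<inter> reach (Suc g + j)))
     (m ^ j * (2 * D' * renewal_const * m ^ g + real j * (moment_const * (2 * D * renewal_const) * (m ^ g) powr \<kappa> / m)))"
proof (induction j)
  case 0
  have sub: "big_at M 0 \<inter> reach (Suc g) \<subseteq> {c. M \<le> c [] \<and> (\<exists>i<c []. branch c i \<in> reach g)}"
    by (auto simp: big_at_0 reach_Suc)
  have "{c. M \<le> c []} \<inter> {c. \<exists>i<c []. branch c i \<in> reach g} \<in> events"
    by (intro sets.Int sets_gw_space_coordinate sets_exists_branch sets_reach)
  hence ev: "{c. M \<le> c [] \<and> (\<exists>i<c []. branch c i \<in> reach g)} \<in> events" by (simp add: Collect_conj_eq)
  have D0: "D' \<ge> 0" using D'[of M] mult_nonneg_nonneg[OF _ pmf_nonneg[of \<xi> M], of "real M"] by linarith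
  have "coeff_le (F (big_at M 0 \<inter> reach (Suc g))) (2 * D' * (renewal_const * prob (reach g)))"
    by (rule coeff_le_F_mono[OF sub ev big_root_exists]) (use M D' sets_reach in auto)
  moreover have "2 * D' * (renewal_const * prob (reach g)) \<le> 2 * D' * renewal_const * m ^ g"
    using D0 renewal_const_pos by (simp add: mult.assoc mult_left_mono prob_reach_le)
  ultimately show ?case unfolding coeff_le_def by (auto intro: order_trans)
next
  case (Suc j)
  define R where "R = reach (Suc g + j)"
  have Rev: "R \<in> events" by (simp add: R_def sets_reach)
  define b where "b = m ^ j * (2 * D * renewal_const)"
  define u where "u = m ^ j * (2 * D' * renewal_const * m ^ g + real j * (moment_const * (2 * D * renewal_const) * (m ^ g) powr \<kappa> / m))"
  let ?A = "{c. \<exists>i<c []. branch c i \<in> big_at M j \<inter> R}"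
  let ?B = "{c. \<exists>i<c []. \<exists>j'<c []. i \<noteq> j' \<and> branch c i \<in> big_at M j \<and> branch c j' \<in> R}"
  have Aev: "?A \<in> events" by (intro sets_exists_branch sets.Int sets_big_at Rev)
  have Bev: "?B \<in> events" by (intro sets_exists_two_branches sets_big_at Rev)
  have sub: "big_at M (Suc j) \<inter> reach (Suc g + Suc j) \<subseteq> ?A \<union> ?B"
  proof
    fix c assume "c \<in> big_at M (Suc j) \<inter> reach (Suc g + Suc j)"
    hence "c \<in> big_at M (Suc j)" "c \<in> reach (Suc (Suc g + j))" by auto
    then obtain i i' where "i < c []" "branch c i \<in> big_at M j" "i' < c []" "branch c i' \<in> R"
      by (auto simp: big_at_Suc reach_Suc R_def)
    thus "c \<in> ?A \<union> ?B" by (cases "i = i'") auto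
  qed
  have a: "coeff_le (F ?A) (m * u)"
    unfolding u_def by (intro first_moment_step sets.Int sets_big_at Rev) (use Suc in \<open>simp add: R_def\<close>)
  have bb: "coeff_le (F (big_at M j)) b" unfolding b_def by (rule big_at_bound[OF D])
  have b0: "b \<ge> 0" by (rule coeff_le_nonneg[OF bb])
  have B: "coeff_le (F ?B) (moment_const * (b * prob R powr \<kappa>))"
    by (rule pair_step[OF sets_big_at Rev bb])
  have "prob R \<le> m ^ (Suc g + j)" unfolding R_def by (rule prob_reach_le)
  also have "\<dots> \<le> m ^ g" using m_pos m_less_1 by (intro power_decreasing) auto
  finally have "prob R powr \<kappa> \<le> (m ^ g) powr \<kappa>" using \<kappa> by (intro powr_mono2) auto
  hence pr: "moment_const * (b * prob R powr \<kappa>) \<le> moment_const * (b * (m ^ g) powr \<kappa>)"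
    using b0 moment_const_nonneg by (intro mult_left_mono) auto
  have "fps_nth (F (big_at M (Suc j) \<inter> reach (Suc g + Suc j))) l \<le> m * u + moment_const * (b * (m ^ g) powr \<kappa>)" for l
    using F_le_Un[OF sub Aev Bev, of l] coeff_leD(2)[OF a, of l] coeff_leD(2)[OF B, of l] pr by linarith
  also have "m * u + moment_const * (b * (m ^ g) powr \<kappa>) = m ^ Suc j * (2 * D' * renewal_const * m ^ g + real (Suc j) * (moment_const * (2 * D * renewal_const) * (m ^ g) powr \<kappa> / m))"
    unfolding u_def b_def using m_pos by (simp add: field_simps)
  finally show ?case using F_nonneg by (auto simp: coeff_le_def)
qed

lemma union_over_big:
  assumes R: "R \<in> events" and \<beta>: "\<And>j. fps_nth (F (big_at M j \<inter> R)) n \<le> \<beta> j" "\<beta> sums s"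
  shows "prob (count n \<inter> R) \<le> prob (count n \<inter> no_big M) + s"
proof -
  have ev: "count n \<inter> (big_at M j \<inter> R) \<in> events" for j
    by (intro sets.Int sets_count_event sets_big_at R)
  have "prob (count n \<inter> R) \<le> prob ((count n \<inter> no_big M) \<union> (\<Union>j. count n \<inter> (big_at M j \<inter> R)))"
    using ev by (intro finite_measure_mono sets.Un sets.Int sets_count_event sets_no_big sets.countable_UN) (auto simp: no_big_def)
  also have "\<dots> \<le> prob (count n \<inter> no_big M) + prob (\<Union>j. count n \<inter> (big_at M j \<inter> R))"
    using ev by (intro measure_Un_le sets.Int sets_count_event sets_no_big sets.countable_UN) auto
  also have "prob (\<Union>j. count n \<inter> (big_at M j \<inter> R)) \<le> s"
  proof -
    have le: "prob (count n \<inter> (big_at M j \<inter> R)) \<le> \<beta> j" for j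
      using \<beta>(1)[of j] unfolding F_nth .
    have sm: "summable (\<lambda>j. prob (count n \<inter> (big_at M j \<inter> R)))"
      by (rule summable_comparison_test'[OF sums_summable[OF \<beta>(2)], of 0]) (simp add: le)
    have "prob (\<Union>j. count n \<inter> (big_at M j \<inter> R)) \<le> (\<Sum>j. prob (count n \<inter> (big_at M j \<inter> R)))"
      using ev sm by (intro finite_measure_subadditive_countably) auto
    also have "\<dots> \<le> (\<Sum>j. \<beta> j)" by (intro suminf_le le sm sums_summable[OF \<beta>(2)])
    also have "\<dots> = s" by (rule sums_unique[OF \<beta>(2), symmetric])
    finally show ?thesis .
  qed
  finally show ?thesis by simp
qed

end

section \<open>The probability of the conditioning event\<close>

lemma fps_nth_power_diag_ge:
  fixes Q :: "real fps"
  assumes "\<And>l. fps_nth Q l \<ge> 0"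
  shows "fps_nth (Q ^ k) k \<ge> fps_nth Q 1 ^ k"
proof (induction k)
  case (Suc k)
  have nn: "fps_nth (Q ^ k) l \<ge> 0" for k l
  proof (induction k arbitrary: l)
    case (Suc k)
    thus ?case using assms by (auto simp: fps_mult_nth intro!: sum_nonneg)
  qed (auto simp: fps_one_nth)
  have "fps_nth Q 1 ^ Suc k \<le> fps_nth Q 1 * fps_nth (Q ^ k) (Suc k - 1)"
    using Suc assms by (simp add: mult_left_mono)
  also have "\<dots> \<le> (\<Sum>i=0..Suc k. fps_nth Q i * fps_nth (Q ^ k) (Suc k - i))"
    by (rule member_le_sum) (use assms nn in auto)
  also have "\<dots> = fps_nth (Q ^ Suc k) (Suc k)" by (simp only: power_Suc fps_mult_nth)
  finally show ?case .
qed auto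

context condensation_gw
begin

lemma F_UNIV_le_pmf: "\<exists>C>0. \<forall>\<^sub>F n in sequentially. fps_nth (F UNIV) n \<le> C * pmf \<xi> n"
proof -
  obtain \<delta> C where \<delta>: "\<delta> > 0" "C > 0" "\<forall>\<^sub>F n in sequentially. big_threshold \<delta> C n"
    using big_threshold_exists by blast
  define C' where "C' = 1 + 2 * C * renewal_const / (1 - m)"
  have C': "C' > 0" using \<delta> renewal_const_pos m_less_1 by (auto simp: C'_def intro!: add_pos_nonneg)
  have "\<forall>\<^sub>F n in sequentially. fps_nth (F UNIV) n \<le> C' * pmf \<xi> n"
    using \<delta>(3)[unfolded big_threshold_def] eventually_ge_at_top[of 1]
  proof eventually_elim
    case (elim n)
    define M where "M = nat \<lceil>\<delta> * real n\<rceil>"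
    have "coeff_le (F (big_at M j)) (m ^ j * (2 * (C * pmf \<xi> n) * renewal_const))" for j
      by (rule big_at_bound) (use elim in \<open>auto simp: M_def\<close>)
    hence 1: "fps_nth (F (big_at M j \<inter> UNIV)) n \<le> m ^ j * (2 * (C * pmf \<xi> n) * renewal_const)" for j
      using coeff_leD(2) by simp
    have "(\<lambda>j. m ^ j * (2 * (C * pmf \<xi> n) * renewal_const)) sums (1 / (1 - m) * (2 * (C * pmf \<xi> n) * renewal_const))"
      using m_pos m_less_1 by (intro sums_mult2 geometric_sums) auto
    from union_over_big[OF UNIV_in_events 1 this] 
    have "fps_nth (F UNIV) n \<le> pmf \<xi> n / real n + 1 / (1 - m) * (2 * (C * pmf \<xi> n) * renewal_const)"
      using elim by (simp add: F_nth M_def)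
    also have "pmf \<xi> n / real n \<le> pmf \<xi> n" using elim by (simp add: field_simps mult_le_cancel_left1)
    finally show ?case by (simp add: C'_def algebra_simps)
  qed
  thus ?thesis using C' by blast
qed

text \<open>
  The expected count is finite, because the count inherits the moment of order \<open>1 + \<kappa>\<close> from \<open>\<xi>\<close>
  through the upper bound \<open>F_UNIV_le_pmf\<close>.
\<close>

lemma F_UNIV_tail_summable: "summable (\<lambda>j. 1 - (\<Sum>i\<le>j. fps_nth (F UNIV) i))"
proof -
  define Q where "Q = fps_nth (F UNIV)"
  have Qnn: "Q l \<ge> 0" for l by (simp add: Q_def F_nonneg)
  have Qs: "Q sums 1" unfolding Q_def by (rule F_UNIV_sums_1)
  obtain C where C: "C > 0" "\<forall>\<^sub>F n in sequentially. Q n \<le> C * pmf \<xi> n"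
    using F_UNIV_le_pmf unfolding Q_def by blast
  have sm: "summable (\<lambda>n. Q n * real n powr (1 + \<kappa>))"
  proof (rule summable_comparison_test_ev)
    show "\<forall>\<^sub>F n in sequentially. norm (Q n * real n powr (1 + \<kappa>)) \<le> C * (pmf \<xi> n * real n powr (1 + \<kappa>))"
      using C(2) by eventually_elim (use Qnn in \<open>auto simp: mult_right_mono mult.assoc[symmetric]\<close>)
    show "summable (\<lambda>n. C * (pmf \<xi> n * real n powr (1 + \<kappa>)))" by (intro summable_mult moment)
  qed
  define D where "D = (\<Sum>n. Q n * real n powr (1 + \<kappa>))"
  have bound: "0 \<le> 1 - (\<Sum>i\<le>j. Q i) \<and> 1 - (\<Sum>i\<le>j. Q i) \<le> D * real (Suc j) powr (- (1 + \<kappa>))" for j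
  proof
    have "(\<Sum>i<Suc j. Q i) \<le> 1" by (rule partial_sum_le_sums[OF Qs Qnn])
    thus "0 \<le> 1 - (\<Sum>i\<le>j. Q i)" by (simp add: lessThan_Suc_atMost)
    have sh: "(\<lambda>i. Q (i + Suc j)) sums (1 - (\<Sum>i<Suc j. Q i))"
      using Qs by (rule sums_split_initial_segment)
    have smsh: "summable (\<lambda>i. Q (i + Suc j) * real (i + Suc j) powr (1 + \<kappa>))"
      using summable_ignore_initial_segment[OF sm, of "Suc j"] .
    have "1 - (\<Sum>i<Suc j. Q i) \<le> (\<Sum>i. Q (i + Suc j) * real (i + Suc j) powr (1 + \<kappa>)) * real (Suc j) powr (- (1 + \<kappa>))"
    proof (rule sums_le[OF _ sh sums_mult2[OF summable_sums[OF smsh]]])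
      fix i
      have "real (Suc j) powr (1 + \<kappa>) \<le> real (i + Suc j) powr (1 + \<kappa>)" using \<kappa> by (intro powr_mono2) auto
      hence "1 \<le> real (i + Suc j) powr (1 + \<kappa>) * real (Suc j) powr (- (1 + \<kappa>))"
        unfolding powr_minus by (simp add: field_simps)
      from mult_left_mono[OF this Qnn[of "i + Suc j"]]
      show "Q (i + Suc j) \<le> Q (i + Suc j) * real (i + Suc j) powr (1 + \<kappa>) * real (Suc j) powr (- (1 + \<kappa>))"
        by (simp add: mult.assoc)
    qed
    also have "(\<Sum>i. Q (i + Suc j) * real (i + Suc j) powr (1 + \<kappa>)) \<le> D"
    proof -
      have "D = (\<Sum>i. Q (i + Suc j) * real (i + Suc j) powr (1 + \<kappa>)) + (\<Sum>i<Suc j. Q i * real i powr (1 + \<kappa>))"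
        unfolding D_def by (rule suminf_split_initial_segment[OF sm])
      moreover have "(\<Sum>i<Suc j. Q i * real i powr (1 + \<kappa>)) \<ge> 0" using Qnn by (intro sum_nonneg mult_nonneg_nonneg) auto
      ultimately show ?thesis by linarith
    qed
    finally show "1 - (\<Sum>i\<le>j. Q i) \<le> D * real (Suc j) powr (- (1 + \<kappa>))"
      by (simp add: lessThan_Suc_atMost mult_right_mono)
  qed
  have "summable (\<lambda>j. 1 - (\<Sum>i\<le>j. Q i))"
  proof (rule summable_comparison_test')
    have "summable (\<lambda>j. real (j + 1) powr (- (1 + \<kappa>)))"
      using \<kappa> by (intro summable_ignore_initial_segment) (simp add: summable_real_powr_iff)
    thus "summable (\<lambda>j. D * real (Suc j) powr (- (1 + \<kappa>)))" by (intro summable_mult) simp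
    show "norm (1 - (\<Sum>i\<le>j. Q i)) \<le> D * real (Suc j) powr (- (1 + \<kappa>))" for j
      using bound[of j] by simp
  qed
  thus ?thesis by (simp add: Q_def)
qed

lemma root_fps_eventually_const: "\<exists>e\<le>1. \<forall>\<^sub>F k in sequentially. root_fps k = fps_X ^ e"
proof -
  have ev: "\<forall>\<^sub>F k in sequentially. k \<notin> S" if "finite S" for S :: "nat set"
    using that by (simp add: eventually_sequentially) (metis finite_nat_set_iff_bounded not_less)
  from Om_finite show ?thesis
  proof
    assume "finite \<Omega>"
    from ev[OF this] have "\<forall>\<^sub>F k in sequentially. root_fps k = fps_X ^ 0"
      by eventually_elim (simp add: root_fps_def)
    thus ?thesis by (intro exI[of _ 0]) auto
  next
    assume "finite (- \<Omega>)"
    from ev[OF this] have "\<forall>\<^sub>F k in sequentially. root_fps k = fps_X ^ 1"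
      by eventually_elim (simp add: root_fps_def)
    thus ?thesis by (intro exI[of _ 1]) auto
  qed
qed

lemma pmf_eventually_pos: "\<forall>\<^sub>F n in sequentially. pmf \<xi> n > 0"
proof -
  obtain A0 where "\<forall>\<^sub>F n in sequentially. pmf \<xi> n \<ge> real n powr (- A0)" using poly_lower by blast
  thus ?thesis using eventually_ge_at_top[of 1]
    by eventually_elim (smt (verit) of_nat_0_less_iff powr_gt_zero less_le_trans zero_less_one order_less_le_trans less_numeral_extra(1))
qed

text \<open>
  A root with \<open>k\<close> children, each carrying exactly one \<open>\<Omega>\<close>-vertex, realises every large count.
\<close>

lemma F_UNIV_eventually_pos: "\<forall>\<^sub>F n in sequentially. fps_nth (F UNIV) n > 0"
proof -
  obtain e where e: "e \<le> 1" "\<forall>\<^sub>F k in sequentially. root_fps k = fps_X ^ e"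
    using root_fps_eventually_const by blast
  have "\<forall>\<^sub>F k in sequentially. fps_nth (F UNIV) (k + e) > 0"
    using e(2) pmf_eventually_pos
  proof eventually_elim
    case (elim k)
    have "0 < pmf \<xi> k * fps_nth (F UNIV) 1 ^ k" using F_UNIV_1_pos elim by simp
    also have "\<dots> \<le> pmf \<xi> k * fps_nth (F UNIV ^ k) k"
      by (intro mult_left_mono fps_nth_power_diag_ge F_nonneg) auto
    also have "\<dots> = pmf \<xi> k * fps_nth (root_fps k * F UNIV ^ k) (k + e)"
      unfolding elim(1) by (simp add: fps_X_power_mult_nth)
    also have "\<dots> \<le> fps_nth (F UNIV) (k + e)" by (rule pmf_root_le)
    finally show ?case .
  qed
  thus ?thesis by (subst (asm) eventually_sequentially_seg)
qed

text \<open>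
  Summing over the root's outdegree \<open>k\<close> in a range \<open>k2 \<le> k < b n\<close>, on which \<open>pmf \<xi> k\<close> is at least of
  the order of \<open>pmf \<xi> n\<close>, leaves the renewal function of the count at \<open>n - e\<close>, where \<open>e\<close> is the contribution of
  a root of large outdegree.
\<close>

lemma F_UNIV_ge_pmf: "\<exists>c>0. \<forall>\<^sub>F n in sequentially. fps_nth (F UNIV) n \<ge> c * pmf \<xi> n"
proof -
  define Q where "Q = F UNIV"
  obtain b :: nat and c where bc: "b > 0" "c > 0" 
    "\<forall>\<^sub>F n in sequentially. \<forall>K\<ge>b * n. (\<Sum>k<K. fps_nth (Q ^ k) n) \<ge> c"
    using renewal_lower_bound[of "F UNIV", OF F_nonneg F_UNIV_sums_1 F_UNIV_0_less_1 F_UNIV_tail_summable F_UNIV_eventually_pos]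
    unfolding Q_def by blast
  obtain e where e: "e \<le> 1" "\<forall>\<^sub>F k in sequentially. root_fps k = fps_X ^ e"
    using root_fps_eventually_const by blast
  then obtain k1 where k1: "\<And>k. k \<ge> k1 \<Longrightarrow> root_fps k = fps_X ^ e"
    by (auto simp: eventually_sequentially)
  obtain k0 where k0: "\<forall>\<delta>>0. \<exists>C>0. \<forall>n\<ge>k0. \<forall>k\<ge>k0. \<delta> * real n \<le> real k \<longrightarrow>
           real k * pmf \<xi> k \<le> C * (real n * pmf \<xi> n)" using compare by blast
  have "1 / real b > 0" using bc by simp
  from k0[THEN spec, THEN mp, OF this] obtain C where C0: "C > 0" and
    "\<forall>n\<ge>k0. \<forall>k\<ge>k0. 1 / real b * real n \<le> real k \<longrightarrow> real k * pmf \<xi> k \<le> C * (real n * pmf \<xi> n)"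
    by (elim exE conjE)
  note C = C0 this(2)[rule_format]
  define k2 where "k2 = max (max k0 k1) 1"
  have Qw: "weight_le 1 (Q ^ k) 1" for k unfolding Q_def by (intro weight_le_power1 weight_le_F1) auto
  have Qnn: "fps_nth (Q ^ k) l \<ge> 0" for k l using weight_leD(1)[OF Qw] .
  \<comment> \<open>A bounded number of branches has a count close to \<open>n\<close> only with small probability, so small \<open>k\<close> may be
      dropped from the renewal function.\<close>
  have "(\<lambda>n. \<Sum>k<k2. fps_nth (Q ^ k) n) \<longlonglongrightarrow> (\<Sum>k<k2. 0)"
  proof (intro tendsto_sum)
    fix k
    have "(\<Sum>l<N. fps_nth (Q ^ k) l) \<le> 1" for N
    proof -
      have "(\<Sum>l<N. fps_nth (Q ^ k) l) \<le> (\<Sum>l\<le>N. fps_nth (Q ^ k) l)"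
        using Qnn by (intro sum_mono2) auto
      also have "\<dots> \<le> 1" using weight_leD(2)[OF Qw[of k], of N] by simp
      finally show ?thesis .
    qed
    hence "summable (\<lambda>n. fps_nth (Q ^ k) n)" by (intro summableI_nonneg_bounded[OF Qnn])
    thus "(\<lambda>n. fps_nth (Q ^ k) n) \<longlonglongrightarrow> 0" by (rule summable_LIMSEQ_zero)
  qed
  hence "\<forall>\<^sub>F n in sequentially. (\<Sum>k<k2. fps_nth (Q ^ k) n) < c / 2" using bc by (intro order_tendstoD) auto
  with bc(3) have ev: "\<forall>\<^sub>F n in sequentially. (\<forall>K\<ge>b * n. (\<Sum>k<K. fps_nth (Q ^ k) n) \<ge> c) \<and> (\<Sum>k<k2. fps_nth (Q ^ k) n) < c / 2"
    by eventually_elim auto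
  have "\<forall>\<^sub>F n in sequentially. (\<forall>K\<ge>b * (n - e). (\<Sum>k<K. fps_nth (Q ^ k) (n - e)) \<ge> c) \<and> (\<Sum>k<k2. fps_nth (Q ^ k) (n - e)) < c / 2"
    using ev by (rule eventually_compose_filterlim) (rule filterlim_minus_const_nat_at_top)
  hence "\<forall>\<^sub>F n in sequentially. fps_nth (F UNIV) n \<ge> (c / (2 * C * real b)) * pmf \<xi> n"
    using eventually_ge_at_top[of k2]
  proof eventually_elim
    case (elim n)
    have n: "n \<ge> k0" "n \<ge> 1" "e \<le> n" using elim e by (auto simp: k2_def)
    define K where "K = max k2 (b * n)"
    have "b * (n - e) \<le> K" unfolding K_def by (rule max.coboundedI2) simp
    hence "c \<le> (\<Sum>k<K. fps_nth (Q ^ k) (n - e))" using elim(1) by blast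
    also have "{..<K} = {..<k2} \<union> {k2..<K}" by (auto simp: K_def)
    also have "(\<Sum>k\<in>{..<k2} \<union> {k2..<K}. fps_nth (Q ^ k) (n - e)) = 
       (\<Sum>k<k2. fps_nth (Q ^ k) (n - e)) + (\<Sum>k\<in>{k2..<K}. fps_nth (Q ^ k) (n - e))"
      by (rule sum.union_disjoint) auto
    finally have half: "c / 2 \<le> (\<Sum>k\<in>{k2..<K}. fps_nth (Q ^ k) (n - e))" using elim by simp
    have pk: "pmf \<xi> n / (C * real b) \<le> pmf \<xi> k" if k: "k \<in> {k2..<K}" for k
    proof -
      have kb: "k \<le> b * n" "k \<ge> k0" using k by (auto simp: K_def k2_def)
      have "1 / real b * real k \<le> real n" using kb bc by (simp add: field_simps flip: of_nat_mult)
      hence "real n * pmf \<xi> n \<le> C * (real k * pmf \<xi> k)" using C(2)[of k n] n kb by auto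
      also have "\<dots> \<le> C * (real (b * n) * pmf \<xi> k)" using C kb by (intro mult_left_mono mult_right_mono of_nat_mono) auto
      finally have "real n * pmf \<xi> n \<le> real n * (C * real b * pmf \<xi> k)" by (simp add: mult_ac)
      hence "pmf \<xi> n \<le> C * real b * pmf \<xi> k" using n by simp
      thus ?thesis using C bc by (simp add: field_simps)
    qed
    have "(c / (2 * C * real b)) * pmf \<xi> n = pmf \<xi> n / (C * real b) * (c / 2)" by (simp add: mult_ac)
    also have "\<dots> \<le> pmf \<xi> n / (C * real b) * (\<Sum>k\<in>{k2..<K}. fps_nth (Q ^ k) (n - e))"
      using half C by (intro mult_left_mono) auto
    also have "\<dots> = (\<Sum>k\<in>{k2..<K}. pmf \<xi> n / (C * real b) * fps_nth (Q ^ k) (n - e))" by (rule sum_distrib_left)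
    also have "\<dots> \<le> (\<Sum>k\<in>{k2..<K}. pmf \<xi> k * fps_nth (Q ^ k) (n - e))"
      using Qnn by (intro sum_mono mult_right_mono pk) auto
    also have "\<dots> = (\<Sum>k\<in>{k2..<K}. pmf \<xi> k * fps_nth (root_fps k * Q ^ k) n)"
    proof (intro sum.cong refl)
      fix k assume "k \<in> {k2..<K}"
      hence "root_fps k = fps_X ^ e" by (intro k1) (auto simp: k2_def)
      thus "pmf \<xi> k * fps_nth (Q ^ k) (n - e) = pmf \<xi> k * fps_nth (root_fps k * Q ^ k) n"
        using n by (simp add: fps_X_power_mult_nth)
    qed
    also have "\<dots> \<le> fps_nth (F UNIV) n"
    proof -
      have nn: "0 \<le> pmf \<xi> k * fps_nth (root_fps k * Q ^ k) n" for k
        using weight_leD(1)[OF weight_le_mult[OF weight_le_root_fps1 Qw]] by simp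
      have "(\<Sum>k\<in>{k2..<K}. pmf \<xi> k * fps_nth (root_fps k * Q ^ k) n) \<le> (\<Sum>k<K. pmf \<xi> k * fps_nth (root_fps k * Q ^ k) n)"
        using nn by (intro sum_mono2) auto
      also have "\<dots> \<le> fps_nth (F UNIV) n"
        using F_UNIV_sums[of n] nn unfolding Q_def by (intro partial_sum_le_sums)
      finally show ?thesis .
    qed
    finally show ?case .
  qed
  moreover have "c / (2 * C * real b) > 0" using bc C by simp
  ultimately show ?thesis by blast
qed

section \<open>The height of the conditioned tree\<close>

text \<open>
  At \<open>h = log n / log (1/m) - K\<close> the expected number \<open>\<delta> n c1 m ^ h\<close> of branches of a big vertex that reach height \<open>h\<close> is at
  least \<open>c1 \<delta> exp (a K)\<close>, so that none of them does so only with a probability that vanishes for large \<open>K\<close>.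
\<close>

lemma conditioned_height_low:
  assumes \<epsilon>: "\<epsilon> > 0"
  shows "\<exists>K. \<forall>\<^sub>F n in sequentially. \<forall>h. real h \<le> ln (real n) / ln (1 / m) - K \<longrightarrow>
           prob (count n \<inter> - reach h) \<le> \<epsilon> * prob (count n)"
proof -
  obtain \<delta> C where \<delta>: "\<delta> > 0" "C > 0" "\<forall>\<^sub>F n in sequentially. big_threshold \<delta> C n"
    using big_threshold_exists by blast
  obtain c where c: "c > 0" "\<forall>\<^sub>F n in sequentially. fps_nth (F UNIV) n \<ge> c * pmf \<xi> n"
    using F_UNIV_ge_pmf by blast
  obtain c1 where c1: "c1 > 0" "\<And>h. prob (reach h) \<ge> c1 * m ^ h" using prob_reach_ge by blast
  define B where "B = 2 * C * renewal_const / (1 - m)"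
  have B: "B > 0" using \<delta> renewal_const_pos m_less_1 by (simp add: B_def)
  define a where "a = ln (1 / m)"
  have a: "a > 0" using m_pos m_less_1 by (simp add: a_def)
  have lnm: "ln m = - a" using m_pos by (simp add: a_def ln_div)
  have "((\<lambda>K. B * exp (- (c1 * \<delta> * exp (a * K)))) \<longlongrightarrow> B * 0) at_top"
  proof (intro tendsto_mult tendsto_const filterlim_compose[OF exp_at_bot])
    have "filterlim (\<lambda>K. exp (a * K)) at_top at_top"
      by (intro filterlim_compose[OF exp_at_top] filterlim_tendsto_pos_mult_at_top[OF tendsto_const a filterlim_ident])
    hence "filterlim (\<lambda>K. c1 * \<delta> * exp (a * K)) at_top at_top"
      using c1 \<delta> by (intro filterlim_tendsto_pos_mult_at_top[OF tendsto_const]) auto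
    thus "filterlim (\<lambda>K. - (c1 * \<delta> * exp (a * K))) at_bot at_top" by (simp add: filterlim_uminus_at_top)
  qed
  hence "\<forall>\<^sub>F K in at_top. B * exp (- (c1 * \<delta> * exp (a * K))) < \<epsilon> * c / 2"
    using c \<epsilon> by (intro order_tendstoD) auto
  then obtain K where K: "B * exp (- (c1 * \<delta> * exp (a * K))) < \<epsilon> * c / 2"
    by (auto simp: eventually_at_top_linorder)
  have "(\<lambda>n. 1 / real n) \<longlonglongrightarrow> 0" by (rule lim_1_over_n)
  hence "\<forall>\<^sub>F n in sequentially. 1 / real n < \<epsilon> * c / 2" using c \<epsilon> by (intro order_tendstoD) auto
  hence "\<forall>\<^sub>F n in sequentially. \<forall>h. real h \<le> ln (real n) / ln (1 / m) - K \<longrightarrow>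
           prob (count n \<inter> - reach h) \<le> \<epsilon> * prob (count n)"
    using \<delta>(3)[unfolded big_threshold_def] c(2) eventually_ge_at_top[of 1]
  proof eventually_elim
    case (elim n)
    show ?case
    proof (intro allI impI)
      fix h assume h: "real h \<le> ln (real n) / ln (1 / m) - K"
      define M where "M = nat \<lceil>\<delta> * real n\<rceil>"
      define x where "x = prob (reach h)"
      have x: "0 \<le> x" "x \<le> 1" by (auto simp: x_def)
      have n: "real n > 0" using elim by simp
      have "coeff_le (F (big_at M j \<inter> - reach h)) (m ^ j * (2 * (C * pmf \<xi> n) * renewal_const * (1 - x) ^ M))" for j
        unfolding x_def by (rule big_at_low_bound) (use elim in \<open>auto simp: M_def\<close>)
      note 1 = coeff_leD(2)[OF this]
      have 2: "(\<lambda>j. m ^ j * (2 * (C * pmf \<xi> n) * renewal_const * (1 - x) ^ M)) sums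
         (1 / (1 - m) * (2 * (C * pmf \<xi> n) * renewal_const * (1 - x) ^ M))"
        using m_pos m_less_1 by (intro sums_mult2 geometric_sums) auto
      have "prob (count n \<inter> - reach h) \<le> prob (count n \<inter> no_big M) + 1 / (1 - m) * (2 * (C * pmf \<xi> n) * renewal_const * (1 - x) ^ M)"
        by (rule union_over_big[OF compl_events[OF sets_reach] 1 2])
      also have "1 / (1 - m) * (2 * (C * pmf \<xi> n) * renewal_const * (1 - x) ^ M) = pmf \<xi> n * (B * (1 - x) ^ M)"
        by (simp add: B_def)
      also have "(1 - x) ^ M \<le> exp (- (c1 * \<delta> * exp (a * K)))"
      proof -
        have "(1 - x) ^ M \<le> exp (- x) ^ M" using x exp_ge_add_one_self[of "- x"] by (intro power_mono) auto
        also have "\<dots> = exp (- (x * real M))" by (simp add: exp_of_nat_mult[symmetric] mult.commute)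
        also have "\<dots> \<le> exp (- (c1 * \<delta> * exp (a * K)))"
        proof -
          have "a * real h \<le> ln (real n) - a * K" using h a by (simp add: a_def[symmetric] field_simps)
          hence "exp (a * K) \<le> exp (ln (real n) + real h * ln m)" by (simp add: lnm algebra_simps)
          also have "\<dots> = real n * m ^ h" using n m_pos by (simp add: exp_add exp_of_nat_mult)
          finally have "c1 * \<delta> * exp (a * K) \<le> c1 * \<delta> * (real n * m ^ h)" using c1 \<delta> by (intro mult_left_mono) auto
          also have "\<dots> = (c1 * m ^ h) * (\<delta> * real n)" by simp
          also have "\<dots> \<le> x * real M"
          proof (rule mult_mono)
            show "c1 * m ^ h \<le> x" unfolding x_def by (rule c1(2))
            show "\<delta> * real n \<le> real M" unfolding M_def by linarith
          qed (use x \<delta> in auto)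
          finally show ?thesis by simp
        qed
        finally show ?thesis .
      qed
      also have "B * exp (- (c1 * \<delta> * exp (a * K))) \<le> \<epsilon> * c / 2" using K by simp
      also have "prob (count n \<inter> no_big M) \<le> pmf \<xi> n * (1 / real n)" using elim by (simp add: M_def)
      also have "1 / real n \<le> \<epsilon> * c / 2" using elim by simp
      finally have "prob (count n \<inter> - reach h) \<le> pmf \<xi> n * (\<epsilon> * c / 2) + pmf \<xi> n * (\<epsilon> * c / 2)"
        using B by (simp add: mult_left_mono)
      also have "\<dots> = \<epsilon> * (c * pmf \<xi> n)" by simp
      also have "\<dots> \<le> \<epsilon> * prob (count n)" using elim \<epsilon> by (intro mult_left_mono) (auto simp: F_nth)
      finally show "prob (count n \<inter> - reach h) \<le> \<epsilon> * prob (count n)" .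
    qed
  qed
  thus ?thesis by blast
qed

text \<open>
  Big vertices at height \<open>J\<close> or more are unlikely once \<open>J\<close> is large.  For the finitely many smaller heights,
  \<open>big_at_high_bound\<close> is applied with \<open>g = h - J - 1\<close>; then \<open>n m ^ g\<close> is at most \<open>\<mu> K\<close>, which tends to 0 as \<open>K\<close> grows.
  Hence \<open>J\<close> is chosen before \<open>K\<close>.
\<close>

lemma conditioned_height_high:
  assumes \<epsilon>: "\<epsilon> > 0"
  shows "\<exists>K. \<forall>\<^sub>F n in sequentially. \<forall>h. real h \<ge> ln (real n) / ln (1 / m) + K \<longrightarrow>
           prob (count n \<inter> reach h) \<le> \<epsilon> * prob (count n)"
proof -
  obtain \<delta> C where \<delta>: "\<delta> > 0" "C > 0" "\<forall>\<^sub>F n in sequentially. big_threshold \<delta> C n"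
    using big_threshold_exists by blast
  obtain c where c: "c > 0" "\<forall>\<^sub>F n in sequentially. fps_nth (F UNIV) n \<ge> c * pmf \<xi> n"
    using F_UNIV_ge_pmf by blast
  define B where "B = 2 * C * renewal_const"
  have B: "B > 0" using \<delta> renewal_const_pos by (simp add: B_def)
  define a where "a = ln (1 / m)"
  have a: "a > 0" using m_pos m_less_1 by (simp add: a_def)
  have lnm: "ln m = - a" using m_pos by (simp add: a_def ln_div)
  have "(\<lambda>J. m ^ J * B / (1 - m)) \<longlonglongrightarrow> 0 * B / (1 - m)"
    using m_pos m_less_1 by (intro tendsto_intros LIMSEQ_realpow_zero) auto
  hence "\<forall>\<^sub>F J in sequentially. m ^ J * B / (1 - m) < \<epsilon> * c / 3"
    using c \<epsilon> by (intro order_tendstoD) auto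
  then obtain J where J: "m ^ J * B / (1 - m) < \<epsilon> * c / 3" by (auto simp: eventually_sequentially)
  define \<mu> where "\<mu> = (\<lambda>K. exp (- a * (K - real J - 1)))"
  define \<phi> where "\<phi> = (\<lambda>K. real J * (B * \<mu> K + real J * (moment_const * B * (\<mu> K) powr \<kappa> / m)))"
  have "((\<lambda>K. \<mu> K) \<longlongrightarrow> 0) at_top"
    unfolding \<mu>_def
  proof (rule filterlim_compose[OF exp_at_bot])
    have "filterlim (\<lambda>K. a * (- (real J + 1) + K)) at_top at_top"
      by (intro filterlim_tendsto_pos_mult_at_top[OF tendsto_const a] filterlim_tendsto_add_at_top[OF tendsto_const] filterlim_ident)
    hence "filterlim (\<lambda>K. - (a * (- (real J + 1) + K))) at_bot at_top" by (simp add: filterlim_uminus_at_top)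
    thus "filterlim (\<lambda>K. - a * (K - real J - 1)) at_bot at_top" by (simp add: algebra_simps)
  qed
  hence "(\<phi> \<longlongrightarrow> real J * (B * 0 + real J * (moment_const * B * 0 powr \<kappa> / m))) at_top"
    unfolding \<phi>_def using \<kappa> m_pos
    by (intro tendsto_mult tendsto_add tendsto_const tendsto_divide tendsto_powr') (auto simp: \<mu>_def)
  hence "\<forall>\<^sub>F K in at_top. \<phi> K < \<epsilon> * c / 3" using c \<epsilon> by (intro order_tendstoD) auto
  then obtain K0 where K0: "\<And>K. K \<ge> K0 \<Longrightarrow> \<phi> K < \<epsilon> * c / 3" by (auto simp: eventually_at_top_linorder)
  define K where "K = max K0 (real J + 1)"
  have K: "\<phi> K < \<epsilon> * c / 3" "K \<ge> real J + 1" using K0[of K] by (auto simp: K_def)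
  have "(\<lambda>n. 1 / real n) \<longlonglongrightarrow> 0" by (rule lim_1_over_n)
  hence "\<forall>\<^sub>F n in sequentially. 1 / real n < \<epsilon> * c / 3" using c \<epsilon> by (intro order_tendstoD) auto
  hence "\<forall>\<^sub>F n in sequentially. \<forall>h. real h \<ge> ln (real n) / ln (1 / m) + K \<longrightarrow>
           prob (count n \<inter> reach h) \<le> \<epsilon> * prob (count n)"
    using \<delta>(3)[unfolded big_threshold_def] c(2) eventually_ge_at_top[of 1]
  proof eventually_elim
    case (elim n)
    show ?case
    proof (intro allI impI)
      fix h assume h: "real h \<ge> ln (real n) / ln (1 / m) + K"
      define M where "M = nat \<lceil>\<delta> * real n\<rceil>"
      have n: "real n > 0" "real n \<ge> 1" using elim by simp_all
      have "ln (real n) / ln (1 / m) \<ge> 0" using a n by (simp add: a_def)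
      hence "real h \<ge> real (J + 1)" using h K by simp
      hence hJ: "h \<ge> J + 1" by linarith
      define g where "g = h - J - 1"
      have hg: "h = Suc g + J" using hJ by (simp add: g_def)
      have ng: "real n * m ^ g \<le> \<mu> K"
      proof -
        have "real g = real h - real J - 1" using hg by simp
        hence "real g \<ge> ln (real n) / a + (K - real J - 1)" using h by (simp add: a_def)
        hence "a * real g \<ge> a * (ln (real n) / a + (K - real J - 1))" using a by (intro mult_left_mono) auto
        also have "a * (ln (real n) / a + (K - real J - 1)) = ln (real n) + a * (K - real J - 1)"
          using a by (simp add: distrib_left)
        finally have "ln (real n) + real g * ln m \<le> - a * (K - real J - 1)" by (simp add: lnm algebra_simps)
        hence "exp (ln (real n) + real g * ln m) \<le> \<mu> K" by (simp add: \<mu>_def)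
        thus ?thesis using n m_pos by (simp add: exp_add exp_of_nat_mult)
      qed
      have g1: "m ^ g \<le> \<mu> K"
      proof -
        have "1 * m ^ g \<le> real n * m ^ g" using n m_pos by (intro mult_right_mono) auto
        thus ?thesis using ng by simp
      qed
      define u where "u = pmf \<xi> n * (B * \<mu> K + real J * (moment_const * B * (\<mu> K) powr \<kappa> / m))"
      have u0: "u \<ge> 0" unfolding u_def using B moment_const_nonneg m_pos by (auto simp: \<mu>_def)
      have pk: "pmf \<xi> k \<le> C * pmf \<xi> n" "real k * pmf \<xi> k \<le> C * (real n * pmf \<xi> n)" if "k \<ge> M" for k
        using elim that by (auto simp: M_def)
      have small_j: "fps_nth (F (big_at M j \<inter> reach h)) n \<le> u" if j: "j < J" for j
      proof -
        have "fps_nth (F (big_at M j \<inter> reach h)) n \<le> fps_nth (F (big_at M j \<inter> reach (Suc g + j))) n"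
          using reach_antimono[of "Suc g + j" h] j by (intro F_mono) (auto simp: hg intro!: sets.Int sets_big_at sets_reach)
        also have "\<dots> \<le> m ^ j * (2 * (C * (real n * pmf \<xi> n)) * renewal_const * m ^ g + 
           real j * (moment_const * (2 * (C * pmf \<xi> n) * renewal_const) * (m ^ g) powr \<kappa> / m))"
          by (rule coeff_leD(2)[OF big_at_high_bound]) (use elim pk in \<open>auto simp: M_def\<close>)
        also have "\<dots> = m ^ j * (pmf \<xi> n * (B * (real n * m ^ g) + real j * (moment_const * B * (m ^ g) powr \<kappa> / m)))"
          by (simp add: B_def algebra_simps)
        also have "\<dots> \<le> 1 * (pmf \<xi> n * (B * \<mu> K + real J * (moment_const * B * (\<mu> K) powr \<kappa> / m)))"
          using m_pos m_less_1 B moment_const_nonneg j ng g1 \<kappa>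
          by (intro mult_mono add_mono mult_left_mono divide_right_mono powr_mono2 power_le_one) (auto intro!: add_nonneg_nonneg mult_nonneg_nonneg)
        finally show ?thesis by (simp add: u_def)
      qed
      have large_j: "fps_nth (F (big_at M j \<inter> reach h)) n \<le> m ^ j * (B * pmf \<xi> n)" for j
      proof -
        have "fps_nth (F (big_at M j \<inter> reach h)) n \<le> fps_nth (F (big_at M j)) n"
          by (intro F_mono) (auto intro!: sets_big_at)
        also have "\<dots> \<le> m ^ j * (2 * (C * pmf \<xi> n) * renewal_const)"
          by (rule coeff_leD(2)[OF big_at_bound]) (use pk in auto)
        finally show ?thesis by (simp add: B_def mult_ac)
      qed
      define \<beta> where "\<beta> = (\<lambda>j. (if j \<in> {..<J} then u else 0) + (if j < J then 0 else m ^ j * (B * pmf \<xi> n)))"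
      have s1: "(\<lambda>j. if j \<in> {..<J} then u else 0) sums (\<Sum>j\<in>{..<J}. u)"
        by (rule sums_If_finite_set) simp
      have "(\<lambda>j. m ^ j * (m ^ J * (B * pmf \<xi> n))) sums (1 / (1 - m) * (m ^ J * (B * pmf \<xi> n)))"
        using m_pos m_less_1 by (intro sums_mult2 geometric_sums) auto
      hence "(\<lambda>j. (\<lambda>j. if j < J then 0 else m ^ j * (B * pmf \<xi> n)) (j + J)) sums (1 / (1 - m) * (m ^ J * (B * pmf \<xi> n)))"
        by (simp add: power_add mult_ac)
      hence s2: "(\<lambda>j. if j < J then 0 else m ^ j * (B * pmf \<xi> n)) sums (1 / (1 - m) * (m ^ J * (B * pmf \<xi> n)))"
        by (subst (asm) sums_zero_iff_shift) auto
      have \<beta>s: "\<beta> sums ((\<Sum>j\<in>{..<J}. u) + 1 / (1 - m) * (m ^ J * (B * pmf \<xi> n)))"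
        unfolding \<beta>_def by (rule sums_add[OF s1 s2])
      have \<beta>le: "fps_nth (F (big_at M j \<inter> reach h)) n \<le> \<beta> j" for j
        using small_j[of j] large_j[of j] by (auto simp: \<beta>_def)
      have "prob (count n \<inter> reach h) \<le> prob (count n \<inter> no_big M) + ((\<Sum>j\<in>{..<J}. u) + 1 / (1 - m) * (m ^ J * (B * pmf \<xi> n)))"
        by (rule union_over_big[OF sets_reach \<beta>le \<beta>s])
      also have "(\<Sum>j\<in>{..<J}. u) + 1 / (1 - m) * (m ^ J * (B * pmf \<xi> n)) = pmf \<xi> n * (\<phi> K + m ^ J * B / (1 - m))"
        by (simp add: u_def \<phi>_def algebra_simps)
      also have "\<phi> K + m ^ J * B / (1 - m) \<le> \<epsilon> * c / 3 + \<epsilon> * c / 3" using K J by simp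
      also have "prob (count n \<inter> no_big M) \<le> pmf \<xi> n * (1 / real n)" using elim by (simp add: M_def)
      also have "1 / real n \<le> \<epsilon> * c / 3" using elim by simp
      finally have "prob (count n \<inter> reach h) \<le> pmf \<xi> n * (\<epsilon> * c / 3) + pmf \<xi> n * (\<epsilon> * c / 3 + \<epsilon> * c / 3)"
        by (simp add: mult_left_mono)
      also have "\<dots> = \<epsilon> * (c * pmf \<xi> n)" by (simp add: algebra_simps)
      also have "\<dots> \<le> \<epsilon> * prob (count n)" using elim \<epsilon> by (intro mult_left_mono) (auto simp: F_nth)
      finally show "prob (count n \<inter> reach h) \<le> \<epsilon> * prob (count n)" .
    qed
  qed
  thus ?thesis by blast
qed

end

lemma length_image_tree_of:
  "(\<lambda>v. length v) ` tree_of c = {h. c \<in> reach h}"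
  by (auto simp: reach_def)

text \<open>
  The height is a function of the set of occupied levels, which is an initial segment of the naturals or all of them;
  so it takes countably many values.  This covers infinite trees, where \<^const>\<open>Max\<close> is just some fixed value.
\<close>

lemma measurable_tree_height:
  "(\<lambda>c. tree_height (tree_of c)) \<in> measurable (gw_space \<xi>) (count_space UNIV)"
proof -
  define S where "S = (\<lambda>c. {h. c \<in> reach h})"
  define \<S> where "\<S> = insert UNIV (range lessThan :: nat set set)"
  have S_in: "S c \<in> \<S>" for c
  proof (cases "\<forall>h. c \<in> reach h")
    case True
    thus ?thesis by (simp add: S_def \<S>_def)
  next
    case False
    define H where "H = (LEAST h. c \<notin> reach h)"
    have "c \<notin> reach H" unfolding H_def using False by (metis LeastI)
    hence "c \<in> reach h \<longleftrightarrow> h < H" for h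
      using not_less_Least[of h "\<lambda>h. c \<notin> reach h"] reach_antimono[of H h] unfolding H_def by (meson not_less subsetD)
    thus ?thesis by (auto simp: S_def \<S>_def lessThan_def)
  qed
  have countable_\<S>: "countable \<S>" by (simp add: \<S>_def)
  have ev: "{c. S c = s} \<in> sets (gw_space \<xi>)" for s
  proof -
    have [measurable]: "reach h \<in> sets (gw_space \<xi>)" for h by (rule sets_reach)
    have "{c \<in> space (gw_space \<xi>). \<forall>h. c \<in> reach h \<longleftrightarrow> h \<in> s} \<in> sets (gw_space \<xi>)" by measurable
    also have "{c \<in> space (gw_space \<xi>). \<forall>h. c \<in> reach h \<longleftrightarrow> h \<in> s} = {c. S c = s}" by (auto simp: S_def)
    finally show ?thesis .
  qed
  show ?thesis
  proof (subst measurable_count_space_eq2_countable, intro conjI ballI)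
    fix x
    have "(\<lambda>c. tree_height (tree_of c)) -` {x} \<inter> space (gw_space \<xi>) = (\<Union>s\<in>{s \<in> \<S>. Max s = x}. {c. S c = s})"
      using S_in by (auto simp: tree_height_def length_image_tree_of S_def)
    also have "\<dots> \<in> sets (gw_space \<xi>)"
      using countable_\<S> ev by (intro sets.countable_UN'') auto
    finally show "(\<lambda>c. tree_height (tree_of c)) -` {x} \<inter> space (gw_space \<xi>) \<in> sets (gw_space \<xi>)" .
  qed auto
qed

lemma real_distribution_symmetric_interval:
  assumes "real_distribution \<mu>" "\<epsilon> > 0"
  shows "\<exists>b>0. \<forall>b'\<ge>b. measure \<mu> {- b'<..b'} > 1 - \<epsilon>"
proof -
  interpret real_distribution \<mu> by fact
  have "(\<lambda>i. measure \<mu> {- real i<..real i}) \<longlonglongrightarrow> measure \<mu> (\<Union>i. {- real i<..real i})"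
    by (intro Lim_measure_incseq) (auto simp: incseq_def emeasure_eq_measure)
  also have "(\<Union>i. {- real i<..real i}) = UNIV"
  proof (intro equalityI subsetI)
    fix x :: real
    obtain i :: nat where "real i > \<bar>x\<bar>" using reals_Archimedean2 by blast
    hence "x \<in> {- real i<..real i}" by auto
    thus "x \<in> (\<Union>i. {- real i<..real i})" by blast
  qed auto
  also have "measure \<mu> UNIV = 1" using prob_space by simp
  finally have "\<forall>\<^sub>F i in sequentially. measure \<mu> {- real i<..real i} > 1 - \<epsilon>"
    using assms(2) by (intro order_tendstoD) auto
  then obtain i where i: "\<And>j. j \<ge> i \<Longrightarrow> measure \<mu> {- real j<..real j} > 1 - \<epsilon>" by (auto simp: eventually_sequentially)
  show ?thesis
  proof (intro exI[of _ "real (Suc i)"] conjI allI impI)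
    fix b' assume "b' \<ge> real (Suc i)"
    hence "measure \<mu> {- real (Suc i)<..real (Suc i)} \<le> measure \<mu> {- b'<..b'}"
      by (intro finite_measure_mono) auto
    thus "measure \<mu> {- b'<..b'} > 1 - \<epsilon>" using i[of "Suc i"] by simp
  qed auto
qed

text \<open>
  Each of the finitely many exceptional distributions is tight by itself.
\<close>

lemma tight_if_eventually:
  assumes rd: "\<And>k. real_distribution (\<mu> k)"
    and ev: "\<And>\<epsilon>. \<epsilon> > 0 \<Longrightarrow> \<exists>b. \<forall>\<^sub>F k in sequentially. measure (\<mu> k) {- b<..b} > 1 - \<epsilon>"
  shows "tight \<mu>"
  unfolding tight_def
proof (intro conjI allI impI rd)
  fix \<epsilon> :: real assume \<epsilon>: "\<epsilon> > 0"
  obtain b N where bN: "\<And>k. k \<ge> N \<Longrightarrow> measure (\<mu> k) {- b<..b} > 1 - \<epsilon>"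
    using ev[OF \<epsilon>] by (auto simp: eventually_sequentially)
  have "\<forall>k. \<exists>b>0. \<forall>b'\<ge>b. measure (\<mu> k) {- b'<..b'} > 1 - \<epsilon>"
    using real_distribution_symmetric_interval[OF rd \<epsilon>] by blast
  then obtain B where B: "\<And>k. B k > 0" "\<And>k b'. b' \<ge> B k \<Longrightarrow> measure (\<mu> k) {- b'<..b'} > 1 - \<epsilon>" by metis
  define b' where "b' = max 1 (max b (\<Sum>k<N. B k))"
  have "measure (\<mu> k) {- b'<..b'} > 1 - \<epsilon>" for k
  proof (cases "k < N")
    case True
    have "B k \<le> (\<Sum>k<N. B k)" using True B(1) by (intro member_le_sum) (auto intro: less_imp_le)
    thus ?thesis by (intro B(2)) (simp add: b'_def)
  next
    case False
    interpret real_distribution "\<mu> k" by (rule rd)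
    have "measure (\<mu> k) {- b<..b} \<le> measure (\<mu> k) {- b'<..b'}"
      by (intro finite_measure_mono) (auto simp: b'_def)
    thus ?thesis using bN[of k] False by simp
  qed
  thus "\<exists>a b. a < b \<and> (\<forall>k. measure (\<mu> k) {a<..b} > 1 - \<epsilon>)"
    by (intro exI[of _ "- b'"] exI[of _ b']) (auto simp: b'_def)
qed

context condensation_gw
begin

lemma cond_gw_space_eq: "cond_gw_space \<xi> \<Omega> n = uniform_measure (gw_space \<xi>) (count n)"
  by (simp add: cond_gw_space_def count_event_def)

lemma prob_space_cond_gw_space:
  assumes "prob (count n) > 0"
  shows "prob_space (cond_gw_space \<xi> \<Omega> n)"
  unfolding cond_gw_space_eq using assms by (intro prob_space_uniform_measure) (auto simp: emeasure_eq_measure)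

text \<open>
  On an infinite tree the height is meaningless, but such a tree reaches every level and so is covered by the upper
  tail bound.
\<close>

lemma conditioned_height_concentrated:
  assumes \<epsilon>: "\<epsilon> > 0"
  shows "\<exists>b. \<forall>\<^sub>F n in sequentially. 
    measure (cond_gw_space \<xi> \<Omega> n) {c. real (tree_height (tree_of c)) - ln (real n) / ln (1 / m) \<in> {- b<..b}} > 1 - \<epsilon>"
proof -
  define Hn where "Hn = (\<lambda>(n::nat) c. real (tree_height (tree_of c)) - ln (real n) / ln (1 / m))"
  have e3: "\<epsilon> / 3 > 0" using \<epsilon> by simp
  obtain K1 where K1: "\<forall>\<^sub>F n in sequentially. \<forall>h. real h \<le> ln (real n) / ln (1 / m) - K1 \<longrightarrow>
           prob (count n \<inter> - reach h) \<le> \<epsilon> / 3 * prob (count n)"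
    using conditioned_height_low[OF e3] by blast
  obtain K2 where K2: "\<forall>\<^sub>F n in sequentially. \<forall>h. real h \<ge> ln (real n) / ln (1 / m) + K2 \<longrightarrow>
           prob (count n \<inter> reach h) \<le> \<epsilon> / 3 * prob (count n)"
    using conditioned_height_high[OF e3] by blast
  define b where "b = \<bar>K1\<bar> + \<bar>K2\<bar> + 2"
  have "\<forall>\<^sub>F n in sequentially. measure (cond_gw_space \<xi> \<Omega> n) {c. Hn n c \<in> {- b<..b}} > 1 - \<epsilon>"
    using K1 K2 F_UNIV_eventually_pos eventually_ge_at_top[of 1]
  proof eventually_elim
    case (elim n)
    have pos: "prob (count n) > 0" using elim by (simp add: F_nth)
    interpret C: prob_space "cond_gw_space \<xi> \<Omega> n" by (rule prob_space_cond_gw_space[OF pos])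
    define L where "L = ln (real n) / ln (1 / m)"
    have L0: "L \<ge> 0" using m_pos m_less_1 elim by (simp add: L_def)
    have [measurable]: "(\<lambda>c. tree_height (tree_of c)) \<in> measurable (gw_space \<xi>) (count_space UNIV)"
      by (rule measurable_tree_height)
    have "{c \<in> space (gw_space \<xi>). Hn n c \<in> {- b<..b}} \<in> events" unfolding Hn_def by measurable
    hence Gev: "{c. Hn n c \<in> {- b<..b}} \<in> events" by simp
    define E where "E = - {c. Hn n c \<in> {- b<..b}}"
    have Eev: "E \<in> events" unfolding E_def by (rule compl_events[OF Gev])
    define h1 where "h1 = (if L - \<bar>K1\<bar> - 1 \<ge> 0 then Suc (nat \<lfloor>L - \<bar>K1\<bar> - 1\<rfloor>) else 0)"
    define h2 where "h2 = nat \<lceil>L + \<bar>K2\<bar>\<rceil>"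
    have sub: "count n \<inter> E \<subseteq> (count n \<inter> - reach h1) \<union> (count n \<inter> reach h2)"
    proof
      fix c assume c: "c \<in> count n \<inter> E"
      show "c \<in> (count n \<inter> - reach h1) \<union> (count n \<inter> reach h2)"
      proof (cases "finite (tree_of c)")
        case False
        thus ?thesis using c finite_tree_of by blast
      next
        case True
        define H where "H = tree_height (tree_of c)"
        have iff: "H < h \<longleftrightarrow> c \<notin> reach h" for h unfolding H_def by (rule tree_height_less_iff[OF True])
        consider "real H - L \<le> - b" | "real H - L > b" using c by (force simp: E_def Hn_def H_def L_def)
        thus ?thesis
        proof cases
          case 1
          hence "real H \<le> L - \<bar>K1\<bar> - 1" by (simp add: b_def)
          moreover from this have "L - \<bar>K1\<bar> - 1 \<ge> 0" using of_nat_0_le_iff[of H, where 'a = real] by linarith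
          ultimately have "h1 = Suc (nat \<lfloor>L - \<bar>K1\<bar> - 1\<rfloor>)" "H \<le> nat \<lfloor>L - \<bar>K1\<bar> - 1\<rfloor>"
            by (simp only: h1_def if_True, intro le_nat_floor)
          hence "H < h1" by linarith
          thus ?thesis using c iff by auto
        next
          case 2
          hence "real H > L + \<bar>K2\<bar> + 1" by (simp add: b_def)
          hence "\<not> H < h2" unfolding h2_def by linarith
          thus ?thesis using c iff by auto
        qed
      qed
    qed
    have low: "prob (count n \<inter> - reach h1) \<le> \<epsilon> / 3 * prob (count n)"
    proof (cases "L - \<bar>K1\<bar> - 1 \<ge> 0")
      case True
      hence "real h1 \<le> L - K1" unfolding h1_def by simp linarith
      thus ?thesis using elim(1) by (simp add: L_def)
    next
      case False
      hence "count n \<inter> - reach h1 = {}" by (simp add: h1_def)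
      thus ?thesis using \<epsilon> pos by simp
    qed
    have "real h2 \<ge> L + K2" using L0 unfolding h2_def by linarith
    hence high: "prob (count n \<inter> reach h2) \<le> \<epsilon> / 3 * prob (count n)" using elim(2) by (simp add: L_def)
    have "prob (count n \<inter> E) \<le> prob ((count n \<inter> - reach h1) \<union> (count n \<inter> reach h2))"
      by (intro finite_measure_mono sub sets.Un sets.Int sets_count_event compl_events sets_reach)
    also have "\<dots> \<le> prob (count n \<inter> - reach h1) + prob (count n \<inter> reach h2)"
      by (intro measure_Un_le sets.Int sets_count_event compl_events sets_reach)
    also have "\<dots> \<le> \<epsilon> / 3 * prob (count n) + \<epsilon> / 3 * prob (count n)" using low high by (rule add_mono)
    finally have "prob (count n \<inter> E) / prob (count n) \<le> 2 * \<epsilon> / 3" using pos by (simp add: field_simps)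
    also have "prob (count n \<inter> E) / prob (count n) = measure (cond_gw_space \<xi> \<Omega> n) E"
      unfolding cond_gw_space_eq using pos by (subst measure_uniform_measure[OF _ _ Eev]) (auto simp: emeasure_eq_measure)
    finally have "C.prob E \<le> 2 * \<epsilon> / 3" .
    moreover have "C.prob E = 1 - C.prob {c. Hn n c \<in> {- b<..b}}"
    proof -
      have "space (cond_gw_space \<xi> \<Omega> n) = UNIV" "{c. Hn n c \<in> {- b<..b}} \<in> sets (cond_gw_space \<xi> \<Omega> n)"
        using Gev by (auto simp: cond_gw_space_eq)
      thus ?thesis using C.prob_compl[of "{c. Hn n c \<in> {- b<..b}}"] by (simp add: E_def Compl_eq_Diff_UNIV)
    qed
    ultimately show ?case using \<epsilon> by simp
  qed
  thus ?thesis unfolding Hn_def by (rule exI)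
qed

lemma conditioned_height_tight:
  "\<exists>n\<^sub>0.
    (\<forall>n\<ge>n\<^sub>0. prob_space (cond_gw_space \<xi> \<Omega> n)) \<and>
    tight (\<lambda>k. distr (cond_gw_space \<xi> \<Omega> (n\<^sub>0 + k)) borel
      (\<lambda>c. real (tree_height (tree_of c)) - ln (real (n\<^sub>0 + k)) / ln (1 / m)))"
proof -
  obtain n0 where n0: "\<And>n. n \<ge> n0 \<Longrightarrow> prob (count n) > 0"
    using F_UNIV_eventually_pos by (auto simp: eventually_sequentially F_nth)
  have ps: "prob_space (cond_gw_space \<xi> \<Omega> n)" if "n \<ge> n0" for n
    by (rule prob_space_cond_gw_space[OF n0[OF that]])
  have rv: "(\<lambda>c. real (tree_height (tree_of c)) - x) \<in> borel_measurable (cond_gw_space \<xi> \<Omega> n)" for n x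
  proof -
    note [measurable] = measurable_tree_height[of \<xi>]
    have "(\<lambda>c. real (tree_height (tree_of c)) - x) \<in> borel_measurable (gw_space \<xi>)" by measurable
    thus ?thesis unfolding cond_gw_space_eq by simp
  qed
  show ?thesis
  proof (intro exI[of _ n0] conjI allI impI ps tight_if_eventually)
    show "real_distribution (distr (cond_gw_space \<xi> \<Omega> (n0 + k)) borel
      (\<lambda>c. real (tree_height (tree_of c)) - ln (real (n0 + k)) / ln (1 / m)))" for k
      by (intro prob_space.real_distribution_distr ps rv) auto
    fix \<epsilon> :: real assume "\<epsilon> > 0"
    from conditioned_height_concentrated[OF this] obtain b where b: "\<forall>\<^sub>F n in sequentially. 
      measure (cond_gw_space \<xi> \<Omega> n) {c. real (tree_height (tree_of c)) - ln (real n) / ln (1 / m) \<in> {- b<..b}} > 1 - \<epsilon>"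
      by blast
    then obtain N where N: "\<And>n. n \<ge> N \<Longrightarrow> measure (cond_gw_space \<xi> \<Omega> n)
        {c. real (tree_height (tree_of c)) - ln (real n) / ln (1 / m) \<in> {- b<..b}} > 1 - \<epsilon>"
      by (auto simp only: eventually_sequentially)
    have "\<forall>\<^sub>F k in sequentially. measure (cond_gw_space \<xi> \<Omega> (n0 + k)) 
      {c. real (tree_height (tree_of c)) - ln (real (n0 + k)) / ln (1 / m) \<in> {- b<..b}} > 1 - \<epsilon>"
      using eventually_ge_at_top[of N] by (rule eventually_mono) (rule N, simp)
    moreover have "measure (distr (cond_gw_space \<xi> \<Omega> (n0 + k)) borel
        (\<lambda>c. real (tree_height (tree_of c)) - ln (real (n0 + k)) / ln (1 / m))) {- b<..b} =
      measure (cond_gw_space \<xi> \<Omega> (n0 + k))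
        {c. real (tree_height (tree_of c)) - ln (real (n0 + k)) / ln (1 / m) \<in> {- b<..b}}" for k
      by (subst measure_distr[OF rv]) (auto simp: vimage_def cond_gw_space_eq)
    ultimately show "\<exists>b. \<forall>\<^sub>F k in sequentially. measure (distr (cond_gw_space \<xi> \<Omega> (n0 + k)) borel
      (\<lambda>c. real (tree_height (tree_of c)) - ln (real (n0 + k)) / ln (1 / m))) {- b<..b} > 1 - \<epsilon>"
      by (intro exI[of _ b]) (simp only:)
  qed simp
qed

end

lemma pmf_mean_sums:
  fixes \<xi> :: "nat pmf"
  assumes "integrable (measure_pmf \<xi>) real"
  shows "(\<lambda>k. pmf \<xi> k * real k) sums measure_pmf.expectation \<xi> real"
proof -
  have "integrable (density (count_space UNIV) (pmf \<xi>)) real"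
    using assms by (simp add: measure_pmf_eq_density)
  hence "integrable (count_space UNIV) (\<lambda>k. pmf \<xi> k *\<^sub>R real k)"
    by (subst (asm) integrable_density) auto
  hence "(\<lambda>k. pmf \<xi> k *\<^sub>R real k) sums (\<integral>k. pmf \<xi> k *\<^sub>R real k \<partial>count_space UNIV)"
    by (rule sums_integral_count_space_nat)
  also have "(\<integral>k. pmf \<xi> k *\<^sub>R real k \<partial>count_space UNIV) = measure_pmf.expectation \<xi> real"
    unfolding measure_pmf_eq_density by (subst integral_density) auto
  finally show ?thesis by simp
qed

theorem corollary1p6:
  fixes \<xi> :: "nat pmf" and f :: "real \<Rightarrow> real" and \<alpha> :: real and \<Omega> :: "nat set"
  assumes "pmf \<xi> 0 > 0"
    and "measure_pmf.prob \<xi> {..1} < 1"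
    and "integrable (measure_pmf \<xi>) real"
    and "measure_pmf.expectation \<xi> real < 1"
    and "\<alpha> > 1"
    and "slowly_varying f"
    and "\<forall>\<^sub>F n in sequentially. pmf \<xi> n = f (real n) * real n powr (- 1 - \<alpha>)"
    and "\<Omega> \<noteq> {}"
    and "measure_pmf.prob \<xi> \<Omega> > 0"
    and "finite \<Omega> \<or> finite (- \<Omega>)"
  shows "\<exists>n\<^sub>0.
    (\<forall>n\<ge>n\<^sub>0. prob_space (cond_gw_space \<xi> \<Omega> n)) \<and>
    tight (\<lambda>k. distr (cond_gw_space \<xi> \<Omega> (n\<^sub>0 + k)) borel
      (\<lambda>c. real (tree_height (tree_of c)) -
            ln (real (n\<^sub>0 + k)) / ln (1 / measure_pmf.expectation \<xi> real)))"
proof -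
  define m where "m = measure_pmf.expectation \<xi> real"
  obtain \<kappa> where \<kappa>: "\<kappa> > 0" "\<kappa> \<le> 1" "summable (\<lambda>k. pmf \<xi> k * real k powr (1 + \<kappa>))"
    using regular_tail_moment[OF assms(6,5,7)] by blast
  have lower: "\<forall>\<^sub>F n in sequentially. pmf \<xi> n \<ge> real n powr (- (2 + \<alpha>))"
    using regular_tail_lower[OF assms(6,7)] by simp
  have mean: "(\<lambda>k. pmf \<xi> k * real k) sums m"
    unfolding m_def by (rule pmf_mean_sums[OF assms(3)])
  have m_pos: "m > 0"
  proof (rule ccontr)
    assume "\<not> m > 0"
    have nn: "0 \<le> pmf \<xi> k * real k" for k by simp
    have z: "pmf \<xi> k * real k = 0" for k
    proof -
      have "pmf \<xi> k * real k \<le> (\<Sum>j<Suc k. pmf \<xi> j * real j)" using nn by (simp add: sum_nonneg)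
      also have "\<dots> \<le> m" by (rule partial_sum_le_sums[OF mean nn])
      finally show ?thesis using \<open>\<not> m > 0\<close> nn[of k] by linarith
    qed
    have sub: "x \<le> 1" if "x \<in> set_pmf \<xi>" for x
      using z[of x] that by (simp add: set_pmf_iff)
    have "AE x in measure_pmf \<xi>. x \<in> {..1}"
      unfolding AE_measure_pmf_iff using sub by simp
    hence "measure_pmf.prob \<xi> {..1} = 1" by (subst measure_pmf.prob_eq_1) auto
    thus False using assms(2) by simp
  qed
  have Om: "\<exists>a\<in>\<Omega>. pmf \<xi> a > 0"
  proof (rule ccontr)
    assume "\<not> ?thesis"
    hence "\<Omega> \<inter> set_pmf \<xi> = {}" by (auto simp: set_pmf_iff pmf_pos)
    hence "measure_pmf.prob \<xi> \<Omega> = 0" by (simp add: measure_pmf_zero_iff Int_commute)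
    thus False using assms(9) by simp
  qed
  interpret condensation_gw \<xi> \<Omega> m \<kappa>
  proof unfold_locales
    show "\<exists>A>0. \<forall>\<^sub>F n in sequentially. pmf \<xi> n \<ge> real n powr (- A)"
      using lower assms(5) by (intro exI[of _ "2 + \<alpha>"]) auto
    show "m < 1" using assms(4) by (simp add: m_def)
  qed (use assms(1,10) \<kappa> mean m_pos Om regular_tail_compare[OF assms(6,5,7)] in auto)
  show ?thesis using conditioned_height_tight unfolding m_def .
qed

end
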